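(* Let an $r$-regular wavelet basis ($r$-RWB) be given and let $f$ be a probability density belonging to the class $\mathcal{S}([-1,1],d(r),\Delta_1,\Delta_2,N_S)$. Let $\xi=\xi_{d(r)+2}$, where for $\tau\in\mathbb{N}$ $$\xi_\tau(x)=\frac{(2\tau+3)!}{[(\tau+1)!]^2}\,3^{-(2\tau+3)}(1.5-x)^{\tau+1}(1.5+x)^{\tau+1}\,\mathbf{1}_{[-1.5,1.5]}(x).$$ Then for all $0<\pi<1$ the function $f_\pi=(1-\pi)f+\pi\xi$ is regular with constant $C=\pi\,\xi(1.25)/2$; that is, there exists $N=N(f,\xi,\pi)$ such that for all $j\ge N$ $$\left(\int_{\mathbb{R}}(Q_jf_\pi(x))^2f_\pi(x)\,dx\right)^{1/2}\ge\sqrt{\pi\,\xi(1.25)/2}\;\|Q_jf_\pi\|_2.$$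
   Context: **Wavelets.** Let $r\ge1$ be an integer. An $r$-regular wavelet basis ($r$-RWB) consists of a scaling function $\phi$ of a multiresolution analysis of $L^2(\mathbb{R})$ and the associated orthonormal real-valued wavelet $\psi$, both of class $C^r$ and compactly supported; we assume $\mathrm{supp}\,\psi=[0,S(r)]$ with $S(r)\in\mathbb{N}$. Put $\psi_{j,k}(x)=2^{j/2}\psi(2^jx-k)$. The integer $d(r)\ge r$ is the one for which $\int_{\mathbb{R}}x^k\psi(x)\,dx=0$ for $0\le k\le d(r)$ and $\int_{\mathbb{R}}x^{d(r)+1}\psi(x)\,dx\ne0$. For $j\ge0$ let $G_j(x,y)=\sum_{k\in\mathbb{Z}}\psi_{j,k}(x)\psi_{j,k}(y)$ and $Q_jf(x)=\int_{\mathbb{R}}G_j(x,y)f(y)\,dy$. $\|\cdot\|_p$ is the norm of $L^p(\mathbb{R})$. **Piecewise-smooth functions.** A function $f$ is piecewise-smooth with index $id(f)=m\ge0$ ($m$ an integer) if $f\in C^{m-1}(\mathbb{R})$ when $m\ge1$, and there exist $n\in\mathbb{N}$ and points $a_1<\dots<a_n$ (the defect points) such that $f\notin C^m(\{a_i\})$ for some $i$ and $f\in C^{m+1}$ on each of $(-\infty,a_1]$, $[a_i,a_{i+1}]$ ($i=1,\dots,n-1$), $[a_n,\infty)$. Here membership in $C^{m+1}$ of a closed interval means that the restriction to the interior extends to a $C^{m+1}$ function on the closed interval, and $f\notin C^m(\{a\})$ means $f^{(m)}(a^-)\neq f^{(m)}(a^+)$. **The class $\mathcal{S}$.** For $0<\Delta_1\le\Delta_2$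 and $N_S\in\mathbb{N}$, $f\in\mathcal{S}([-1,1],d(r),\Delta_1,\Delta_2,N_S)$ means: $\mathrm{supp}\,f\subset[-1,1]$; $f$ is piecewise-smooth with $id(f)=m\le d(r)$; for each defect point $d$ of $f$, $\Delta_1\le|f^{(m)}(d^-)-f^{(m)}(d^+)|\le\Delta_2$; and the number of defect points is at most $N_S$. **Regularity.** A bounded compactly supported function $g$ is regular (for the given $r$-RWB) with constant $C>0$ if there is $N$ such that for all $j\ge N$, $C\int_{\mathbb{R}}|Q_jg(x)|^2dx\le\int_{\mathbb{R}}(Q_jg(x))^2g(x)\,dx$. *)

theory Defs
  imports "HOL-Analysis.Analysis"
begin

text \<open>Elements of \<open>L\<^sup>2(\<real>)\<close> are represented by Borel functions, without passing to classes
  modulo null sets; closed subspaces are therefore saturated under almost-everywhere equality.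
  Scalars are real, since the wavelets are real-valued.\<close>

definition L2 :: "(real \<Rightarrow> real) set" where
  "L2 = {f. f \<in> borel_measurable borel \<and> integrable lborel (\<lambda>x. (f x)\<^sup>2)}"

definition L2_inner :: "(real \<Rightarrow> real) \<Rightarrow> (real \<Rightarrow> real) \<Rightarrow> real" where
  "L2_inner f g = (LINT x|lborel. f x * g x)"

definition L2_norm :: "(real \<Rightarrow> real) \<Rightarrow> real" where
  "L2_norm f = sqrt (LINT x|lborel. (f x)\<^sup>2)"

definition L2_closed_subspace :: "(real \<Rightarrow> real) set \<Rightarrow> bool" where
  "L2_closed_subspace V \<longleftrightarrow>
     V \<subseteq> L2 \<and> (\<lambda>x. 0) \<in> V \<and>
     (\<forall>f\<in>V. \<forall>g\<in>V. (\<lambda>x. f x + g x) \<in> V) \<and>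
     (\<forall>c. \<forall>f\<in>V. (\<lambda>x. c * f x) \<in> V) \<and>
     (\<forall>f\<in>L2. (\<forall>\<epsilon>>0. \<exists>g\<in>V. L2_norm (\<lambda>x. f x - g x) < \<epsilon>) \<longrightarrow> f \<in> V)"

definition L2_orthonormal_basis :: "(real \<Rightarrow> real) set \<Rightarrow> (int \<Rightarrow> real \<Rightarrow> real) \<Rightarrow> bool" where
  "L2_orthonormal_basis V e \<longleftrightarrow>
     (\<forall>k. e k \<in> V) \<and>
     (\<forall>k l. L2_inner (e k) (e l) = (if k = l then 1 else 0)) \<and>
     (\<forall>f\<in>V. \<forall>\<epsilon>>0. \<exists>K c. finite K \<and> L2_norm (\<lambda>x. f x - (\<Sum>k\<in>K. c k * e k x)) < \<epsilon>)"

text \<open>For an interval \<open>S\<close> with more than one point, \<open>f\<close> is of class \<open>C\<^sup>k\<close> on \<open>S\<close>, with one-sided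
  derivatives at endpoints belonging to \<open>S\<close>; \<open>D i\<close> is the \<open>i\<close>-th derivative.\<close>

definition C_k_on :: "nat \<Rightarrow> (real \<Rightarrow> real) \<Rightarrow> real set \<Rightarrow> bool" where
  "C_k_on k f S \<longleftrightarrow>
     (\<exists>D :: nat \<Rightarrow> real \<Rightarrow> real.
        (\<forall>x\<in>S. D 0 x = f x) \<and>
        (\<forall>i<k. \<forall>x\<in>S. (D i has_real_derivative D (Suc i) x) (at x within S)) \<and>
        continuous_on S (D k))"

text \<open>The values of \<open>f\<close> itself at the endpoints are irrelevant here.\<close>

definition C_k_extends :: "nat \<Rightarrow> (real \<Rightarrow> real) \<Rightarrow> real set \<Rightarrow> bool" where
  "C_k_extends k f I \<longleftrightarrow> (\<exists>g. C_k_on k g I \<and> (\<forall>x\<in>interior I. g x = f x))"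

definition supp :: "(real \<Rightarrow> real) \<Rightarrow> real set" where
  "supp f = closure {x. f x \<noteq> 0}"

definition multiresolution :: "(int \<Rightarrow> (real \<Rightarrow> real) set) \<Rightarrow> (real \<Rightarrow> real) \<Rightarrow> bool" where
  "multiresolution V \<phi> \<longleftrightarrow>
     (\<forall>j. L2_closed_subspace (V j)) \<and>
     (\<forall>j. V j \<subseteq> V (j + 1)) \<and>
     (\<Inter>j. V j) = {f \<in> L2. AE x in lborel. f x = 0} \<and>
     (\<forall>f\<in>L2. \<forall>\<epsilon>>0. \<exists>j. \<exists>g\<in>V j. L2_norm (\<lambda>x. f x - g x) < \<epsilon>) \<and>
     (\<forall>j f. f \<in> V j \<longleftrightarrow> (\<lambda>x. f (2 * x)) \<in> V (j + 1)) \<and>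
     L2_orthonormal_basis (V 0) (\<lambda>k x. \<phi> (x - of_int k))"

definition associated_wavelet :: "(int \<Rightarrow> (real \<Rightarrow> real) set) \<Rightarrow> (real \<Rightarrow> real) \<Rightarrow> bool" where
  "associated_wavelet V \<psi> \<longleftrightarrow>
     L2_orthonormal_basis {f \<in> V 1. \<forall>g\<in>V 0. L2_inner f g = 0} (\<lambda>k x. \<psi> (x - of_int k))"

definition RWB :: "nat \<Rightarrow> nat \<Rightarrow> (real \<Rightarrow> real) \<Rightarrow> (real \<Rightarrow> real) \<Rightarrow> bool" where
  "RWB r S \<phi> \<psi> \<longleftrightarrow>
     r \<ge> 1 \<and>
     (\<exists>V. multiresolution V \<phi> \<and> associated_wavelet V \<psi>) \<and>
     C_k_on r \<phi> UNIV \<and> C_k_on r \<psi> UNIV \<and>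
     compact (supp \<phi>) \<and> supp \<psi> = {0..real S}"

definition vanishing_order :: "nat \<Rightarrow> (real \<Rightarrow> real) \<Rightarrow> nat \<Rightarrow> bool" where
  "vanishing_order r \<psi> d \<longleftrightarrow>
     r \<le> d \<and> (\<forall>k\<le>d. (LINT x|lborel. x ^ k * \<psi> x) = 0) \<and>
     (LINT x|lborel. x ^ (d + 1) * \<psi> x) \<noteq> 0"

definition wavelet :: "(real \<Rightarrow> real) \<Rightarrow> nat \<Rightarrow> int \<Rightarrow> real \<Rightarrow> real" where
  "wavelet \<psi> j k x = 2 powr (real j / 2) * \<psi> (2 ^ j * x - of_int k)"

text \<open>For compactly supported \<open>\<psi>\<close> only finitely many terms of the sum are nonzero.\<close>

definition G_kernel :: "(real \<Rightarrow> real) \<Rightarrow> nat \<Rightarrow> real \<Rightarrow> real \<Rightarrow> real" where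
  "G_kernel \<psi> j x y = (\<Sum>\<^sub>\<infinity>k\<in>UNIV. wavelet \<psi> j k x * wavelet \<psi> j k y)"

definition Q_proj :: "(real \<Rightarrow> real) \<Rightarrow> nat \<Rightarrow> (real \<Rightarrow> real) \<Rightarrow> real \<Rightarrow> real" where
  "Q_proj \<psi> j f x = (LINT y|lborel. G_kernel \<psi> j x y * f y)"

definition left_deriv :: "nat \<Rightarrow> (real \<Rightarrow> real) \<Rightarrow> real \<Rightarrow> real" where
  "left_deriv m f a = Lim (at_left a) ((deriv ^^ m) f)"

definition right_deriv :: "nat \<Rightarrow> (real \<Rightarrow> real) \<Rightarrow> real \<Rightarrow> real" where
  "right_deriv m f a = Lim (at_right a) ((deriv ^^ m) f)"

text \<open>\<open>f\<close> is piecewise-smooth with index \<open>m\<close> and defect points \<open>a 1 < \<dots> < a n\<close>. The limits in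
  \<open>left_deriv\<close> and \<open>right_deriv\<close> exist by the last three conjuncts. That \<open>n \<ge> 1\<close> follows from
  the existence of a genuine defect.\<close>

definition piecewise_smooth :: "(real \<Rightarrow> real) \<Rightarrow> nat \<Rightarrow> nat \<Rightarrow> (nat \<Rightarrow> real) \<Rightarrow> bool" where
  "piecewise_smooth f m n a \<longleftrightarrow>
     (m \<ge> 1 \<longrightarrow> C_k_on (m - 1) f UNIV) \<and>
     strict_mono_on {1..n} a \<and>
     (\<exists>i\<in>{1..n}. left_deriv m f (a i) \<noteq> right_deriv m f (a i)) \<and>
     C_k_extends (m + 1) f {..a 1} \<and>
     (\<forall>i\<in>{1..<n}. C_k_extends (m + 1) f {a i..a (i + 1)}) \<and>
     C_k_extends (m + 1) f {a n..}"

definition S_class :: "real set \<Rightarrow> nat \<Rightarrow> real \<Rightarrow> real \<Rightarrow> nat \<Rightarrow> (real \<Rightarrow> real) set" where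
  "S_class A d \<Delta>\<^sub>1 \<Delta>\<^sub>2 N\<^sub>S =
     {f. supp f \<subseteq> A \<and>
         (\<exists>m n a. piecewise_smooth f m n a \<and> m \<le> d \<and> n \<le> N\<^sub>S \<and>
            (\<forall>i\<in>{1..n}. \<Delta>\<^sub>1 \<le> \<bar>left_deriv m f (a i) - right_deriv m f (a i)\<bar> \<and>
                        \<bar>left_deriv m f (a i) - right_deriv m f (a i)\<bar> \<le> \<Delta>\<^sub>2))}"

definition prob_density :: "(real \<Rightarrow> real) \<Rightarrow> bool" where
  "prob_density f \<longleftrightarrow>
     f \<in> borel_measurable borel \<and> (\<forall>x. 0 \<le> f x) \<and>
     integrable lborel f \<and> (LINT x|lborel. f x) = 1"

definition regular_with :: "(real \<Rightarrow> real) \<Rightarrow> real \<Rightarrow> (real \<Rightarrow> real) \<Rightarrow> bool" where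
  "regular_with \<psi> C g \<longleftrightarrow>
     bounded (range g) \<and> compact (supp g) \<and> C > 0 \<and>
     (\<exists>N. \<forall>j\<ge>N. C * (LINT x|lborel. \<bar>Q_proj \<psi> j g x\<bar>\<^sup>2) \<le> (LINT x|lborel. (Q_proj \<psi> j g x)\<^sup>2 * g x))"

definition xi :: "nat \<Rightarrow> real \<Rightarrow> real" where
  "xi \<tau> x = fact (2 * \<tau> + 3) / (fact (\<tau> + 1))\<^sup>2 * (1 / 3 ^ (2 * \<tau> + 3)) *
     (3/2 - x) ^ (\<tau> + 1) * (3/2 + x) ^ (\<tau> + 1) * indicator {-3/2..3/2} x"

end

theory Submission
  imports Defs "HOL-Computational_Algebra.Polynomial"
begin

text \<open>
  On \<open>[-5/4, 5/4]\<close> the mixture satisfies \<open>f\<^sub>\<pi> \<ge> \<pi> \<xi> \<ge> \<pi> \<xi>(5/4)\<close>. Off this interval, and for large \<open>j\<close>,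
  the projection \<open>Q\<^sub>j f\<^sub>\<pi>\<close> equals \<open>\<pi> Q\<^sub>j \<xi>\<close>, because \<open>f\<close> lives on \<open>[-1, 1]\<close> and the wavelets at level
  \<open>j\<close> have length \<open>O(2\<^sup>-\<^sup>j)\<close>. So the constant \<open>\<pi> \<xi>(5/4) / 2\<close> works as soon as the energy of \<open>Q\<^sub>j \<xi>\<close>
  is at most half the energy of \<open>Q\<^sub>j f\<^sub>\<pi>\<close>, and this follows from a comparison of decay rates.

  The function \<open>\<xi>\<close> is smooth enough to be approximated by polynomials of degree \<open>d\<close> up to
  \<open>O(h^(d+1))\<close> on every interval of length \<open>h\<close> (\<open>xi_approximation\<close>); the vanishing moments kill the
  polynomials, so the energy of \<open>Q\<^sub>j \<xi>\<close> is \<open>O(4^(-(d+1)j))\<close> (\<open>smooth_energy_upper_bound\<close>). The density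
  \<open>f\<close> has a jump in its derivative of order \<open>m \<le> d\<close> at a point \<open>a\<close>; near \<open>a\<close> it is a polynomial of
  degree \<open>m\<close> plus a multiple of the truncated power \<open>(x - a)\<^sub>+^m\<close> plus a smaller term
  (\<open>first_defect_expansion\<close>), and the truncated power alone contributes an energy of order
  \<open>2^(-j) 4^(-mj)\<close> (\<open>defect_energy_lower_bound\<close>). The quotient of the two rates is at least of order
  \<open>2^j\<close>.

  The lower bound has to hold at every large level, whatever the position of \<open>2^j a\<close> relative to the
  integers. It rests on the fact that for no \<open>\<theta>\<close> and no \<open>m \<le> d\<close> is \<open>(x - \<theta>)\<^sub>+^m\<close> orthogonal to
  all integer translates of \<open>\<psi>\<close> (\<open>trunc_pow_not_orthogonal\<close>); compactness then makes this uniform in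
  \<open>\<theta>\<close>. Suppose that \<open>s = (x - \<theta>)\<^sub>+^m\<close> is orthogonal to all of them. Then so is the complementary
  power \<open>t = (x - \<theta>)^m - s\<close>, and for both functions the projections onto levels \<open>0\<close> and \<open>1\<close> coincide.
  Since the generators of level \<open>1\<close> are half as wide as those of level \<open>0\<close>, the level \<open>0\<close> coefficients
  of \<open>s\<close> vanish on the left and those of \<open>t\<close> on the right of a common point, so that the two
  coefficient sequences have disjoint supports. Hence the residual \<open>e\<close> of \<open>s\<close>, which up to sign is also
  the residual of \<open>t\<close> and therefore has compact support, satisfies
  \<open>\<parallel>e\<parallel>\<^sup>2 = \<langle>s, e\<rangle> = - \<langle>s, t\<rangle> + \<langle>s, P t\<rangle> = 0\<close>, where \<open>P\<close> is the projection onto level \<open>0\<close>. So \<open>s\<close> and \<open>t\<close>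
  are sums of translates of \<open>\<phi>\<close>, and the pairing of \<open>t\<close> with the unit translate of \<open>s\<close>, which is not
  zero, forces \<open>\<phi>\<close> to be supported in an interval of length \<open>1\<close>. A continuous such \<open>\<phi>\<close> vanishes on a
  whole coset of the integers, contradicting that its translates reproduce the constant \<open>1\<close>.
\<close>

section \<open>Locally bounded functions\<close>

text \<open>Truncated powers and polynomials are not square-integrable, but all projections used here are
  sums of compactly supported functions and make sense for every function of this class.\<close>

definition locally_bounded :: "(real \<Rightarrow> real) \<Rightarrow> bool" where
  "locally_bounded f \<longleftrightarrow> f \<in> borel_measurable borel \<and> (\<forall>R. \<exists>M. \<forall>x. \<bar>x\<bar> \<le> R \<longrightarrow> \<bar>f x\<bar> \<le> M)"

lemma locally_bounded_measurable: "locally_bounded f \<Longrightarrow> f \<in> borel_measurable borel"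
  by (simp add: locally_bounded_def)

lemma locally_bounded_bound:
  assumes "locally_bounded f"
  obtains M where "0 \<le> M" "\<And>x. \<bar>x\<bar> \<le> R \<Longrightarrow> \<bar>f x\<bar> \<le> M"
proof -
  obtain M where M: "\<And>x. \<bar>x\<bar> \<le> R \<Longrightarrow> \<bar>f x\<bar> \<le> M"
    using assms unfolding locally_bounded_def by blast
  have "\<bar>f x\<bar> \<le> max 0 M" if "\<bar>x\<bar> \<le> R" for x
    using M[OF that] by linarith
  then show ?thesis using that[of "max 0 M"] by auto
qed

lemma locally_boundedI:
  assumes "f \<in> borel_measurable borel" "\<And>R. 0 \<le> R \<Longrightarrow> \<exists>M. \<forall>x. \<bar>x\<bar> \<le> R \<longrightarrow> \<bar>f x\<bar> \<le> M"
  shows "locally_bounded f"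
  unfolding locally_bounded_def
proof (intro conjI allI assms(1))
  fix R :: real
  obtain M where "\<And>x. \<bar>x\<bar> \<le> \<bar>R\<bar> \<Longrightarrow> \<bar>f x\<bar> \<le> M"
    using assms(2)[of "\<bar>R\<bar>"] by auto
  then have "\<forall>x. \<bar>x\<bar> \<le> R \<longrightarrow> \<bar>f x\<bar> \<le> M" by auto
  then show "\<exists>M. \<forall>x. \<bar>x\<bar> \<le> R \<longrightarrow> \<bar>f x\<bar> \<le> M" ..
qed

lemma locally_bounded_continuous:
  assumes "continuous_on UNIV f"
  shows "locally_bounded f"
proof (rule locally_boundedI)
  show "f \<in> borel_measurable borel"
    using assms by (rule borel_measurable_continuous_onI)
  fix R :: real
  have "compact (f ` {-R..R})"
    using assms by (intro compact_continuous_image) (auto intro: continuous_on_subset)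
  then obtain M where "\<forall>y\<in>f ` {-R..R}. norm y \<le> M"
    using compact_imp_bounded bounded_iff by blast
  then have "\<forall>x. \<bar>x\<bar> \<le> R \<longrightarrow> \<bar>f x\<bar> \<le> M" by (auto simp: abs_le_iff)
  then show "\<exists>M. \<forall>x. \<bar>x\<bar> \<le> R \<longrightarrow> \<bar>f x\<bar> \<le> M" ..
qed

lemma locally_bounded_const [intro]: "locally_bounded (\<lambda>x. c)"
  by (rule locally_bounded_continuous) simp

lemma locally_bounded_poly [intro]: "locally_bounded (poly p)"
  by (rule locally_bounded_continuous) (simp add: continuous_on_poly)

lemma locally_bounded_add [intro]:
  assumes "locally_bounded f" "locally_bounded g"
  shows "locally_bounded (\<lambda>x. f x + g x)"
proof (rule locally_boundedI)
  show "(\<lambda>x. f x + g x) \<in> borel_measurable borel"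
    using assms[THEN locally_bounded_measurable] by simp
  fix R :: real
  obtain M N where "\<And>x. \<bar>x\<bar> \<le> R \<Longrightarrow> \<bar>f x\<bar> \<le> M" "\<And>x. \<bar>x\<bar> \<le> R \<Longrightarrow> \<bar>g x\<bar> \<le> N"
    using assms by (metis locally_bounded_bound)
  then have "\<forall>x. \<bar>x\<bar> \<le> R \<longrightarrow> \<bar>f x + g x\<bar> \<le> M + N"
    by (meson abs_triangle_ineq add_mono order_trans)
  then show "\<exists>M. \<forall>x. \<bar>x\<bar> \<le> R \<longrightarrow> \<bar>f x + g x\<bar> \<le> M" ..
qed

lemma locally_bounded_mult [intro]:
  assumes "locally_bounded f" "locally_bounded g"
  shows "locally_bounded (\<lambda>x. f x * g x)"
proof (rule locally_boundedI)
  show "(\<lambda>x. f x * g x) \<in> borel_measurable borel"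
    using assms[THEN locally_bounded_measurable] by simp
  fix R :: real
  obtain M N where "0 \<le> M" "\<And>x. \<bar>x\<bar> \<le> R \<Longrightarrow> \<bar>f x\<bar> \<le> M" "\<And>x. \<bar>x\<bar> \<le> R \<Longrightarrow> \<bar>g x\<bar> \<le> N"
    using assms by (metis locally_bounded_bound)
  then have "\<forall>x. \<bar>x\<bar> \<le> R \<longrightarrow> \<bar>f x * g x\<bar> \<le> M * N"
    by (auto simp: abs_mult intro!: mult_mono)
  then show "\<exists>M. \<forall>x. \<bar>x\<bar> \<le> R \<longrightarrow> \<bar>f x * g x\<bar> \<le> M" ..
qed

lemma locally_bounded_diff [intro]:
  assumes "locally_bounded f" "locally_bounded g"
  shows "locally_bounded (\<lambda>x. f x - g x)"
proof -
  have "locally_bounded (\<lambda>x. f x + (- 1) * g x)"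
    by (intro locally_bounded_add locally_bounded_mult assms locally_bounded_const)
  then show ?thesis by simp
qed

lemma locally_bounded_power2 [intro]: "locally_bounded f \<Longrightarrow> locally_bounded (\<lambda>x. (f x)\<^sup>2)"
  unfolding power2_eq_square by (rule locally_bounded_mult)

lemma locally_bounded_affine:
  assumes "locally_bounded f"
  shows "locally_bounded (\<lambda>x. f (a * x + b))"
proof (rule locally_boundedI)
  show "(\<lambda>x. f (a * x + b)) \<in> borel_measurable borel"
    by (rule measurable_compose[OF _ locally_bounded_measurable[OF assms]]) simp
  fix R :: real assume "0 \<le> R"
  obtain M where M: "\<And>x. \<bar>x\<bar> \<le> \<bar>a\<bar> * R + \<bar>b\<bar> \<Longrightarrow> \<bar>f x\<bar> \<le> M"
    using assms by (metis locally_bounded_bound)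
  have "\<bar>f (a * x + b)\<bar> \<le> M" if "\<bar>x\<bar> \<le> R" for x
  proof (rule M)
    have "\<bar>a * x\<bar> \<le> \<bar>a\<bar> * R"
      using that by (simp add: abs_mult mult_left_mono)
    then show "\<bar>a * x + b\<bar> \<le> \<bar>a\<bar> * R + \<bar>b\<bar>" by linarith
  qed
  then show "\<exists>M. \<forall>x. \<bar>x\<bar> \<le> R \<longrightarrow> \<bar>f (a * x + b)\<bar> \<le> M" by blast
qed

lemma locally_bounded_shift: "locally_bounded f \<Longrightarrow> locally_bounded (\<lambda>x. f (x - b))"
  using locally_bounded_affine[of f 1 "- b"] by simp

lemma locally_bounded_scale: "locally_bounded f \<Longrightarrow> locally_bounded (\<lambda>x. f (x / a))"
  using locally_bounded_affine[of f "1 / a" 0] by simp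

lemma locally_bounded_scale': "locally_bounded f \<Longrightarrow> locally_bounded (\<lambda>x. f (a * x))"
  using locally_bounded_affine[of f a 0] by simp

lemma locally_bounded_restrict:
  assumes "locally_bounded f" "A \<in> sets borel"
  shows "locally_bounded (\<lambda>x. if x \<in> A then f x else 0)"
proof (rule locally_boundedI)
  show "(\<lambda>x. if x \<in> A then f x else 0) \<in> borel_measurable borel"
    using locally_bounded_measurable[OF assms(1)] assms(2) by measurable
  fix R :: real
  obtain M where "0 \<le> M" "\<And>x. \<bar>x\<bar> \<le> R \<Longrightarrow> \<bar>f x\<bar> \<le> M"
    using assms(1) by (metis locally_bounded_bound)
  then have "\<forall>x. \<bar>x\<bar> \<le> R \<longrightarrow> \<bar>if x \<in> A then f x else 0\<bar> \<le> M" by auto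
  then show "\<exists>M. \<forall>x. \<bar>x\<bar> \<le> R \<longrightarrow> \<bar>if x \<in> A then f x else 0\<bar> \<le> M" ..
qed

lemma integrable_locally_bounded:
  assumes "locally_bounded f" and supp: "\<And>x. f x \<noteq> 0 \<Longrightarrow> \<bar>x\<bar> \<le> R"
  shows "integrable lborel f"
proof -
  obtain M where M: "0 \<le> M" "\<And>x. \<bar>x\<bar> \<le> R \<Longrightarrow> \<bar>f x\<bar> \<le> M"
    using assms(1) by (metis locally_bounded_bound)
  have "integrable lborel (\<lambda>x. M * indicator {-R..R} x :: real)"
    by (intro integrable_mult_right integrable_real_indicator) (auto simp: emeasure_lborel_Icc_eq)
  then show ?thesis
  proof (rule Bochner_Integration.integrable_bound)
    show "f \<in> borel_measurable lborel" using locally_bounded_measurable[OF assms(1)] by simp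
    have "norm (f x) \<le> norm (M * indicator {-R..R} x :: real)" for x
      using M supp[of x] by (cases "f x = 0") (auto simp: indicator_def abs_le_iff)
    then show "AE x in lborel. norm (f x) \<le> norm (M * indicator {-R..R} x :: real)"
      by simp
  qed
qed

lemma integrable_locally_bounded_mult:
  assumes "locally_bounded f" "locally_bounded g" and supp: "\<And>x. g x \<noteq> 0 \<Longrightarrow> \<bar>x\<bar> \<le> R"
  shows "integrable lborel (\<lambda>x. f x * g x)"
  using assms by (intro integrable_locally_bounded[where R = R] locally_bounded_mult) auto

text \<open>Identities of projections are obtained in \<open>L\<^sup>2\<close> and hence almost everywhere; this turns them into
  pointwise ones.\<close>

lemma continuous_AE_zero_imp_zero:
  fixes f :: "real \<Rightarrow> real"
  assumes cont: "continuous_on A f" and "open A" "x \<in> A"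
    and AE: "AE x in lborel. x \<in> A \<longrightarrow> f x = 0"
  shows "f x = 0"
proof (rule ccontr)
  assume nz: "f x \<noteq> 0"
  have "open {y \<in> A. f y \<noteq> 0}"
    using continuous_open_preimage[OF cont \<open>open A\<close>, of "- {0}"]
    by (simp add: vimage_def Int_def open_Compl)
  moreover have "x \<in> {y \<in> A. f y \<noteq> 0}" using nz \<open>x \<in> A\<close> by simp
  ultimately obtain e where e: "0 < e" "ball x e \<subseteq> {y \<in> A. f y \<noteq> 0}"
    by (meson open_contains_ball)
  have "AE y in lborel. y \<notin> ball x e"
    using AE by eventually_elim (use e(2) in auto)
  then have "emeasure lborel (ball x e) = 0"
    using AE_iff_measurable[of "ball x e" lborel "\<lambda>y. y \<notin> ball x e"]
    by (simp del: mem_ball)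
  moreover have "emeasure lborel (ball x e) = ennreal (2 * e)"
    using e(1) by (simp add: ball_eq_greaterThanLessThan)
  ultimately show False using e(1) by (simp add: ennreal_eq_0_iff)
qed

lemma integral_mult_translate_add:
  fixes f g :: "real \<Rightarrow> real"
  shows "(LINT x|lborel. f x * g (x - b)) = (LINT x|lborel. f (x + b) * g x)"
  using lborel_integral_real_affine[of 1 "\<lambda>x. f x * g (x - b)" b] by (simp add: add.commute)

lemma lborel_integral_dilation:
  fixes f :: "real \<Rightarrow> real"
  assumes "0 < a"
  shows "(LINT x|lborel. f (a * x)) = (LINT x|lborel. f x) / a"
  using lborel_integral_real_affine[of a f 0] assms by simp

section \<open>Projection onto the span of integer translates\<close>

definition translate_coeff :: "(real \<Rightarrow> real) \<Rightarrow> (real \<Rightarrow> real) \<Rightarrow> int \<Rightarrow> real" where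
  "translate_coeff \<eta> f k = (LINT y|lborel. f y * \<eta> (y - of_int k))"

text \<open>For compactly supported \<open>\<eta>\<close> only finitely many terms are active at each point, so that
  functions of any growth can be projected.\<close>

definition translate_proj :: "(real \<Rightarrow> real) \<Rightarrow> (real \<Rightarrow> real) \<Rightarrow> real \<Rightarrow> real" where
  "translate_proj \<eta> f x = (\<Sum>k | \<eta> (x - of_int k) \<noteq> 0. translate_coeff \<eta> f k * \<eta> (x - of_int k))"

text \<open>Both the scaling function and the wavelet are instances.\<close>

locale orthonormal_translates =
  fixes \<eta> :: "real \<Rightarrow> real" and c :: real
  assumes continuous: "continuous_on UNIV \<eta>"
    and support: "\<eta> x \<noteq> 0 \<Longrightarrow> \<bar>x\<bar> \<le> c"
    and orthonormal:
      "(LINT x|lborel. \<eta> (x - of_int k) * \<eta> (x - of_int l)) = (if k = l then 1 else 0)"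
begin

lemma locally_bounded [intro]: "locally_bounded \<eta>"
  using continuous by (rule locally_bounded_continuous)

lemma locally_bounded_translate [intro]: "locally_bounded (\<lambda>x. \<eta> (x - b))"
  by (rule locally_bounded_shift) (rule locally_bounded)

lemma continuous_translate [continuous_intros]: "continuous_on A (\<lambda>x. \<eta> (x - b))"
  by (rule continuous_on_compose2[OF continuous]) (auto intro!: continuous_intros)

lemma integrable_translate_coeff [intro]:
  assumes "locally_bounded f"
  shows "integrable lborel (\<lambda>y. f y * \<eta> (y - b))"
  using assms
proof (rule integrable_locally_bounded_mult)
  show "\<bar>x\<bar> \<le> c + \<bar>b\<bar>" if "\<eta> (x - b) \<noteq> 0" for x
    using support[OF that] by linarith
qed auto

lemma c_nonneg: "0 \<le> c"
proof (rule ccontr)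
  assume "\<not> 0 \<le> c"
  then have "\<eta> x = 0" for x using support[of x] by force
  then show False using orthonormal[of 0 0] by simp
qed

lemma finite_active: "finite {k::int. \<eta> (x - of_int k) \<noteq> 0}"
proof (rule finite_subset)
  show "{k::int. \<eta> (x - of_int k) \<noteq> 0} \<subseteq> {\<lfloor>x - c\<rfloor>..\<lceil>x + c\<rceil>}"
  proof
    fix k :: int assume "k \<in> {k. \<eta> (x - of_int k) \<noteq> 0}"
    then have "\<bar>x - of_int k\<bar> \<le> c" using support by blast
    then show "k \<in> {\<lfloor>x - c\<rfloor>..\<lceil>x + c\<rceil>}" by (auto simp: abs_le_iff) linarith+
  qed
qed simp

lemma proj_eq_sum:
  assumes "finite K" "\<And>k. \<eta> (x - of_int k) \<noteq> 0 \<Longrightarrow> translate_coeff \<eta> f k \<noteq> 0 \<Longrightarrow> k \<in> K"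
  shows "translate_proj \<eta> f x = (\<Sum>k\<in>K. translate_coeff \<eta> f k * \<eta> (x - of_int k))"
  unfolding translate_proj_def
proof (rule sum.mono_neutral_cong[OF assms(1) finite_active])
qed (use assms(2) in auto)

lemma proj_eq_interval_sum:
  assumes "\<bar>x\<bar> \<le> R" "R + c \<le> of_int N"
  shows "translate_proj \<eta> f x = (\<Sum>k\<in>{-N..N}. translate_coeff \<eta> f k * \<eta> (x - of_int k))"
proof (rule proj_eq_sum)
  fix k :: int assume "\<eta> (x - of_int k) \<noteq> 0"
  then show "k \<in> {-N..N}" using support[of "x - of_int k"] assms by auto
qed simp

lemma translate_coeff_eq_0:
  assumes "\<And>y. \<eta> (y - of_int k) \<noteq> 0 \<Longrightarrow> f y = 0"
  shows "translate_coeff \<eta> f k = 0"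
proof -
  have "(\<lambda>y. f y * \<eta> (y - of_int k)) = (\<lambda>y. 0)"
    using assms by (intro ext) auto
  then show ?thesis by (simp add: translate_coeff_def)
qed

lemma translate_coeff_cong:
  assumes "\<And>y. \<eta> (y - of_int k) \<noteq> 0 \<Longrightarrow> f y = g y"
  shows "translate_coeff \<eta> f k = translate_coeff \<eta> g k"
proof -
  have "f y * \<eta> (y - of_int k) = g y * \<eta> (y - of_int k)" for y
    using assms[of y] by auto
  then show ?thesis by (simp only: translate_coeff_def)
qed

lemma proj_eq_interval_sum':
  assumes supp: "\<And>y. f y \<noteq> 0 \<Longrightarrow> \<bar>y\<bar> \<le> R" and "R + c \<le> of_int N"
  shows "translate_proj \<eta> f x = (\<Sum>k\<in>{-N..N}. translate_coeff \<eta> f k * \<eta> (x - of_int k))"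
proof (rule proj_eq_sum)
  fix k :: int assume "translate_coeff \<eta> f k \<noteq> 0"
  then obtain y where "\<eta> (y - of_int k) \<noteq> 0" "f y \<noteq> 0"
    using translate_coeff_eq_0 by blast
  then show "k \<in> {-N..N}" using support[of "y - of_int k"] supp[of y] assms(2) by auto
qed simp

lemma proj_continuous: "continuous_on A (translate_proj \<eta> f)"
proof (rule continuous_on_subset)
  have "isCont (translate_proj \<eta> f) x" for x
  proof -
    obtain N :: int where N: "\<bar>x\<bar> + 1 + c \<le> of_int N"
      using ex_le_of_int by blast
    have "continuous_on (ball x 1) (\<lambda>x. \<Sum>k\<in>{-N..N}. translate_coeff \<eta> f k * \<eta> (x - of_int k))"
      by (intro continuous_intros)
    moreover have "translate_proj \<eta> f y = (\<Sum>k\<in>{-N..N}. translate_coeff \<eta> f k * \<eta> (y - of_int k))"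
      if "y \<in> ball x 1" for y
      using that N by (intro proj_eq_interval_sum[where R = "\<bar>x\<bar> + 1"]) (auto simp: dist_real_def)
    ultimately have "continuous_on (ball x 1) (translate_proj \<eta> f)"
      by (simp cong: continuous_on_cong_simp)
    then show ?thesis by (simp add: continuous_on_eq_continuous_at)
  qed
  then show "continuous_on UNIV (translate_proj \<eta> f)"
    by (simp add: continuous_on_eq_continuous_at)
qed simp

lemma locally_bounded_proj [intro]: "locally_bounded (translate_proj \<eta> f)"
  by (rule locally_bounded_continuous) (rule proj_continuous)

lemma translate_coeff_diff:
  "locally_bounded f \<Longrightarrow> locally_bounded g \<Longrightarrow> translate_coeff \<eta> (\<lambda>x. f x - g x) k = translate_coeff \<eta> f k - translate_coeff \<eta> g k"
  by (simp add: translate_coeff_def left_diff_distrib Bochner_Integration.integral_diff integrable_translate_coeff)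

lemma proj_diff:
  "locally_bounded f \<Longrightarrow> locally_bounded g \<Longrightarrow> translate_proj \<eta> (\<lambda>x. f x - g x) x = translate_proj \<eta> f x - translate_proj \<eta> g x"
  by (simp add: translate_proj_def translate_coeff_diff left_diff_distrib sum_subtractf)

lemma proj_local:
  assumes "\<And>y. \<bar>y - x\<bar> \<le> 2 * c \<Longrightarrow> f y = g y"
  shows "translate_proj \<eta> f x = translate_proj \<eta> g x"
  unfolding translate_proj_def
proof (rule sum.cong[OF refl])
  fix k :: int assume "k \<in> {k. \<eta> (x - of_int k) \<noteq> 0}"
  then have k: "\<bar>x - of_int k\<bar> \<le> c" using support by blast
  have "translate_coeff \<eta> f k = translate_coeff \<eta> g k"
  proof (rule translate_coeff_cong)
    fix y assume "\<eta> (y - of_int k) \<noteq> 0"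
    then show "f y = g y" using support[of "y - of_int k"] k by (intro assms) linarith
  qed
  then show "translate_coeff \<eta> f k * \<eta> (x - of_int k) = translate_coeff \<eta> g k * \<eta> (x - of_int k)" by simp
qed

lemma proj_zero: "translate_proj \<eta> (\<lambda>x. 0) x = 0"
  by (simp add: translate_proj_def translate_coeff_def)

lemma proj_eq_0:
  assumes "\<And>y. \<bar>y - x\<bar> \<le> 2 * c \<Longrightarrow> f y = 0"
  shows "translate_proj \<eta> f x = 0"
  using proj_local[of x f "\<lambda>_. 0"] assms by (simp add: proj_zero)

lemma proj_support:
  assumes "\<And>y. f y \<noteq> 0 \<Longrightarrow> \<bar>y\<bar> \<le> R" and "translate_proj \<eta> f x \<noteq> 0"
  shows "\<bar>x\<bar> \<le> R + 2 * c"
proof (rule ccontr)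
  assume "\<not> ?thesis"
  then have "translate_proj \<eta> f x = 0"
    using assms(1) by (intro proj_eq_0) force
  with assms(2) show False by simp
qed

text \<open>Only one of the factors needs compact support, so that the projection of a function of
  polynomial growth can be paired with a compactly supported one.\<close>

lemma integral_proj_mult:
  assumes "locally_bounded f" "locally_bounded h" and supp: "\<And>y. h y \<noteq> 0 \<Longrightarrow> \<bar>y\<bar> \<le> R"
    and N: "R + c \<le> of_int N"
  shows "(LINT x|lborel. translate_proj \<eta> f x * h x) = (\<Sum>k\<in>{-N..N}. translate_coeff \<eta> f k * translate_coeff \<eta> h k)"
proof -
  have "(LINT x|lborel. translate_proj \<eta> f x * h x)
      = (LINT x|lborel. (\<Sum>k\<in>{-N..N}. translate_coeff \<eta> f k * (h x * \<eta> (x - of_int k))))"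
  proof (intro Bochner_Integration.integral_cong refl)
    fix x :: real
    show "translate_proj \<eta> f x * h x = (\<Sum>k\<in>{-N..N}. translate_coeff \<eta> f k * (h x * \<eta> (x - of_int k)))"
    proof (cases "h x = 0")
      case False
      then have "translate_proj \<eta> f x = (\<Sum>k\<in>{-N..N}. translate_coeff \<eta> f k * \<eta> (x - of_int k))"
        by (intro proj_eq_interval_sum[OF supp N])
      then show ?thesis by (simp add: sum_distrib_right sum_distrib_left mult_ac)
    qed simp
  qed
  also have "\<dots> = (\<Sum>k\<in>{-N..N}. translate_coeff \<eta> f k * translate_coeff \<eta> h k)"
    using assms(2) unfolding translate_coeff_def[of \<eta> h]
    by (subst Bochner_Integration.integral_sum) (auto intro!: integrable_mult_right integrable_translate_coeff)
  finally show ?thesis .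
qed

lemma translate_coeff_proj:
  assumes "locally_bounded f"
  shows "translate_coeff \<eta> (translate_proj \<eta> f) k = translate_coeff \<eta> f k"
proof -
  obtain N :: int where N: "c + \<bar>of_int k\<bar> + c \<le> of_int N"
    using ex_le_of_int by blast
  have k: "k \<in> {-N..N}" using N c_nonneg by auto
  have "translate_coeff \<eta> (translate_proj \<eta> f) k = (\<Sum>l\<in>{-N..N}. translate_coeff \<eta> f l * translate_coeff \<eta> (\<lambda>y. \<eta> (y - of_int k)) l)"
    unfolding translate_coeff_def[of \<eta> "translate_proj \<eta> f"]
  proof (rule integral_proj_mult[OF assms locally_bounded_translate _ N])
    fix y :: real assume "\<eta> (y - of_int k) \<noteq> 0"
    then show "\<bar>y\<bar> \<le> c + \<bar>of_int k\<bar>" using support[of "y - of_int k"] by linarith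
  qed
  also have "\<dots> = (\<Sum>l\<in>{-N..N}. if l = k then translate_coeff \<eta> f l else 0)"
    by (intro sum.cong refl) (auto simp: translate_coeff_def[of \<eta> "\<lambda>y. \<eta> (y - _)"] orthonormal)
  also have "\<dots> = translate_coeff \<eta> f k" using k by simp
  finally show ?thesis .
qed

text \<open>This is Parseval's identity; the range of \<open>k\<close> covers all translates that meet the support of the
  projection itself, hence the margin \<open>3 * c\<close>.\<close>

lemma proj_energy:
  assumes "locally_bounded f" and supp: "\<And>y. f y \<noteq> 0 \<Longrightarrow> \<bar>y\<bar> \<le> R"
    and N: "R + 3 * c \<le> of_int N"
  shows "(LINT x|lborel. (translate_proj \<eta> f x)\<^sup>2) = (\<Sum>k\<in>{-N..N}. (translate_coeff \<eta> f k)\<^sup>2)"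
proof -
  have "(LINT x|lborel. translate_proj \<eta> f x * translate_proj \<eta> f x)
      = (\<Sum>l\<in>{-N..N}. translate_coeff \<eta> f l * translate_coeff \<eta> (translate_proj \<eta> f) l)"
    using proj_support[OF supp] N
    by (intro integral_proj_mult[where R = "R + 2 * c"] assms(1)) auto
  then show ?thesis
    by (simp add: translate_coeff_proj[OF assms(1)] power2_eq_square)
qed

lemma translate_coeff_le_proj_energy:
  assumes "locally_bounded f" and supp: "\<And>y. f y \<noteq> 0 \<Longrightarrow> \<bar>y\<bar> \<le> R"
  shows "(translate_coeff \<eta> f k)\<^sup>2 \<le> (LINT x|lborel. (translate_proj \<eta> f x)\<^sup>2)"
proof -
  obtain N :: int where N: "max (R + 3 * c) \<bar>of_int k\<bar> \<le> of_int N"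
    using ex_le_of_int by blast
  have "(translate_coeff \<eta> f k)\<^sup>2 \<le> (\<Sum>l\<in>{-N..N}. (translate_coeff \<eta> f l)\<^sup>2)"
    using N by (intro member_le_sum) auto
  also have "\<dots> = (LINT x|lborel. (translate_proj \<eta> f x)\<^sup>2)"
    using N by (intro proj_energy[symmetric, OF assms]) auto
  finally show ?thesis .
qed

end

section \<open>Square-integrable functions and multiresolutions\<close>

lemma L2_square_integrable: "f \<in> L2 \<Longrightarrow> integrable lborel (\<lambda>x. (f x)\<^sup>2)"
  by (simp add: L2_def)

lemma L2_measurable: "f \<in> L2 \<Longrightarrow> f \<in> borel_measurable borel"
  by (simp add: L2_def)

lemma L2_mult_integrable:
  assumes "f \<in> L2" "g \<in> L2"
  shows "integrable lborel (\<lambda>x. f x * g x)"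
proof (rule Bochner_Integration.integrable_bound)
  show "integrable lborel (\<lambda>x. (f x)\<^sup>2 + (g x)\<^sup>2)"
    using assms[THEN L2_square_integrable] by simp
  show "(\<lambda>x. f x * g x) \<in> borel_measurable lborel"
    using assms[THEN L2_measurable] by simp
  have "\<bar>f x * g x\<bar> \<le> (f x)\<^sup>2 + (g x)\<^sup>2" for x
  proof -
    have "2 * (\<bar>f x\<bar> * \<bar>g x\<bar>) \<le> (f x)\<^sup>2 + (g x)\<^sup>2"
      using sum_squares_bound[of "\<bar>f x\<bar>" "\<bar>g x\<bar>"] by simp
    moreover have "0 \<le> \<bar>f x\<bar> * \<bar>g x\<bar>" by simp
    ultimately show ?thesis unfolding abs_mult by linarith
  qed
  then show "AE x in lborel. norm (f x * g x) \<le> norm ((f x)\<^sup>2 + (g x)\<^sup>2)"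
    by simp
qed

lemma L2_add:
  assumes "f \<in> L2" "g \<in> L2"
  shows "(\<lambda>x. f x + g x) \<in> L2"
  using L2_mult_integrable[OF assms] assms
  by (auto simp: L2_def power2_sum mult.assoc)

lemma L2_cmult: "f \<in> L2 \<Longrightarrow> (\<lambda>x. c * f x) \<in> L2"
  by (auto simp: L2_def power_mult_distrib)

lemma L2_diff: "f \<in> L2 \<Longrightarrow> g \<in> L2 \<Longrightarrow> (\<lambda>x. f x - g x) \<in> L2"
  using L2_add[of f "\<lambda>x. (- 1) * g x"] L2_cmult[of g "- 1"] by simp

lemma L2_sum:
  assumes "finite K" "\<And>k. k \<in> K \<Longrightarrow> e k \<in> L2"
  shows "(\<lambda>x. \<Sum>k\<in>K. c k * e k x) \<in> L2"
  using assms
proof (induction rule: finite_induct)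
  case empty
  then show ?case by (simp add: L2_def)
next
  case (insert k K)
  then show ?case by (simp add: L2_add L2_cmult)
qed

lemma L2_compact:
  assumes "locally_bounded f" "\<And>x. f x \<noteq> 0 \<Longrightarrow> \<bar>x\<bar> \<le> R"
  shows "f \<in> L2"
  unfolding L2_def
  using assms locally_bounded_measurable integrable_locally_bounded[of "\<lambda>x. (f x)\<^sup>2" R] by auto

lemma L2_inner_commute: "L2_inner f g = L2_inner g f"
  by (simp add: L2_inner_def mult.commute)

lemma L2_inner_add_left:
  assumes "f \<in> L2" "g \<in> L2" "h \<in> L2"
  shows "L2_inner (\<lambda>x. f x + g x) h = L2_inner f h + L2_inner g h"
  using assms by (simp add: L2_inner_def distrib_right L2_mult_integrable)

lemma L2_inner_diff_left:
  assumes "f \<in> L2" "g \<in> L2" "h \<in> L2"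
  shows "L2_inner (\<lambda>x. f x - g x) h = L2_inner f h - L2_inner g h"
  using assms by (simp add: L2_inner_def left_diff_distrib L2_mult_integrable)

lemma L2_inner_diff_right:
  assumes "f \<in> L2" "g \<in> L2" "h \<in> L2"
  shows "L2_inner h (\<lambda>x. f x - g x) = L2_inner h f - L2_inner h g"
  using L2_inner_diff_left[OF assms] by (simp add: L2_inner_commute)

lemma L2_inner_sum_right:
  assumes "f \<in> L2" "\<And>k. k \<in> K \<Longrightarrow> e k \<in> L2"
  shows "L2_inner f (\<lambda>x. \<Sum>k\<in>K. c k * e k x) = (\<Sum>k\<in>K. c k * L2_inner f (e k))"
proof -
  have "L2_inner f (\<lambda>x. \<Sum>k\<in>K. c k * e k x) = (LINT x|lborel. (\<Sum>k\<in>K. c k * (f x * e k x)))"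
    by (simp add: L2_inner_def sum_distrib_left mult_ac)
  also have "\<dots> = (\<Sum>k\<in>K. c k * L2_inner f (e k))"
    using assms by (subst Bochner_Integration.integral_sum) (auto simp: L2_inner_def L2_mult_integrable)
  finally show ?thesis .
qed

lemma L2_inner_dilate:
  assumes "0 < a"
  shows "L2_inner (\<lambda>x. f (a * x)) (\<lambda>x. g (a * x)) = L2_inner f g / a"
  using lborel_integral_dilation[OF assms, of "\<lambda>x. f x * g x"] by (simp add: L2_inner_def)

text \<open>A substitute for the Cauchy--Schwarz inequality: the parameter \<open>t\<close> is chosen by the user instead of
  being optimised.\<close>

lemma L2_inner_weighted_bound:
  assumes "f \<in> L2" "g \<in> L2" "0 < t"
  shows "2 * \<bar>L2_inner f g\<bar> \<le> t * (LINT x|lborel. (f x)\<^sup>2) + (LINT x|lborel. (g x)\<^sup>2) / t"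
proof -
  define h where "h s x = (t * f x + s * g x)\<^sup>2 / t" for s x
  have h: "(LINT x|lborel. h s x) = t * (LINT x|lborel. (f x)\<^sup>2) + (LINT x|lborel. (g x)\<^sup>2) / t
      + 2 * s * L2_inner f g" if "s\<^sup>2 = 1" for s
  proof -
    have "h s x = t * (f x)\<^sup>2 + (g x)\<^sup>2 / t + 2 * s * (f x * g x)" for x
    proof -
      have "(t * f x + s * g x)\<^sup>2 = t * (t * (f x)\<^sup>2) + s\<^sup>2 * (g x)\<^sup>2 + t * (2 * s * (f x * g x))"
        by (simp add: power2_eq_square algebra_simps)
      then show ?thesis unfolding h_def that
        using \<open>0 < t\<close> by (simp add: field_simps)
    qed
    then show ?thesis
      using assms by (simp add: L2_inner_def L2_mult_integrable L2_square_integrable)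
  qed
  have "0 \<le> (LINT x|lborel. h s x)" for s
    using \<open>0 < t\<close> by (intro Bochner_Integration.integral_nonneg) (simp add: h_def)
  from this[of 1] this[of "-1"] show ?thesis
    by (simp add: h abs_le_iff)
qed

lemma orthogonal_to_basis_imp_orthogonal:
  assumes V: "V \<subseteq> L2" and basis: "L2_orthonormal_basis V e"
    and u: "u \<in> L2" and perp: "\<And>k. L2_inner u (e k) = 0" and g: "g \<in> V"
  shows "L2_inner u g = 0"
proof (rule ccontr)
  assume nz: "L2_inner u g \<noteq> 0"
  define b where "b = \<bar>L2_inner u g\<bar>"
  define A where "A = (LINT x|lborel. (u x)\<^sup>2)"
  have b: "0 < b" using nz by (simp add: b_def)
  have A: "0 \<le> A" unfolding A_def by simp
  \<comment> \<open>With this weight the first term of the weighted bound is below \<open>b\<close>, and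
    the tolerance \<open>b * t\<close> keeps the second one below \<open>b\<close>.\<close>
  define t where "t = b / (A + 1)"
  have t: "0 < t" using b A by (simp add: t_def)
  obtain K c where K: "finite K" and
    approx: "L2_norm (\<lambda>x. g x - (\<Sum>k\<in>K. c k * e k x)) < sqrt (b * t)"
    using basis g b t unfolding L2_orthonormal_basis_def by (meson mult_pos_pos real_sqrt_gt_0_iff)
  have e: "e k \<in> L2" for k
    using basis V unfolding L2_orthonormal_basis_def by blast
  let ?s = "\<lambda>x. \<Sum>k\<in>K. c k * e k x"
  have s: "?s \<in> L2" using K e by (intro L2_sum)
  have gL: "g \<in> L2" using g V by blast
  have "L2_inner u ?s = 0" by (simp add: L2_inner_sum_right u e perp)
  then have "b = \<bar>L2_inner u (\<lambda>x. g x - ?s x)\<bar>"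
    by (simp add: L2_inner_diff_right gL s u b_def)
  then have "2 * b \<le> t * A + (LINT x|lborel. (g x - ?s x)\<^sup>2) / t"
    unfolding A_def using L2_inner_weighted_bound[OF u L2_diff[OF gL s] t] by simp
  also have "\<dots> < b + b"
  proof (rule add_less_le_mono)
    show "t * A < b" using b A by (simp add: t_def field_simps)
    have "(LINT x|lborel. (g x - ?s x)\<^sup>2) < b * t"
      using approx unfolding L2_norm_def by simp
    then show "(LINT x|lborel. (g x - ?s x)\<^sup>2) / t \<le> b"
      using t by (simp add: field_simps)
  qed
  finally show False by simp
qed

text \<open>This covers the spaces of a multiresolution as well as the wavelet space, which is given as an
  orthogonal complement.\<close>

definition L2_subspace :: "(real \<Rightarrow> real) set \<Rightarrow> bool" where
  "L2_subspace V \<longleftrightarrow> V \<subseteq> L2 \<and> (\<lambda>x. 0) \<in> V \<and>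
     (\<forall>f\<in>V. \<forall>g\<in>V. (\<lambda>x. f x + g x) \<in> V) \<and> (\<forall>c. \<forall>f\<in>V. (\<lambda>x. c * f x) \<in> V)"

lemma L2_subspace_L2: "L2_subspace V \<Longrightarrow> f \<in> V \<Longrightarrow> f \<in> L2"
  by (auto simp: L2_subspace_def)

lemma L2_subspace_zero: "L2_subspace V \<Longrightarrow> (\<lambda>x. 0) \<in> V"
  by (simp add: L2_subspace_def)

lemma L2_subspace_add: "L2_subspace V \<Longrightarrow> f \<in> V \<Longrightarrow> g \<in> V \<Longrightarrow> (\<lambda>x. f x + g x) \<in> V"
  by (simp add: L2_subspace_def)

lemma L2_subspace_cmult: "L2_subspace V \<Longrightarrow> f \<in> V \<Longrightarrow> (\<lambda>x. c * f x) \<in> V"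
  by (simp add: L2_subspace_def)

lemma L2_subspace_diff:
  "L2_subspace V \<Longrightarrow> f \<in> V \<Longrightarrow> g \<in> V \<Longrightarrow> (\<lambda>x. f x - g x) \<in> V"
  using L2_subspace_add[of V f "\<lambda>x. (- 1) * g x"] L2_subspace_cmult[of V g "- 1"] by simp

lemma L2_subspace_sum:
  assumes V: "L2_subspace V" and "finite K" "\<And>k. k \<in> K \<Longrightarrow> e k \<in> V"
  shows "(\<lambda>x. \<Sum>k\<in>K. c k * e k x) \<in> V"
  using assms(2,3)
proof (induction rule: finite_induct)
  case empty
  then show ?case using L2_subspace_zero[OF V] by simp
next
  case (insert k K)
  then have "(\<lambda>x. c k * e k x + (\<Sum>k\<in>K. c k * e k x)) \<in> V"
    by (intro L2_subspace_add[OF V] L2_subspace_cmult[OF V]) auto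
  then show ?case using insert by simp
qed

lemma L2_closed_subspace_imp_subspace: "L2_closed_subspace V \<Longrightarrow> L2_subspace V"
  by (auto simp: L2_closed_subspace_def L2_subspace_def)

lemma L2_subspace_orthogonal_complement:
  assumes V: "L2_subspace V" and U: "U \<subseteq> L2"
  shows "L2_subspace {f \<in> V. \<forall>g\<in>U. L2_inner f g = 0}" (is "L2_subspace ?W")
proof -
  have "(\<lambda>x. f x + g x) \<in> ?W" if fg: "f \<in> ?W" "g \<in> ?W" for f g
  proof -
    have "L2_inner (\<lambda>x. f x + g x) u = 0" if "u \<in> U" for u
      using fg U that L2_subspace_L2[OF V] by (subst L2_inner_add_left) auto
    then show ?thesis using fg L2_subspace_add[OF V] by simp
  qed
  moreover have "(\<lambda>x. c * f x) \<in> ?W" if "f \<in> ?W" for c f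
    using L2_subspace_cmult[OF V] that by (simp add: L2_inner_def mult.assoc)
  moreover have "(\<lambda>x. 0) \<in> ?W"
    using L2_subspace_zero[OF V] by (simp add: L2_inner_def)
  moreover have "?W \<subseteq> L2" using L2_subspace_L2[OF V] by blast
  ultimately show ?thesis unfolding L2_subspace_def by blast
qed

lemma multiresolution_mono:
  assumes "multiresolution V \<phi>" "i \<le> j"
  shows "V i \<subseteq> V j"
  using assms(2)
proof (induction rule: int_ge_induct)
  case (step k)
  then show ?case using assms(1) unfolding multiresolution_def by blast
qed simp

lemma multiresolution_scale:
  assumes "multiresolution V \<phi>"
  shows "g \<in> V (int n) \<longleftrightarrow> (\<lambda>x. g (x / 2 ^ n)) \<in> V 0"
proof (induction n arbitrary: g)
  case (Suc n)
  have scale: "\<forall>j f. f \<in> V j \<longleftrightarrow> (\<lambda>x. f (2 * x)) \<in> V (j + 1)"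
    using assms by (simp add: multiresolution_def)
  have "g \<in> V (int (Suc n)) \<longleftrightarrow> (\<lambda>x. g (x / 2)) \<in> V (int n)"
    using scale[rule_format, of "\<lambda>x. g (x / 2)" "int n"] by (simp add: add.commute)
  also have "\<dots> \<longleftrightarrow> (\<lambda>x. g (x / 2 ^ n / 2)) \<in> V 0"
    by (rule Suc.IH)
  finally show ?case by (simp add: mult.commute)
qed simp

text \<open>What the rest of the proof uses of an \<open>r\<close>-regular wavelet basis: the projection onto level \<open>1\<close> splits
  into the projections generated by \<open>\<phi>\<close> and \<open>\<psi>\<close>, pointwise and for all locally bounded functions, and
  the projections onto fine levels approximate the identity. Level \<open>n\<close> is reached by conjugating the
  projection onto level \<open>0\<close> with a dilation.\<close>

locale wavelet_pair =
  phi: orthonormal_translates \<phi> c + psi: orthonormal_translates \<psi> c for \<phi> \<psi> c +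
  fixes d :: nat
  assumes refinement: "locally_bounded f \<Longrightarrow>
      translate_proj \<phi> (\<lambda>y. f (y / 2)) (2 * x) = translate_proj \<phi> f x + translate_proj \<psi> f x"
    and density: "locally_bounded f \<Longrightarrow> (\<And>y. f y \<noteq> 0 \<Longrightarrow> \<bar>y\<bar> \<le> R) \<Longrightarrow> 0 < \<epsilon> \<Longrightarrow>
      \<exists>n. (LINT x|lborel. (f x - translate_proj \<phi> (\<lambda>y. f (y / 2 ^ n)) (2 ^ n * x))\<^sup>2) < \<epsilon>"
    and moments: "k \<le> d \<Longrightarrow> (LINT x|lborel. x ^ k * \<psi> x) = 0"

context orthonormal_translates
begin

lemma proj_mem:
  assumes V: "L2_subspace V" and basis: "L2_orthonormal_basis V (\<lambda>k x. \<eta> (x - of_int k))"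
    and supp: "\<And>y. f y \<noteq> 0 \<Longrightarrow> \<bar>y\<bar> \<le> R"
  shows "translate_proj \<eta> f \<in> V"
proof -
  obtain N :: int where N: "R + c \<le> of_int N"
    using ex_le_of_int by blast
  have "translate_proj \<eta> f = (\<lambda>x. \<Sum>k\<in>{-N..N}. translate_coeff \<eta> f k * \<eta> (x - of_int k))"
    by (rule ext) (rule proj_eq_interval_sum'[OF supp N])
  also have "\<dots> \<in> V"
    using basis by (intro L2_subspace_sum[OF V]) (auto simp: L2_orthonormal_basis_def)
  finally show ?thesis .
qed

lemma residual_orthogonal:
  assumes V: "L2_subspace V" and basis: "L2_orthonormal_basis V (\<lambda>k x. \<eta> (x - of_int k))"
    and f: "locally_bounded f" and supp: "\<And>y. f y \<noteq> 0 \<Longrightarrow> \<bar>y\<bar> \<le> R" and "g \<in> V"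
  shows "L2_inner (\<lambda>x. f x - translate_proj \<eta> f x) g = 0"
proof (rule orthogonal_to_basis_imp_orthogonal[OF _ basis _ _ \<open>g \<in> V\<close>])
  show "V \<subseteq> L2" using V by (simp add: L2_subspace_def)
  then show "(\<lambda>x. f x - translate_proj \<eta> f x) \<in> L2"
    using proj_mem[OF V basis supp] L2_compact[OF f supp] by (intro L2_diff) auto
  show "L2_inner (\<lambda>x. f x - translate_proj \<eta> f x) (\<lambda>x. \<eta> (x - of_int k)) = 0" for k
    using translate_coeff_diff[OF f locally_bounded_proj, of f k] translate_coeff_proj[OF f, of k]
    by (simp add: translate_coeff_def L2_inner_def)
qed

end


definition level_proj :: "(real \<Rightarrow> real) \<Rightarrow> nat \<Rightarrow> (real \<Rightarrow> real) \<Rightarrow> real \<Rightarrow> real" where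
  "level_proj \<eta> n f x = translate_proj \<eta> (\<lambda>y. f (y / 2 ^ n)) (2 ^ n * x)"

locale compact_multiresolution =
  orthonormal_translates \<phi> c for \<phi> c +
  fixes V :: "int \<Rightarrow> (real \<Rightarrow> real) set"
  assumes mra: "multiresolution V \<phi>"
begin

lemma subspace: "L2_subspace (V j)"
  using mra by (simp add: multiresolution_def L2_closed_subspace_imp_subspace)

lemma basis: "L2_orthonormal_basis (V 0) (\<lambda>k x. \<phi> (x - of_int k))"
  using mra by (simp add: multiresolution_def)

lemma supp_dilate:
  fixes f :: "real \<Rightarrow> real"
  assumes "\<And>y. f y \<noteq> 0 \<Longrightarrow> \<bar>y\<bar> \<le> R" and "f (y / 2 ^ n) \<noteq> 0"
  shows "\<bar>y\<bar> \<le> 2 ^ n * R"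
  using assms(1)[OF assms(2)] by (simp add: abs_divide divide_le_eq mult.commute)

lemma level_proj_mem:
  assumes supp: "\<And>y. f y \<noteq> 0 \<Longrightarrow> \<bar>y\<bar> \<le> R"
  shows "level_proj \<phi> n f \<in> V (int n)"
proof -
  have "translate_proj \<phi> (\<lambda>y. f (y / 2 ^ n)) \<in> V 0"
    using supp_dilate[OF supp] by (rule proj_mem[OF subspace basis])
  moreover have "(\<lambda>x. level_proj \<phi> n f (x / 2 ^ n)) = translate_proj \<phi> (\<lambda>y. f (y / 2 ^ n))"
    by (simp add: level_proj_def fun_eq_iff)
  ultimately show ?thesis using multiresolution_scale[OF mra] by simp
qed

lemma level_residual_orthogonal:
  assumes f: "locally_bounded f" and supp: "\<And>y. f y \<noteq> 0 \<Longrightarrow> \<bar>y\<bar> \<le> R" and g: "g \<in> V (int n)"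
  shows "L2_inner (\<lambda>x. f x - level_proj \<phi> n f x) g = 0"
proof -
  let ?f = "\<lambda>y. f (y / 2 ^ n)" and ?g = "\<lambda>y. g (y / 2 ^ n)"
  have "L2_inner (\<lambda>x. ?f x - translate_proj \<phi> ?f x) ?g = 0"
    using f supp_dilate[OF supp] g multiresolution_scale[OF mra]
    by (intro residual_orthogonal[OF subspace basis]) (auto intro: locally_bounded_scale)
  moreover have "L2_inner (\<lambda>x. f x - level_proj \<phi> n f x) g
      = L2_inner (\<lambda>x. ?f x - translate_proj \<phi> ?f x) ?g / 2 ^ n"
    using L2_inner_dilate[of "2 ^ n" "\<lambda>x. ?f x - translate_proj \<phi> ?f x" ?g] by (simp add: level_proj_def)
  ultimately show ?thesis by simp
qed

text \<open>The multiresolution provides some \<open>g\<close> of some level close to \<open>f\<close>. Levels are nested, so the level may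
  be taken nonnegative, and the projection is at least as close to \<open>f\<close> as \<open>g\<close>.\<close>

lemma level_proj_dense:
  assumes f: "locally_bounded f" and supp: "\<And>y. f y \<noteq> 0 \<Longrightarrow> \<bar>y\<bar> \<le> R" and "0 < \<epsilon>"
  shows "\<exists>n. (LINT x|lborel. (f x - level_proj \<phi> n f x)\<^sup>2) < \<epsilon>"
proof -
  have fL: "f \<in> L2" using f supp by (rule L2_compact)
  then obtain j g where g: "g \<in> V j" "L2_norm (\<lambda>x. f x - g x) < sqrt \<epsilon>"
    using mra \<open>0 < \<epsilon>\<close> unfolding multiresolution_def by (meson real_sqrt_gt_0_iff)
  define n where "n = nat j"
  have gV: "g \<in> V (int n)"
    using multiresolution_mono[OF mra, of j "int n"] g(1) by (auto simp: n_def)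
  define P where "P = level_proj \<phi> n f"
  have PV: "P \<in> V (int n)" unfolding P_def using supp by (rule level_proj_mem)
  define h where "h x = P x - g x" for x
  have hV: "h \<in> V (int n)"
    unfolding h_def[abs_def] using subspace PV gV by (rule L2_subspace_diff)
  define u where "u x = f x - P x" for x
  have uL: "u \<in> L2"
    unfolding u_def[abs_def] using fL PV L2_subspace_L2[OF subspace] by (intro L2_diff) auto
  have hL: "h \<in> L2" using hV by (rule L2_subspace_L2[OF subspace])
  have orth: "(LINT x|lborel. u x * h x) = 0"
    using level_residual_orthogonal[OF f supp hV] by (simp add: u_def[abs_def] P_def L2_inner_def)
  have "(LINT x|lborel. (f x - g x)\<^sup>2) = (LINT x|lborel. (u x)\<^sup>2 + (h x)\<^sup>2 + 2 * (u x * h x))"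
    by (intro Bochner_Integration.integral_cong refl)
       (simp add: u_def h_def power2_eq_square algebra_simps)
  also have "\<dots> = (LINT x|lborel. (u x)\<^sup>2) + (LINT x|lborel. (h x)\<^sup>2)"
    using uL hL orth by (simp add: L2_mult_integrable L2_square_integrable)
  finally have "(LINT x|lborel. (u x)\<^sup>2) \<le> (LINT x|lborel. (f x - g x)\<^sup>2)"
    by simp
  also have "\<dots> < \<epsilon>" using g(2) by (simp add: L2_norm_def)
  finally show ?thesis unfolding u_def P_def by blast
qed

text \<open>The difference \<open>v\<close> of the two sides belongs to level \<open>1\<close>. It is orthogonal to level \<open>0\<close>, hence lies in
  the wavelet space, to which it is orthogonal as well; so it vanishes almost everywhere, and
  everywhere by continuity.\<close>

lemma refinement_compact:
  assumes psi: "orthonormal_translates \<psi> c" and assoc: "associated_wavelet V \<psi>"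
    and f: "locally_bounded f" and supp: "\<And>y. f y \<noteq> 0 \<Longrightarrow> \<bar>y\<bar> \<le> R"
  shows "level_proj \<phi> 1 f x = translate_proj \<phi> f x + translate_proj \<psi> f x"
proof -
  interpret psi: orthonormal_translates \<psi> c by (rule psi)
  define W where "W = {f \<in> V 1. \<forall>g\<in>V 0. L2_inner f g = 0}"
  have V01: "V 0 \<subseteq> V 1" using multiresolution_mono[OF mra, of 0 1] by simp
  have VL: "g \<in> L2" if "g \<in> V j" for g j
    using that by (rule L2_subspace_L2[OF subspace])
  have W: "L2_subspace W"
    unfolding W_def by (rule L2_subspace_orthogonal_complement[OF subspace]) (use VL in blast)
  have basisW: "L2_orthonormal_basis W (\<lambda>k x. \<psi> (x - of_int k))"
    using assoc by (simp add: associated_wavelet_def W_def)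
  have WV: "W \<subseteq> V 1" by (auto simp: W_def)
  have fL: "f \<in> L2" using f supp by (rule L2_compact)
  define P0 where "P0 = translate_proj \<phi> f"
  define Q0 where "Q0 = translate_proj \<psi> f"
  define P1 where "P1 = level_proj \<phi> 1 f"
  have P0: "P0 \<in> V 0" unfolding P0_def by (rule proj_mem[OF subspace basis supp])
  have Q0: "Q0 \<in> W" unfolding Q0_def by (rule psi.proj_mem[OF W basisW supp])
  have P1: "P1 \<in> V 1" unfolding P1_def using level_proj_mem[where f = f and n = 1, OF supp] by simp
  have L: "P0 \<in> L2" "Q0 \<in> L2" "P1 \<in> L2" using P0 Q0 P1 WV VL by blast+
  define v where "v x = P1 x - P0 x - Q0 x" for x
  have v1: "v \<in> V 1"
    unfolding v_def[abs_def] using P0 Q0 P1 V01 WV by (intro L2_subspace_diff[OF subspace]) auto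
  have vL: "v \<in> L2" using v1 by (rule VL)
  have residual: "L2_inner f g = L2_inner P1 g" if "g \<in> V 1" for g
    using level_residual_orthogonal[OF f supp, where n = 1 and g = g] that VL[OF that] fL L(3)
    by (simp add: L2_inner_diff_left P1_def)
  have inner_v: "L2_inner v g = L2_inner P1 g - L2_inner P0 g - L2_inner Q0 g" if "g \<in> V 1" for g
    unfolding v_def[abs_def] using L VL[OF that] by (simp add: L2_inner_diff_left L2_diff)
  have "L2_inner v g = 0" if g: "g \<in> V 0" for g
  proof -
    have "L2_inner f g = L2_inner P0 g"
      using residual_orthogonal[OF subspace basis f supp g] VL[OF g] fL L(1)
      by (simp add: L2_inner_diff_left P0_def)
    moreover have "L2_inner Q0 g = 0" using Q0 g by (simp add: W_def)
    moreover have g1: "g \<in> V 1" using g V01 by blast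
    ultimately show ?thesis using residual[OF g1] inner_v[OF g1] by simp
  qed
  then have vW: "v \<in> W" using v1 by (simp add: W_def)
  have "L2_inner v v = 0"
  proof -
    have "L2_inner f v = L2_inner Q0 v"
      using psi.residual_orthogonal[OF W basisW f supp vW] vL fL L(2)
      by (simp add: L2_inner_diff_left Q0_def)
    moreover have "L2_inner P0 v = 0"
      using vW P0 by (simp add: W_def L2_inner_commute[of P0])
    ultimately show ?thesis using residual[OF v1] inner_v[OF v1] by simp
  qed
  then have "(LINT x|lborel. (v x)\<^sup>2) = 0"
    by (simp add: L2_inner_def power2_eq_square)
  then have "AE x in lborel. (v x)\<^sup>2 = 0"
    using integral_nonneg_eq_0_iff_AE[OF L2_square_integrable[OF vL]] by simp
  then have AE: "AE x in lborel. x \<in> UNIV \<longrightarrow> v x = 0" by simp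
  have "continuous_on UNIV v"
    unfolding v_def[abs_def] P0_def Q0_def P1_def level_proj_def[abs_def]
    by (intro continuous_on_diff proj_continuous psi.proj_continuous
        continuous_on_compose2[OF proj_continuous[of UNIV]] continuous_intros) auto
  from continuous_AE_zero_imp_zero[OF this open_UNIV UNIV_I AE] have "v x = 0" .
  then show ?thesis by (simp add: v_def P0_def Q0_def P1_def)
qed

end

lemma RWB_imp_wavelet_pair:
  assumes "RWB r S \<phi> \<psi>" "vanishing_order r \<psi> d"
  shows "\<exists>c. wavelet_pair \<phi> \<psi> c d"
proof -
  obtain V where V: "multiresolution V \<phi>" "associated_wavelet V \<psi>"
    using assms(1) by (auto simp: RWB_def)
  have cont: "continuous_on UNIV \<eta>" if r: "C_k_on r \<eta> UNIV" "r \<ge> 1" for \<eta>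
  proof -
    obtain D where D: "\<And>x. D 0 x = \<eta> x" "\<And>x i. i < r \<Longrightarrow> (D i has_real_derivative D (Suc i) x) (at x)"
      using r(1) unfolding C_k_on_def by auto
    have "(D 0 has_real_derivative D (Suc 0) x) (at x)" for x
      using r(2) by (intro D(2)) simp
    then have "isCont (D 0) x" for x using DERIV_isCont by blast
    moreover have "D 0 = \<eta>" using D(1) by (rule ext)
    ultimately show ?thesis by (simp add: continuous_on_eq_continuous_at)
  qed
  have cont: "continuous_on UNIV \<phi>" "continuous_on UNIV \<psi>"
    using assms(1) cont by (auto simp: RWB_def)
  have mem: "x \<in> supp \<eta>" if "\<eta> x \<noteq> 0" for \<eta> :: "real \<Rightarrow> real" and x
    unfolding supp_def by (rule closure_subset[THEN subsetD]) (simp add: that)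
  have "bounded (supp \<phi>)"
    using assms(1) by (simp add: RWB_def compact_imp_bounded)
  then obtain B where "\<forall>x\<in>supp \<phi>. norm x \<le> B"
    unfolding bounded_iff by blast
  then have B: "\<bar>x\<bar> \<le> B" if "x \<in> supp \<phi>" for x
    using that by simp
  define c where "c = max B (real S)"
  have supp: "\<bar>x\<bar> \<le> c" if "\<phi> x \<noteq> 0 \<or> \<psi> x \<noteq> 0" for x
    using that
  proof
    assume "\<phi> x \<noteq> 0"
    then show ?thesis using B[OF mem, of x] unfolding c_def by linarith
  next
    assume "\<psi> x \<noteq> 0"
    then have "x \<in> {0..real S}" using mem[of \<psi> x] assms(1) by (simp add: RWB_def)
    then show ?thesis unfolding c_def by auto
  qed
  have orth: "(LINT x|lborel. \<eta> (x - of_int k) * \<eta> (x - of_int l)) = (if k = l then 1 else 0)"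
    if "L2_orthonormal_basis U (\<lambda>k x. \<eta> (x - of_int k))" for U \<eta> k l
    using that by (simp add: L2_orthonormal_basis_def L2_inner_def)
  have orth_phi: "(LINT x|lborel. \<phi> (x - of_int k) * \<phi> (x - of_int l)) = (if k = l then 1 else 0)" for k l
    using V(1) by (intro orth[of "V 0"]) (simp add: multiresolution_def)
  have orth_psi: "(LINT x|lborel. \<psi> (x - of_int k) * \<psi> (x - of_int l)) = (if k = l then 1 else 0)" for k l
    using V(2) unfolding associated_wavelet_def by (rule orth)
  interpret phi: compact_multiresolution \<phi> c V
    using V(1) cont supp orth_phi by unfold_locales auto
  have psi: "orthonormal_translates \<psi> c"
    using cont supp orth_psi by unfold_locales auto
  interpret psi: orthonormal_translates \<psi> c by (rule psi)
  have "wavelet_pair \<phi> \<psi> c d"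
  proof
    fix f :: "real \<Rightarrow> real" and x assume f: "locally_bounded f"
    \<comment> \<open>All three projections at \<open>x\<close> only see the values of \<open>f\<close>
      at distance at most \<open>2 * c\<close>, so \<open>f\<close> may be cut off.\<close>
    define R where "R = \<bar>x\<bar> + 2 * c"
    define g where "g y = (if y \<in> {-R..R} then f y else 0)" for y
    have g: "locally_bounded g" unfolding g_def[abs_def] by (rule locally_bounded_restrict[OF f]) simp
    have "level_proj \<phi> 1 g x = translate_proj \<phi> g x + translate_proj \<psi> g x"
    proof (rule phi.refinement_compact[OF psi V(2) g])
      show "\<bar>y\<bar> \<le> R" if "g y \<noteq> 0" for y using that by (auto simp: g_def split: if_splits)
    qed
    moreover have fg: "g y = f y" if "\<bar>y - x\<bar> \<le> 2 * c" for y
      using that by (auto simp: g_def R_def)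
    have "translate_proj \<phi> g x = translate_proj \<phi> f x" "translate_proj \<psi> g x = translate_proj \<psi> f x"
      using fg by (auto intro: phi.proj_local psi.proj_local)
    moreover have "level_proj \<phi> 1 g x = level_proj \<phi> 1 f x"
      unfolding level_proj_def
    proof (rule phi.proj_local, rule fg)
      fix y assume "\<bar>y - 2 ^ 1 * x\<bar> \<le> 2 * c"
      then show "\<bar>y / 2 ^ 1 - x\<bar> \<le> 2 * c" by (simp add: abs_le_iff)
    qed
    ultimately show "translate_proj \<phi> (\<lambda>y. f (y / 2)) (2 * x) = translate_proj \<phi> f x + translate_proj \<psi> f x"
      by (simp add: level_proj_def)
  next
    fix f :: "real \<Rightarrow> real" and R \<epsilon> :: real
    assume "locally_bounded f" "\<And>y. f y \<noteq> 0 \<Longrightarrow> \<bar>y\<bar> \<le> R" "0 < \<epsilon>"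
    then show "\<exists>n. (LINT x|lborel. (f x - translate_proj \<phi> (\<lambda>y. f (y / 2 ^ n)) (2 ^ n * x))\<^sup>2) < \<epsilon>"
      using phi.level_proj_dense[of f R \<epsilon>] by (simp add: level_proj_def)
  next
    fix k assume "k \<le> d"
    then show "(LINT x|lborel. x ^ k * \<psi> x) = 0"
      using assms(2) by (simp add: vanishing_order_def)
  qed
  then show ?thesis ..
qed

section \<open>Truncated powers are not orthogonal to all wavelets\<close>

context orthonormal_translates
begin

text \<open>The ends of the support of \<open>\<eta>\<close>. By continuity \<open>\<eta>\<close> vanishes there, which makes all inequalities
  between supports and translates strict.\<close>

definition lo :: real where "lo = Inf {x. \<eta> x \<noteq> 0}"
definition hi :: real where "hi = Sup {x. \<eta> x \<noteq> 0}"

lemma nonzero_set: "{x. \<eta> x \<noteq> 0} \<noteq> {}" "bdd_below {x. \<eta> x \<noteq> 0}" "bdd_above {x. \<eta> x \<noteq> 0}"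
proof -
  show "{x. \<eta> x \<noteq> 0} \<noteq> {}"
  proof
    assume "{x. \<eta> x \<noteq> 0} = {}"
    then have "\<eta> x = 0" for x by blast
    then show False using orthonormal[of 0 0] by simp
  qed
  show "bdd_below {x. \<eta> x \<noteq> 0}"
    by (rule bdd_belowI[of _ "- c"]) (use support in \<open>force simp: abs_le_iff\<close>)
  show "bdd_above {x. \<eta> x \<noteq> 0}"
    by (rule bdd_aboveI[of _ c]) (use support in \<open>force simp: abs_le_iff\<close>)
qed

lemma lo_less: assumes "\<eta> x \<noteq> 0" shows "lo < x"
proof -
  have le: "lo \<le> y" if "\<eta> y \<noteq> 0" for y
    unfolding lo_def using that nonzero_set by (intro cInf_lower) auto
  have "\<eta> lo = 0"
  proof (rule ccontr)
    assume nz: "\<eta> lo \<noteq> 0"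
    have "open {x. \<eta> x \<noteq> 0}"
      using open_Collect_neq[OF continuous, of "\<lambda>x. 0"] by simp
    then obtain e where "0 < e" "ball lo e \<subseteq> {x. \<eta> x \<noteq> 0}"
      using nz by (auto simp: open_contains_ball)
    moreover from \<open>0 < e\<close> have "lo - e / 2 \<in> ball lo e" by (simp add: dist_real_def)
    ultimately have "\<eta> (lo - e / 2) \<noteq> 0" by blast
    from le[OF this] \<open>0 < e\<close> show False by simp
  qed
  then show ?thesis using le[OF assms] assms by (cases "x = lo") auto
qed

lemma less_hi: assumes "\<eta> x \<noteq> 0" shows "x < hi"
proof -
  have le: "y \<le> hi" if "\<eta> y \<noteq> 0" for y
    unfolding hi_def using that nonzero_set by (intro cSup_upper) auto
  have "\<eta> hi = 0"
  proof (rule ccontr)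
    assume nz: "\<eta> hi \<noteq> 0"
    have "open {x. \<eta> x \<noteq> 0}"
      using open_Collect_neq[OF continuous, of "\<lambda>x. 0"] by simp
    then obtain e where "0 < e" "ball hi e \<subseteq> {x. \<eta> x \<noteq> 0}"
      using nz by (auto simp: open_contains_ball)
    moreover from \<open>0 < e\<close> have "hi + e / 2 \<in> ball hi e" by (simp add: dist_real_def)
    ultimately have "\<eta> (hi + e / 2) \<noteq> 0" by blast
    from le[OF this] \<open>0 < e\<close> show False by simp
  qed
  then show ?thesis using le[OF assms] assms by (cases "x = hi") auto
qed

lemma near_lo: assumes "lo < y" obtains x where "\<eta> x \<noteq> 0" "x < y"
  using cInf_lessD[OF nonzero_set(1), of y] assms unfolding lo_def by blast

lemma near_hi: assumes "y < hi" obtains x where "\<eta> x \<noteq> 0" "y < x"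
  using less_cSupD[OF nonzero_set(1), of y] assms unfolding hi_def by blast

lemma translate_coeff_nonzero_witness:
  assumes "translate_coeff \<eta> f k \<noteq> 0"
  obtains y where "f y \<noteq> 0" "lo < y - of_int k" "y - of_int k < hi" "\<eta> (y - of_int k) \<noteq> 0"
  using assms translate_coeff_eq_0[of k f] lo_less less_hi by metis

lemma proj_nonzero_witness:
  assumes "translate_proj \<eta> f x \<noteq> 0"
  obtains k where "translate_coeff \<eta> f k \<noteq> 0" "lo < x - of_int k" "x - of_int k < hi"
proof -
  have "\<exists>k. \<eta> (x - of_int k) \<noteq> 0 \<and> translate_coeff \<eta> f k \<noteq> 0"
  proof (rule ccontr)
    assume "\<not> ?thesis"
    then have "translate_proj \<eta> f x = 0"
      unfolding translate_proj_def by (intro sum.neutral) auto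
    with assms show False ..
  qed
  then show ?thesis using that lo_less less_hi by blast
qed

text \<open>Near the left end of the support of the leftmost active translate no other active translate
  contributes, so no cancellation can move the support of the projection to the right.\<close>

lemma translate_coeff_support_left:
  assumes zero: "\<And>x. x < y \<Longrightarrow> translate_proj \<eta> f x = 0"
    and start: "\<And>k. of_int k < (B::real) \<Longrightarrow> translate_coeff \<eta> f k = 0"
    and nz: "translate_coeff \<eta> f k \<noteq> 0"
  shows "y \<le> of_int k + lo"
proof -
  define K where "K = {j. translate_coeff \<eta> f j \<noteq> 0 \<and> j \<le> k}"
  have "B \<le> of_int j" if "j \<in> K" for j
    using start[of j] that by (force simp: K_def not_less[symmetric])
  then have "K \<subseteq> {\<lceil>B\<rceil>..k}"
    by (auto simp: K_def ceiling_le_iff)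
  then have fin: "finite K" by (rule finite_subset) simp
  have kK: "k \<in> K" using nz by (simp add: K_def)
  define j where "j = Min K"
  have j: "j \<in> K" "j \<le> k" using fin kK by (auto simp: j_def intro: Min_in)
  have least: "j \<le> i" if "translate_coeff \<eta> f i \<noteq> 0" for i
  proof (cases "i \<le> k")
    case True
    then show ?thesis using that fin by (simp add: j_def K_def)
  qed (use j in simp)
  have "y \<le> of_int j + lo"
  proof (rule ccontr)
    assume "\<not> ?thesis"
    then obtain z where z: "\<eta> z \<noteq> 0" "z < min (y - of_int j) (lo + 1)"
      using near_lo[of "min (y - of_int j) (lo + 1)"] by auto
    have "translate_proj \<eta> f (z + of_int j) = (\<Sum>i\<in>{j}. translate_coeff \<eta> f i * \<eta> (z + of_int j - of_int i))"
    proof (rule proj_eq_sum)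
      fix i assume i: "\<eta> (z + of_int j - of_int i) \<noteq> 0" "translate_coeff \<eta> f i \<noteq> 0"
      have "of_int i < real_of_int j + 1" using lo_less[OF i(1)] z(2) by simp
      then show "i \<in> {j}" using least[OF i(2)] by simp
    qed simp
    then have "translate_proj \<eta> f (z + of_int j) \<noteq> 0" using z(1) j(1) by (simp add: K_def)
    moreover have "z + of_int j < y" using z(2) by simp
    ultimately show False using zero by blast
  qed
  then show ?thesis using j(2) by linarith
qed

lemma translate_coeff_support_right:
  assumes zero: "\<And>x. y < x \<Longrightarrow> translate_proj \<eta> f x = 0"
    and stop: "\<And>k. (B::real) < of_int k \<Longrightarrow> translate_coeff \<eta> f k = 0"
    and nz: "translate_coeff \<eta> f k \<noteq> 0"
  shows "of_int k + hi \<le> y"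
proof -
  define K where "K = {j. translate_coeff \<eta> f j \<noteq> 0 \<and> k \<le> j}"
  have "of_int j \<le> B" if "j \<in> K" for j
    using stop[of j] that by (force simp: K_def not_less[symmetric])
  then have "K \<subseteq> {k..\<lfloor>B\<rfloor>}"
    by (auto simp: K_def le_floor_iff)
  then have fin: "finite K" by (rule finite_subset) simp
  have kK: "k \<in> K" using nz by (simp add: K_def)
  define j where "j = Max K"
  have j: "j \<in> K" "k \<le> j" using fin kK by (auto simp: j_def intro: Max_in)
  have greatest: "i \<le> j" if "translate_coeff \<eta> f i \<noteq> 0" for i
  proof (cases "k \<le> i")
    case True
    then show ?thesis using that fin by (simp add: j_def K_def)
  qed (use j in simp)
  have "of_int j + hi \<le> y"
  proof (rule ccontr)
    assume "\<not> ?thesis"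
    then obtain z where z: "\<eta> z \<noteq> 0" "max (y - of_int j) (hi - 1) < z"
      using near_hi[of "max (y - of_int j) (hi - 1)"] by auto
    have "translate_proj \<eta> f (z + of_int j) = (\<Sum>i\<in>{j}. translate_coeff \<eta> f i * \<eta> (z + of_int j - of_int i))"
    proof (rule proj_eq_sum)
      fix i assume i: "\<eta> (z + of_int j - of_int i) \<noteq> 0" "translate_coeff \<eta> f i \<noteq> 0"
      have "real_of_int j < of_int i + 1" using less_hi[OF i(1)] z(2) by simp
      then show "i \<in> {j}" using greatest[OF i(2)] by simp
    qed simp
    then have "translate_proj \<eta> f (z + of_int j) \<noteq> 0" using z(1) j(1) by (simp add: K_def)
    moreover have "y < z + of_int j" using z(2) by simp
    ultimately show False using zero by blast
  qed
  then show ?thesis using j(2) by linarith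
qed

text \<open>Formally the integral is \<open>\<Sum>k. translate_coeff \<eta> f k * translate_coeff \<eta> g k\<close>. As \<open>f\<close> and \<open>g\<close>
  live on opposite half-lines, only finitely many terms matter and \<open>g\<close> may be cut off.\<close>

lemma integral_proj_mult_half_lines:
  assumes f: "locally_bounded f" and g: "locally_bounded g"
    and f0: "\<And>y. a < y \<Longrightarrow> f y = 0" and g0: "\<And>y. y \<le> b \<Longrightarrow> g y = 0"
    and disjoint: "\<And>k. translate_coeff \<eta> f k * translate_coeff \<eta> g k = 0"
  shows "(LINT x|lborel. translate_proj \<eta> f x * g x) = 0"
proof -
  define h where "h y = (if y \<in> {..a + 2 * c} then g y else 0)" for y
  have h: "locally_bounded h" unfolding h_def[abs_def] by (rule locally_bounded_restrict[OF g]) simp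
  have supp: "\<bar>y\<bar> \<le> \<bar>a\<bar> + \<bar>b\<bar> + 2 * c" if "h y \<noteq> 0" for y
  proof -
    have "y \<le> a + 2 * c" "\<not> y \<le> b" using that g0 by (auto simp: h_def split: if_splits)
    then show ?thesis using c_nonneg by linarith
  qed
  obtain N :: int where N: "\<bar>a\<bar> + \<bar>b\<bar> + 2 * c + c \<le> of_int N"
    using ex_le_of_int by blast
  have eq: "translate_proj \<eta> f x * g x = translate_proj \<eta> f x * h x" for x
  proof (cases "x \<le> a + 2 * c")
    case False
    then have "translate_proj \<eta> f x = 0" by (intro proj_eq_0 f0) linarith
    then show ?thesis by simp
  qed (simp add: h_def)
  have "(LINT x|lborel. translate_proj \<eta> f x * g x) = (LINT x|lborel. translate_proj \<eta> f x * h x)"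
    unfolding eq ..
  also have "\<dots> = (\<Sum>k\<in>{-N..N}. translate_coeff \<eta> f k * translate_coeff \<eta> h k)"
    using f h supp N by (rule integral_proj_mult)
  also have "\<dots> = 0"
  proof (intro sum.neutral ballI)
    fix k
    show "translate_coeff \<eta> f k * translate_coeff \<eta> h k = 0"
    proof (cases "translate_coeff \<eta> f k = 0")
      case False
      then obtain z where z: "f z \<noteq> 0" "\<eta> (z - of_int k) \<noteq> 0"
        by (metis translate_coeff_nonzero_witness)
      have "translate_coeff \<eta> h k = translate_coeff \<eta> g k"
      proof (rule translate_coeff_cong)
        fix y assume "\<eta> (y - of_int k) \<noteq> 0"
        then have "y \<le> z + 2 * c" using support[of "y - of_int k"] support[OF z(2)] by linarith
        moreover have "z \<le> a" using z(1) f0[of z] by force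
        ultimately show "h y = g y" by (simp add: h_def)
      qed
      then show ?thesis using disjoint by simp
    qed simp
  qed
  finally show ?thesis .
qed

end

context wavelet_pair
begin

lemma translate_coeff_psi_poly:
  assumes "degree p \<le> d"
  shows "translate_coeff \<psi> (poly p) k = 0"
proof -
  define q where "q = pcompose p [:of_int k, 1:]"
  have deg: "degree q \<le> d" using assms by (simp add: q_def degree_pcompose)
  have "translate_coeff \<psi> (poly p) k = (LINT y|lborel. poly p (y + of_int k) * \<psi> y)"
    unfolding translate_coeff_def by (rule integral_mult_translate_add)
  also have "\<dots> = (LINT y|lborel. (\<Sum>i\<le>degree q. coeff q i * (y ^ i * \<psi> y)))"
  proof (intro Bochner_Integration.integral_cong refl)
    fix y
    have "poly p (y + of_int k) = poly q y" by (simp add: q_def poly_pcompose add.commute)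
    then show "poly p (y + of_int k) * \<psi> y = (\<Sum>i\<le>degree q. coeff q i * (y ^ i * \<psi> y))"
      by (simp add: poly_altdef sum_distrib_right mult.assoc)
  qed
  also have "\<dots> = (\<Sum>i\<le>degree q. coeff q i * (LINT y|lborel. y ^ i * \<psi> y))"
  proof (subst Bochner_Integration.integral_sum)
    fix i
    have "locally_bounded (\<lambda>y. y ^ i)" by (intro locally_bounded_continuous continuous_intros)
    then have "integrable lborel (\<lambda>y. y ^ i * \<psi> (y - 0))" by (rule psi.integrable_translate_coeff)
    then show "integrable lborel (\<lambda>y. coeff q i * (y ^ i * \<psi> y))" by simp
  qed simp
  also have "\<dots> = 0" using deg moments by (intro sum.neutral) auto
  finally show ?thesis .
qed

lemma proj_psi_eq_0:
  assumes "\<And>k. translate_coeff \<psi> f k = 0"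
  shows "translate_proj \<psi> f x = 0"
  using assms by (simp add: translate_proj_def)

text \<open>Iterating the refinement identity, the projections onto levels \<open>0\<close> and \<open>n\<close> differ by the wavelet
  projections onto the levels in between.\<close>

lemma level_proj_eq_proj:
  assumes "locally_bounded f" "\<And>m. translate_proj \<psi> (\<lambda>y. f (y / 2 ^ m)) (2 ^ m * x) = 0"
  shows "level_proj \<phi> n f x = translate_proj \<phi> f x"
proof (induction n)
  case (Suc n)
  have "level_proj \<phi> (Suc n) f x = translate_proj \<phi> (\<lambda>y. f (y / 2 / 2 ^ n)) (2 * (2 ^ n * x))"
    by (simp add: level_proj_def mult.assoc)
  also have "\<dots> = level_proj \<phi> n f x"
    using refinement[of "\<lambda>y. f (y / 2 ^ n)" "2 ^ n * x"] assms
    by (simp add: level_proj_def locally_bounded_scale)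
  finally show ?case using Suc by simp
qed (simp add: level_proj_def)

lemma locally_bounded_level_proj: "locally_bounded (level_proj \<phi> n f)"
  unfolding level_proj_def[abs_def] by (rule locally_bounded_scale') (rule phi.locally_bounded_proj)

lemma level_proj_local:
  assumes "\<And>y. \<bar>y - x\<bar> \<le> 2 * c \<Longrightarrow> f y = g y"
  shows "level_proj \<phi> n f x = level_proj \<phi> n g x"
  unfolding level_proj_def
proof (rule phi.proj_local, rule assms)
  fix y assume y: "\<bar>y - 2 ^ n * x\<bar> \<le> 2 * c"
  have "\<bar>y / 2 ^ n - x\<bar> = \<bar>y - 2 ^ n * x\<bar> / 2 ^ n"
    by (simp add: field_simps abs_divide[symmetric])
  also have "\<dots> \<le> \<bar>y - 2 ^ n * x\<bar> / 1"
    by (intro divide_left_mono) auto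
  finally show "\<bar>y / 2 ^ n - x\<bar> \<le> 2 * c" using y by simp
qed

text \<open>The vanishing moments make all wavelet projections of a polynomial zero, so its projections onto all
  levels agree with the one onto level \<open>0\<close>; on the other hand they converge to the polynomial. To stay in
  \<open>L\<^sup>2\<close>, the argument is run for a cut-off of the polynomial.\<close>

lemma proj_phi_poly:
  assumes deg: "degree p \<le> d"
  shows "translate_proj \<phi> (poly p) x = poly p x"
proof -
  define R where "R = \<bar>x\<bar> + 1"
  define R' where "R' = R + 2 * c"
  define f where "f y = (if y \<in> {-R'..R'} then poly p y else 0)" for y
  have f: "locally_bounded f" unfolding f_def[abs_def] by (rule locally_bounded_restrict) auto
  have supp: "\<bar>y\<bar> \<le> R'" if "f y \<noteq> 0" for y using that by (auto simp: f_def split: if_splits)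
  have level: "level_proj \<phi> n f z = translate_proj \<phi> (poly p) z" if "\<bar>z\<bar> \<le> R" for n z
  proof -
    have "level_proj \<phi> n f z = level_proj \<phi> n (poly p) z"
      using that by (intro level_proj_local) (auto simp: f_def R'_def)
    also have "\<dots> = translate_proj \<phi> (poly p) z"
    proof (rule level_proj_eq_proj)
      fix m
      have "(\<lambda>y. poly p (y / 2 ^ m)) = poly (pcompose p [:0, 1 / 2 ^ m:])"
        by (simp add: poly_pcompose fun_eq_iff)
      then show "translate_proj \<psi> (\<lambda>y. poly p (y / 2 ^ m)) (2 ^ m * z) = 0"
        using deg by (simp add: proj_psi_eq_0 translate_coeff_psi_poly degree_pcompose)
    qed auto
    finally show ?thesis .
  qed
  define u where "u z = (if z \<in> {-R..R} then (poly p z - translate_proj \<phi> (poly p) z)\<^sup>2 else 0)" for z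
  have "locally_bounded (\<lambda>z. (poly p z - translate_proj \<phi> (poly p) z)\<^sup>2)"
    by (intro locally_bounded_power2 locally_bounded_diff locally_bounded_poly phi.locally_bounded_proj)
  then have u: "integrable lborel u"
    unfolding u_def[abs_def]
    by (intro integrable_locally_bounded[where R = R] locally_bounded_restrict) (auto split: if_splits)
  have "(LINT z|lborel. u z) \<le> 0"
  proof (rule field_le_epsilon)
    fix \<epsilon> :: real assume "0 < \<epsilon>"
    from density[OF f supp this] obtain n
      where n: "(LINT z|lborel. (f z - level_proj \<phi> n f z)\<^sup>2) < \<epsilon>"
      unfolding level_proj_def by blast
    have "(LINT z|lborel. u z) \<le> (LINT z|lborel. (f z - level_proj \<phi> n f z)\<^sup>2)"
    proof (rule integral_mono[OF u])
      show "integrable lborel (\<lambda>z. (f z - level_proj \<phi> n f z)\<^sup>2)"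
      proof (rule integrable_locally_bounded[where R = "R' + 2 * c"])
        show "locally_bounded (\<lambda>z. (f z - level_proj \<phi> n f z)\<^sup>2)"
          by (intro locally_bounded_power2 locally_bounded_diff f locally_bounded_level_proj)
        fix z assume nz: "(f z - level_proj \<phi> n f z)\<^sup>2 \<noteq> 0"
        show "\<bar>z\<bar> \<le> R' + 2 * c"
        proof (rule ccontr)
          assume z: "\<not> ?thesis"
          have "f y = 0" if "\<bar>y - z\<bar> \<le> 2 * c" for y
            using supp[of y] that z by fastforce
          then have "f z = 0" "level_proj \<phi> n f z = level_proj \<phi> n (\<lambda>_. 0) z"
            using phi.c_nonneg by (auto intro!: level_proj_local)
          then show False using nz by (simp add: level_proj_def phi.proj_zero)
        qed
      qed
      fix z
      have "f z = poly p z" if "\<bar>z\<bar> \<le> R"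
        using that phi.c_nonneg by (auto simp: f_def R'_def)
      then show "u z \<le> (f z - level_proj \<phi> n f z)\<^sup>2"
        using level[of z n] by (auto simp: u_def abs_le_iff)
    qed
    then show "(LINT z|lborel. u z) \<le> 0 + \<epsilon>" using n by simp
  qed
  moreover have "0 \<le> (LINT z|lborel. u z)"
    by (rule Bochner_Integration.integral_nonneg) (simp add: u_def)
  moreover have "AE z in lborel. 0 \<le> u z" by (simp add: u_def)
  ultimately have "AE z in lborel. u z = 0"
    using integral_nonneg_eq_0_iff_AE[OF u] by linarith
  then have "AE z in lborel. z \<in> {-R<..<R} \<longrightarrow> poly p z - translate_proj \<phi> (poly p) z = 0"
    by eventually_elim (auto simp: u_def split: if_splits)
  moreover have "continuous_on {-R<..<R} (\<lambda>z. poly p z - translate_proj \<phi> (poly p) z)"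
    by (intro continuous_intros phi.proj_continuous)
  moreover have "x \<in> {-R<..<R}" by (auto simp: R_def)
  ultimately have "poly p x - translate_proj \<phi> (poly p) x = 0"
    using continuous_AE_zero_imp_zero[of "{-R<..<R}" "\<lambda>z. poly p z - translate_proj \<phi> (poly p) z" x]
    by simp
  then show ?thesis by simp
qed

end

text \<open>The convention at \<open>\<theta>\<close> itself only matters for \<open>m = 0\<close>, where the usual \<open>0 ^ 0 = 1\<close> would otherwise
  enter.\<close>

definition trunc_pow :: "real \<Rightarrow> nat \<Rightarrow> real \<Rightarrow> real" where
  "trunc_pow \<theta> m x = (if \<theta> < x then (x - \<theta>) ^ m else 0)"

lemma locally_bounded_trunc_pow [intro]: "locally_bounded (trunc_pow \<theta> m)"
proof -
  have "locally_bounded (\<lambda>x. if x \<in> {\<theta><..} then (x - \<theta>) ^ m else 0)"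
    by (intro locally_bounded_restrict locally_bounded_continuous continuous_intros) simp
  then show ?thesis by (simp add: trunc_pow_def[abs_def])
qed

context wavelet_pair
begin

text \<open>The argument by contradiction is outlined at the top. It concerns the projections generated by \<open>\<phi>\<close>
  of \<open>s\<close>, the truncated power, and of \<open>t\<close>, its complement in the full power \<open>(x - \<theta>)^m\<close>.\<close>

theorem trunc_pow_not_orthogonal:
  assumes "m \<le> d"
  shows "\<exists>k. translate_coeff \<psi> (trunc_pow \<theta> m) k \<noteq> 0"
proof (rule ccontr)
  assume "\<nexists>k. translate_coeff \<psi> (trunc_pow \<theta> m) k \<noteq> 0"
  then have psi_s: "translate_coeff \<psi> (trunc_pow \<theta> m) k = 0" for k by blast
  define \<alpha> where "\<alpha> = phi.lo"
  define \<beta> where "\<beta> = phi.hi"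
  define p :: "real poly" where "p = [:- \<theta>, 1:] ^ m"
  have deg: "degree p \<le> d" using assms by (simp add: p_def degree_linear_power)
  have p: "poly p x = (x - \<theta>) ^ m" for x by (simp add: p_def)
  define s where "s = trunc_pow \<theta> m"
  define t where "t x = poly p x - s x" for x
  have s_eq: "s x = (if \<theta> < x then (x - \<theta>) ^ m else 0)" for x
    by (simp add: s_def trunc_pow_def)
  have t_eq: "t x = (if \<theta> < x then 0 else (x - \<theta>) ^ m)" for x
    by (simp add: t_def s_eq p)
  have s: "locally_bounded s" unfolding s_def by blast
  have t: "locally_bounded t" unfolding t_def[abs_def] using s by blast
  have psi_t: "translate_coeff \<psi> t k = 0" for k
    unfolding t_def[abs_def] using s psi_s
    by (subst psi.translate_coeff_diff) (auto simp: translate_coeff_psi_poly[OF deg] s_def)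
  have proj_t: "translate_proj \<phi> t x = poly p x - translate_proj \<phi> s x" for x
    unfolding t_def[abs_def] using s by (subst phi.proj_diff) (auto simp: proj_phi_poly[OF deg])
  have fine_s: "translate_proj \<phi> s x = translate_proj \<phi> (\<lambda>y. s (y / 2)) (2 * x)" for x
    using refinement[OF s, of x] proj_psi_eq_0[of s x] psi_s by (simp add: s_def)
  have fine_t: "translate_proj \<phi> t x = translate_proj \<phi> (\<lambda>y. t (y / 2)) (2 * x)" for x
    using refinement[OF t, of x] proj_psi_eq_0[of t x] psi_t by simp

  have start_s: "translate_coeff \<phi> s k = 0" if "of_int k < \<theta> - \<beta>" for k
  proof (rule phi.translate_coeff_eq_0)
    fix y assume "\<phi> (y - of_int k) \<noteq> 0"
    then show "s y = 0" using phi.less_hi[of "y - of_int k"] that by (simp add: \<beta>_def s_eq)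
  qed
  have stop_t: "translate_coeff \<phi> t k = 0" if "\<theta> - \<alpha> < of_int k" for k
  proof (rule phi.translate_coeff_eq_0)
    fix y assume "\<phi> (y - of_int k) \<noteq> 0"
    then show "t y = 0" using phi.lo_less[of "y - of_int k"] that by (simp add: \<alpha>_def t_eq)
  qed

  \<comment> \<open>Level \<open>1\<close> reaches at most half the width of \<open>\<phi>\<close> to the left of \<open>\<theta>\<close>.\<close>
  have range_s: "\<theta> - (\<alpha> + \<beta>) / 2 \<le> of_int k" if "translate_coeff \<phi> s k \<noteq> 0" for k
  proof -
    have "\<theta> - (\<beta> - \<alpha>) / 2 \<le> of_int k + \<alpha>"
      unfolding \<alpha>_def
    proof (rule phi.translate_coeff_support_left[OF _ start_s that])
      fix x assume x: "x < \<theta> - (\<beta> - phi.lo) / 2"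
      show "translate_proj \<phi> s x = 0"
      proof (rule ccontr)
        assume "translate_proj \<phi> s x \<noteq> 0"
        then obtain n where n: "translate_coeff \<phi> (\<lambda>y. s (y / 2)) n \<noteq> 0" "phi.lo < 2 * x - of_int n"
          using phi.proj_nonzero_witness unfolding fine_s by metis
        then obtain y where "s (y / 2) \<noteq> 0" "y - of_int n < \<beta>"
          unfolding \<beta>_def by (metis phi.translate_coeff_nonzero_witness)
        then show False using n(2) x by (auto simp: s_eq field_simps split: if_splits)
      qed
    qed
    then show ?thesis by (simp add: field_simps)
  qed
  have range_t: "of_int k < \<theta> - (\<alpha> + \<beta>) / 2" if "translate_coeff \<phi> t k \<noteq> 0" for k
  proof -
    \<comment> \<open>The rightmost translate of level \<open>1\<close> that can see \<open>t\<close>;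
      it yields the strict inequality needed to separate the two ranges.\<close>
    define n\<^sub>1 where "n\<^sub>1 = \<lceil>2 * \<theta> - \<alpha>\<rceil> - 1"
    have n1: "of_int n\<^sub>1 < 2 * \<theta> - \<alpha>" unfolding n\<^sub>1_def by linarith
    have "of_int k + \<beta> \<le> (of_int n\<^sub>1 + \<beta>) / 2"
      unfolding \<beta>_def
    proof (rule phi.translate_coeff_support_right[OF _ stop_t that])
      fix x assume x: "(of_int n\<^sub>1 + phi.hi) / 2 < x"
      show "translate_proj \<phi> t x = 0"
      proof (rule ccontr)
        assume "translate_proj \<phi> t x \<noteq> 0"
        then obtain n where n: "translate_coeff \<phi> (\<lambda>y. t (y / 2)) n \<noteq> 0" "2 * x - of_int n < phi.hi"
          using phi.proj_nonzero_witness unfolding fine_t by metis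
        then obtain y where "t (y / 2) \<noteq> 0" "\<alpha> < y - of_int n"
          unfolding \<alpha>_def by (metis phi.translate_coeff_nonzero_witness)
        then have "of_int n < 2 * \<theta> - \<alpha>" by (auto simp: t_eq split: if_splits)
        then have "n \<le> n\<^sub>1" unfolding n\<^sub>1_def by linarith
        then show False using n(2) x by (simp add: field_simps)
      qed
    qed
    then show ?thesis using n1 by (simp add: field_simps)
  qed
  have disjoint: "translate_coeff \<phi> t k * translate_coeff \<phi> s k = 0" for k
    using range_s[of k] range_t[of k] by force

  \<comment> \<open>Seen from the left it is the residual of \<open>s\<close>, seen from the right that
    of \<open>t\<close>, so it vanishes far out on both sides.\<close>
  define e where "e x = s x - translate_proj \<phi> s x" for x
  have e_eq: "e x = translate_proj \<phi> t x - t x" for x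
    by (simp add: e_def proj_t t_def)
  have e: "locally_bounded e" unfolding e_def[abs_def] using s by blast
  have e_supp: "\<bar>x\<bar> \<le> \<bar>\<theta>\<bar> + 2 * c" if "e x \<noteq> 0" for x
  proof (rule ccontr)
    assume "\<not> ?thesis"
    then consider "x < \<theta> - 2 * c" | "\<theta> + 2 * c < x" by linarith
    then show False
    proof cases
      case 1
      then have "translate_proj \<phi> s x = 0" by (intro phi.proj_eq_0) (auto simp: s_eq)
      moreover have "s x = 0" using 1 phi.c_nonneg by (simp add: s_eq)
      ultimately show False using that by (simp add: e_def)
    next
      case 2
      then have "translate_proj \<phi> t x = 0" by (intro phi.proj_eq_0) (auto simp: t_eq)
      moreover have "t x = 0" using 2 phi.c_nonneg by (simp add: t_eq)
      ultimately show False using that by (simp add: e_eq)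
    qed
  qed
  have "(LINT x|lborel. translate_proj \<phi> t x * s x) = 0"
    by (rule phi.integral_proj_mult_half_lines[OF t s, where a = \<theta> and b = \<theta>])
       (auto simp: s_eq t_eq disjoint)
  moreover have "translate_proj \<phi> t x * s x = s x * e x" for x
    by (simp add: e_eq s_eq t_eq)
  ultimately have se: "(LINT x|lborel. s x * e x) = 0" by simp
  have Pse: "(LINT x|lborel. translate_proj \<phi> s x * e x) = 0"
  proof -
    obtain N :: int where N: "\<bar>\<theta>\<bar> + 2 * c + c \<le> of_int N" using ex_le_of_int by blast
    have "translate_coeff \<phi> e k = 0" for k
      unfolding e_def[abs_def] using s by (simp add: phi.translate_coeff_diff phi.translate_coeff_proj phi.locally_bounded_proj)
    then show ?thesis using phi.integral_proj_mult[OF s e e_supp N] by simp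
  qed
  have int: "integrable lborel (\<lambda>x. s x * e x)" "integrable lborel (\<lambda>x. translate_proj \<phi> s x * e x)"
    using s e e_supp by (auto intro!: integrable_locally_bounded_mult[where R = "\<bar>\<theta>\<bar> + 2 * c"])
  have "(LINT x|lborel. e x * e x) = (LINT x|lborel. s x * e x - translate_proj \<phi> s x * e x)"
    by (simp add: e_def left_diff_distrib)
  also have "\<dots> = 0" using int se Pse by simp
  finally have "(LINT x|lborel. e x * e x) = 0" .
  moreover have "integrable lborel (\<lambda>x. e x * e x)"
    using e e_supp by (rule integrable_locally_bounded_mult[OF e])
  ultimately have e0: "AE x in lborel. e x = 0"
    using integral_nonneg_eq_0_iff_AE[of lborel "\<lambda>x. e x * e x"] by simp

  \<comment> \<open>Now the projections of \<open>s\<close> and \<open>t\<close> coincide with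
    \<open>s\<close> and \<open>t\<close>, which sharpens the ranges of the coefficients.\<close>
  have left_s: "\<theta> \<le> of_int k + \<alpha>" if "translate_coeff \<phi> s k \<noteq> 0" for k
    unfolding \<alpha>_def
  proof (rule phi.translate_coeff_support_left[OF _ start_s that])
    fix x assume x: "x < \<theta>"
    have "AE x in lborel. x \<in> {..<\<theta>} \<longrightarrow> translate_proj \<phi> s x = 0"
      using e0 by eventually_elim (auto simp: e_def s_eq)
    then show "translate_proj \<phi> s x = 0"
      by (rule continuous_AE_zero_imp_zero[OF phi.proj_continuous, rotated 2]) (use x in auto)
  qed
  have right_t: "of_int k + \<beta> \<le> \<theta>" if "translate_coeff \<phi> t k \<noteq> 0" for k
    unfolding \<beta>_def
  proof (rule phi.translate_coeff_support_right[OF _ stop_t that])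
    fix x assume x: "\<theta> < x"
    have "AE x in lborel. x \<in> {\<theta><..} \<longrightarrow> translate_proj \<phi> t x = 0"
      using e0 by eventually_elim (auto simp: e_eq t_eq)
    then show "translate_proj \<phi> t x = 0"
      by (rule continuous_AE_zero_imp_zero[OF phi.proj_continuous, rotated 2]) (use x in auto)
  qed

  have "\<beta> - \<alpha> \<le> 1"
  proof (rule ccontr)
    assume wide: "\<not> \<beta> - \<alpha> \<le> 1"
    \<comment> \<open>The unit translate of \<open>s\<close> to the left overlaps \<open>t\<close> exactly on \<open>[\<theta> - 1, \<theta>]\<close>.\<close>
    define s' where "s' x = s (x - (- 1))" for x
    have s': "locally_bounded s'" unfolding s'_def[abs_def] by (rule locally_bounded_shift[OF s])
    have translate_coeff_s': "translate_coeff \<phi> s' k = translate_coeff \<phi> s (k + 1)" for k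
      using integral_mult_translate_add[of "\<lambda>x. \<phi> (x - of_int k)" s "- 1"]
      by (simp add: translate_coeff_def s'_def mult.commute algebra_simps)
    have "(LINT x|lborel. translate_proj \<phi> t x * s' x) = 0"
    proof (rule phi.integral_proj_mult_half_lines[OF t s', where a = \<theta> and b = "\<theta> - 1"])
      show "translate_coeff \<phi> t k * translate_coeff \<phi> s' k = 0" for k
        using left_s[of "k + 1"] right_t[of k] wide by (force simp: translate_coeff_s')
    qed (auto simp: s_eq t_eq s'_def)
    moreover have "(LINT x|lborel. translate_proj \<phi> t x * s' x) = (LINT x|lborel. t x * s' x)"
    proof (rule integral_cong_AE)
      show "AE x in lborel. translate_proj \<phi> t x * s' x = t x * s' x"
        using e0 by eventually_elim (simp add: e_eq)
    qed (use t s' in \<open>auto intro!: locally_bounded_measurable\<close>)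
    ultimately have zero: "(LINT x|lborel. (- 1) ^ m * (t x * s' x)) = 0" by simp
    have nonneg: "0 \<le> (- 1) ^ m * (t x * s' x)" for x
    proof -
      have "(- 1) ^ m * (x - \<theta>) ^ m = (\<theta> - x) ^ m"
        by (simp add: power_mult_distrib[symmetric])
      then have "(- 1) ^ m * t x = (if \<theta> < x then 0 else (\<theta> - x) ^ m)"
        by (simp add: t_eq)
      then have "0 \<le> (- 1) ^ m * t x" by simp
      moreover have "0 \<le> s' x" by (simp add: s'_def s_eq)
      ultimately show ?thesis by (metis mult.assoc mult_nonneg_nonneg)
    qed
    have "integrable lborel (\<lambda>x. (- 1) ^ m * (t x * s' x))"
    proof (rule integrable_locally_bounded[where R = "\<bar>\<theta>\<bar> + 1"])
      fix x assume "(- 1) ^ m * (t x * s' x) \<noteq> 0"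
      then have "x \<le> \<theta>" "\<theta> < x + 1" by (auto simp: t_eq s'_def s_eq split: if_splits)
      then show "\<bar>x\<bar> \<le> \<bar>\<theta>\<bar> + 1" by linarith
    qed (intro locally_bounded_mult locally_bounded_const t s')
    then have "AE x in lborel. (- 1) ^ m * (t x * s' x) = 0"
      using integral_nonneg_eq_0_iff_AE nonneg zero by blast
    then have "AE x in lborel. x \<in> {\<theta> - 1<..<\<theta>} \<longrightarrow> (x - \<theta>) ^ m * (x + 1 - \<theta>) ^ m = 0"
      by eventually_elim (auto simp: t_eq s'_def s_eq split: if_splits)
    then have "(\<theta> - 1 / 2 - \<theta>) ^ m * (\<theta> - 1 / 2 + 1 - \<theta>) ^ m = 0"
      by (intro continuous_AE_zero_imp_zero[where A = "{\<theta> - 1<..<\<theta>}"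
          and f = "\<lambda>x. (x - \<theta>) ^ m * (x + 1 - \<theta>) ^ m"] continuous_intros) auto
    then show False by simp
  qed

  \<comment> \<open>No integer translate of the open interval from \<open>\<alpha>\<close> to
    \<open>\<beta>\<close>, of length at most \<open>1\<close>, contains
    \<open>\<alpha>\<close>.\<close>
  have "translate_proj \<phi> (poly [:1:]) \<alpha> = 0"
  proof (rule ccontr)
    assume "translate_proj \<phi> (poly [:1:]) \<alpha> \<noteq> 0"
    then obtain k where "\<alpha> < \<alpha> - of_int k" "\<alpha> - of_int k < \<beta>"
      unfolding \<alpha>_def \<beta>_def by (metis phi.proj_nonzero_witness)
    then have "of_int k < (0::real)" "- 1 < real_of_int k" using \<open>\<beta> - \<alpha> \<le> 1\<close> by linarith+
    then show False by simp
  qed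
  then show False using proj_phi_poly[of "[:1:]" \<alpha>] by simp
qed

end

section \<open>Energy of the wavelet projections\<close>

context orthonormal_translates
begin

text \<open>Dilating by \<open>2^j\<close> reduces the wavelet projection onto level \<open>j\<close> to level \<open>0\<close>.\<close>

lemma Q_proj_eq_proj:
  assumes g: "locally_bounded g"
  shows "Q_proj \<eta> j g x = translate_proj \<eta> (\<lambda>u. g (u / 2 ^ j)) (2 ^ j * x)"
proof -
  define K where "K = {k::int. \<eta> (2 ^ j * x - of_int k) \<noteq> 0}"
  have fin: "finite K" unfolding K_def by (rule finite_active)
  have sq: "2 powr (real j / 2) * 2 powr (real j / 2) = (2::real) ^ j"
    by (simp add: powr_add[symmetric] powr_realpow)
  have kernel: "G_kernel \<eta> j x y * g y =
      (\<Sum>k\<in>K. 2 ^ j * \<eta> (2 ^ j * x - of_int k) * (g y * \<eta> (2 ^ j * y - of_int k)))" for y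
  proof -
    have "G_kernel \<eta> j x y = (\<Sum>\<^sub>\<infinity>k\<in>K. wavelet \<eta> j k x * wavelet \<eta> j k y)"
      unfolding G_kernel_def by (rule infsum_cong_neutral) (auto simp: K_def wavelet_def)
    also have "\<dots> = (\<Sum>k\<in>K. wavelet \<eta> j k x * wavelet \<eta> j k y)"
      by (rule infsum_finite[OF fin])
    also have "\<dots> = (\<Sum>k\<in>K. 2 ^ j * \<eta> (2 ^ j * x - of_int k) * \<eta> (2 ^ j * y - of_int k))"
      unfolding wavelet_def sq[symmetric] by (simp add: mult_ac)
    finally show ?thesis by (simp add: sum_distrib_left sum_distrib_right mult_ac)
  qed
  have int: "integrable lborel (\<lambda>u. g (u / 2 ^ j) * \<eta> (u - of_int k))" for k
    by (rule integrable_translate_coeff[OF locally_bounded_scale[OF g]])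
  have int': "integrable lborel (\<lambda>y. g y * \<eta> (2 ^ j * y - of_int k))" for k
    using lborel_integrable_real_affine[OF int[of k], of "2 ^ j" 0] by simp
  have scaled: "(LINT y|lborel. g y * \<eta> (2 ^ j * y - of_int k))
      = translate_coeff \<eta> (\<lambda>u. g (u / 2 ^ j)) k / 2 ^ j" for k
    using lborel_integral_dilation[of "2 ^ j" "\<lambda>u. g (u / 2 ^ j) * \<eta> (u - of_int k)"]
    by (simp add: translate_coeff_def)
  have "Q_proj \<eta> j g x
      = (\<Sum>k\<in>K. 2 ^ j * \<eta> (2 ^ j * x - of_int k) * (LINT y|lborel. g y * \<eta> (2 ^ j * y - of_int k)))"
    unfolding Q_proj_def kernel using int' by (subst Bochner_Integration.integral_sum) auto
  also have "\<dots> = translate_proj \<eta> (\<lambda>u. g (u / 2 ^ j)) (2 ^ j * x)"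
    unfolding translate_proj_def scaled by (simp add: K_def mult.commute)
  finally show ?thesis .
qed

lemma Q_proj_energy:
  assumes g: "locally_bounded g"
  shows "(LINT x|lborel. (Q_proj \<eta> j g x)\<^sup>2)
    = (LINT x|lborel. (translate_proj \<eta> (\<lambda>u. g (u / 2 ^ j)) x)\<^sup>2) / 2 ^ j"
  using lborel_integral_dilation[of "2 ^ j" "\<lambda>x. (translate_proj \<eta> (\<lambda>u. g (u / 2 ^ j)) x)\<^sup>2"]
  by (simp add: Q_proj_eq_proj[OF g])

lemma locally_bounded_Q_proj:
  assumes "locally_bounded g"
  shows "locally_bounded (Q_proj \<eta> j g)"
proof -
  have "Q_proj \<eta> j g = (\<lambda>x. translate_proj \<eta> (\<lambda>u. g (u / 2 ^ j)) (2 ^ j * x))"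
    by (rule ext) (rule Q_proj_eq_proj[OF assms])
  then show ?thesis by (simp add: locally_bounded_scale'[OF locally_bounded_proj])
qed

lemma Q_proj_local:
  assumes "locally_bounded f" "locally_bounded g" "\<And>y. \<bar>y - x\<bar> \<le> 2 * c / 2 ^ j \<Longrightarrow> f y = g y"
  shows "Q_proj \<eta> j f x = Q_proj \<eta> j g x"
  unfolding assms(1,2)[THEN Q_proj_eq_proj]
proof (rule proj_local, rule assms(3))
  fix y assume y: "\<bar>y - 2 ^ j * x\<bar> \<le> 2 * c"
  have "\<bar>y / 2 ^ j - x\<bar> = \<bar>y - 2 ^ j * x\<bar> / 2 ^ j"
    by (simp add: field_simps abs_divide[symmetric])
  then show "\<bar>y / 2 ^ j - x\<bar> \<le> 2 * c / 2 ^ j" using y by (simp add: divide_right_mono)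
qed

lemma translate_coeff_cmult: "translate_coeff \<eta> (\<lambda>x. a * f x) k = a * translate_coeff \<eta> f k"
  by (simp add: translate_coeff_def mult.assoc)

lemma Q_proj_cmult:
  assumes "locally_bounded f"
  shows "Q_proj \<eta> j (\<lambda>x. a * f x) x = a * Q_proj \<eta> j f x"
  using assms locally_bounded_mult[OF locally_bounded_const[of a] assms]
  by (simp add: Q_proj_eq_proj translate_proj_def translate_coeff_cmult sum_distrib_left mult.assoc)

lemma Q_proj_support:
  assumes "locally_bounded g" and supp: "\<And>y. g y \<noteq> 0 \<Longrightarrow> \<bar>y\<bar> \<le> R" and nz: "Q_proj \<eta> j g x \<noteq> 0"
  shows "\<bar>x\<bar> \<le> R + 2 * c / 2 ^ j"
proof (rule ccontr)
  assume x: "\<not> ?thesis"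
  have "Q_proj \<eta> j g x = Q_proj \<eta> j (\<lambda>y. 0 * g y) x"
    using assms(1) x supp by (intro Q_proj_local) (auto, fastforce)
  also have "\<dots> = 0" using Q_proj_cmult[OF assms(1), of j 0 x] by simp
  finally show False using nz by contradiction
qed

lemma translate_coeff_bound:
  assumes f: "locally_bounded f" and M: "AE u in lborel. \<eta> (u - of_int k) \<noteq> 0 \<longrightarrow> \<bar>f u\<bar> \<le> M"
  shows "\<bar>translate_coeff \<eta> f k\<bar> \<le> M * (LINT u|lborel. \<bar>\<eta> u\<bar>)"
proof -
  have shift: "(LINT u|lborel. \<bar>\<eta> (u - of_int k)\<bar>) = (LINT u|lborel. \<bar>\<eta> u\<bar>)"
    using integral_mult_translate_add[of "\<lambda>_. 1" "\<lambda>u. \<bar>\<eta> u\<bar>" "of_int k"] by simp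
  have int: "integrable lborel (\<lambda>u. \<bar>\<eta> (u - of_int k)\<bar>)"
    using integrable_translate_coeff[OF locally_bounded_const[of 1], of "of_int k"] by simp
  have "\<bar>translate_coeff \<eta> f k\<bar> \<le> (LINT u|lborel. \<bar>f u * \<eta> (u - of_int k)\<bar>)"
    unfolding translate_coeff_def by (rule integral_abs_bound)
  also have "\<dots> \<le> (LINT u|lborel. M * \<bar>\<eta> (u - of_int k)\<bar>)"
  proof (rule integral_mono_AE)
    show "integrable lborel (\<lambda>u. \<bar>f u * \<eta> (u - of_int k)\<bar>)"
      using integrable_translate_coeff[OF f] by (intro integrable_abs)
    show "AE u in lborel. \<bar>f u * \<eta> (u - of_int k)\<bar> \<le> M * \<bar>\<eta> (u - of_int k)\<bar>"
      using M by eventually_elim (force simp: abs_mult intro: mult_right_mono)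
  qed (use int in simp)
  also have "\<dots> = M * (LINT u|lborel. \<bar>\<eta> u\<bar>)" by (simp add: shift)
  finally show ?thesis .
qed

end

context wavelet_pair
begin

lemma translate_coeff_trunc_pow_shift:
  "translate_coeff \<psi> (trunc_pow \<theta> m) k = translate_coeff \<psi> (trunc_pow (\<theta> - of_int k) m) 0"
proof -
  have "trunc_pow \<theta> m (y + of_int k) = trunc_pow (\<theta> - of_int k) m y" for y
    by (simp add: trunc_pow_def algebra_simps)
  then show ?thesis
    using integral_mult_translate_add[of "trunc_pow \<theta> m" \<psi> "of_int k"] by (simp add: translate_coeff_def)
qed

lemma translate_coeff_trunc_pow_support:
  assumes "m \<le> d" "translate_coeff \<psi> (trunc_pow \<theta> m) k \<noteq> 0"
  shows "\<bar>\<theta> - of_int k\<bar> \<le> c"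
proof (rule ccontr)
  assume "\<not> ?thesis"
  then consider "of_int k + c < \<theta>" | "\<theta> < of_int k - c" by linarith
  then show False
  proof cases
    case 1
    have "translate_coeff \<psi> (trunc_pow \<theta> m) k = 0"
    proof (rule psi.translate_coeff_eq_0)
      fix y assume "\<psi> (y - of_int k) \<noteq> 0"
      then show "trunc_pow \<theta> m y = 0"
        using psi.support[of "y - of_int k"] 1 by (simp add: trunc_pow_def)
    qed
    with assms(2) show False ..
  next
    case 2
    have "translate_coeff \<psi> (trunc_pow \<theta> m) k = translate_coeff \<psi> (poly ([:- \<theta>, 1:] ^ m)) k"
    proof (rule psi.translate_coeff_cong)
      fix y assume "\<psi> (y - of_int k) \<noteq> 0"
      then show "trunc_pow \<theta> m y = poly ([:- \<theta>, 1:] ^ m) y"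
        using psi.support[of "y - of_int k"] 2 by (auto simp: trunc_pow_def)
    qed
    also have "\<dots> = 0" using assms(1) by (intro translate_coeff_psi_poly) (simp add: degree_linear_power)
    finally show False using assms(2) by simp
  qed
qed

text \<open>For \<open>m = 0\<close> the integrand is discontinuous in \<open>\<theta>\<close>, but at each \<open>\<theta>\<close> only in the single point \<open>y = \<theta>\<close>, so
  dominated convergence covers all \<open>m\<close>.\<close>

lemma continuous_translate_coeff_trunc_pow: "continuous_on UNIV (\<lambda>\<theta>. translate_coeff \<psi> (trunc_pow \<theta> m) 0)"
proof -
  have "isCont (\<lambda>\<theta>. translate_coeff \<psi> (trunc_pow \<theta> m) 0) \<theta>" for \<theta>
    unfolding isCont_def tendsto_at_iff_sequentially comp_def
  proof (intro allI impI)
    fix X :: "nat \<Rightarrow> real" assume X: "X \<longlonglongrightarrow> \<theta>"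
    then have "Bseq X" by (intro convergent_imp_Bseq convergentI)
    then obtain B where B: "\<And>n. \<bar>X n\<bar> \<le> B" by (auto simp: Bseq_def)
    have "(\<lambda>n. LINT y|lborel. trunc_pow (X n) m y * \<psi> y)
        \<longlonglongrightarrow> (LINT y|lborel. trunc_pow \<theta> m y * \<psi> y)"
    proof (rule integral_dominated_convergence[where w = "\<lambda>y. (c + B) ^ m * \<bar>\<psi> y\<bar>"])
      show "AE y in lborel. (\<lambda>n. trunc_pow (X n) m y * \<psi> y) \<longlonglongrightarrow> trunc_pow \<theta> m y * \<psi> y"
        using AE_lborel_singleton[of \<theta>]
      proof eventually_elim
        case (elim y)
        have "(\<lambda>n. trunc_pow (X n) m y) \<longlonglongrightarrow> trunc_pow \<theta> m y"
        proof (cases "\<theta> < y")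
          case True
          then have "eventually (\<lambda>n. X n < y) sequentially" using X by (simp add: order_tendstoD)
          then have "eventually (\<lambda>n. trunc_pow (X n) m y = (y - X n) ^ m) sequentially"
            by eventually_elim (simp add: trunc_pow_def)
          moreover have "(\<lambda>n. (y - X n) ^ m) \<longlonglongrightarrow> (y - \<theta>) ^ m"
            by (intro tendsto_intros X)
          ultimately show ?thesis using True by (simp add: trunc_pow_def tendsto_cong)
        next
          case False
          then have "eventually (\<lambda>n. y < X n) sequentially" using X elim by (simp add: order_tendstoD)
          then have "eventually (\<lambda>n. trunc_pow (X n) m y = 0) sequentially"
            by eventually_elim (simp add: trunc_pow_def)
          then show ?thesis using False by (simp add: trunc_pow_def tendsto_cong)
        qed
        then show ?case by (intro tendsto_intros)
      qed
      show "integrable lborel (\<lambda>y. (c + B) ^ m * \<bar>\<psi> y\<bar>)"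
        using psi.integrable_translate_coeff[OF locally_bounded_const[of 1], of 0] by simp
      fix n
      show "AE y in lborel. norm (trunc_pow (X n) m y * \<psi> y) \<le> (c + B) ^ m * \<bar>\<psi> y\<bar>"
      proof (intro AE_I2)
        fix y
        show "norm (trunc_pow (X n) m y * \<psi> y) \<le> (c + B) ^ m * \<bar>\<psi> y\<bar>"
        proof (cases "\<psi> y = 0")
          case False
          have "0 \<le> c + B" "\<bar>y - X n\<bar> \<le> c + B" using psi.support[OF False] B[of n] by linarith+
          then have "\<bar>trunc_pow (X n) m y\<bar> \<le> (c + B) ^ m"
            by (simp add: trunc_pow_def power_abs[symmetric] power_mono del: power_abs)
          then show ?thesis by (simp add: abs_mult mult_right_mono)
        qed simp
      qed
    qed (use locally_bounded_measurable[OF locally_bounded_trunc_pow] locally_bounded_measurable[OF psi.locally_bounded] in simp_all)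
    then show "(\<lambda>n. translate_coeff \<psi> (trunc_pow (X n) m) 0) \<longlonglongrightarrow> translate_coeff \<psi> (trunc_pow \<theta> m) 0"
      by (simp add: translate_coeff_def)
  qed
  then show ?thesis by (simp add: continuous_on_eq_continuous_at)
qed

text \<open>Shifting by integers, it is enough to consider \<open>\<theta> \<in> [0, 1]\<close>, where only finitely many translates matter.
  The sum \<open>H\<close> of their absolute coefficients is continuous and positive, hence bounded below.\<close>

lemma trunc_pow_uniform_lower_bound:
  assumes m: "m \<le> d"
  shows "\<exists>\<delta>>0. \<forall>\<theta>. \<exists>k. \<delta> \<le> \<bar>translate_coeff \<psi> (trunc_pow \<theta> m) k\<bar>"
proof -
  define F where "F \<theta> = translate_coeff \<psi> (trunc_pow \<theta> m) 0" for \<theta>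
  obtain N :: int where N: "c + 1 \<le> of_int N" using ex_le_of_int by blast
  then have N0: "0 \<le> N" using psi.c_nonneg by linarith
  define H where "H \<theta> = (\<Sum>k\<in>{-N..N}. \<bar>F (\<theta> - of_int k)\<bar>)" for \<theta>
  have "continuous_on UNIV F"
    unfolding F_def[abs_def] by (rule continuous_translate_coeff_trunc_pow)
  then have "continuous_on {0..1} (\<lambda>\<theta>. F (\<theta> - of_int k))" for k
    by (rule continuous_on_compose2) (auto intro!: continuous_intros)
  then have "continuous_on {0..1} H"
    unfolding H_def by (intro continuous_on_sum continuous_on_rabs)
  then obtain \<theta>\<^sub>0 where \<theta>0: "\<theta>\<^sub>0 \<in> {0..1}" "\<And>\<theta>. \<theta> \<in> {0..1} \<Longrightarrow> H \<theta>\<^sub>0 \<le> H \<theta>"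
    using continuous_attains_inf[of "{0..1::real}" H] by (metis compact_Icc atLeastatMost_empty_iff zero_le_one)
  have "0 < H \<theta>\<^sub>0"
  proof -
    obtain k where k: "translate_coeff \<psi> (trunc_pow \<theta>\<^sub>0 m) k \<noteq> 0"
      using trunc_pow_not_orthogonal[OF m] by blast
    have "k \<in> {-N..N}" using translate_coeff_trunc_pow_support[OF m k] \<theta>0(1) N by auto
    then have "\<bar>F (\<theta>\<^sub>0 - of_int k)\<bar> \<le> H \<theta>\<^sub>0"
      unfolding H_def by (intro member_le_sum) auto
    then show ?thesis using k by (simp add: F_def translate_coeff_trunc_pow_shift[of \<theta>\<^sub>0 m k])
  qed
  define \<delta> where "\<delta> = H \<theta>\<^sub>0 / (2 * of_int N + 2)"
  have \<delta>: "0 < \<delta>" using \<open>0 < H \<theta>\<^sub>0\<close> N0 by (simp add: \<delta>_def)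
  have "\<exists>k. \<delta> \<le> \<bar>translate_coeff \<psi> (trunc_pow \<theta> m) k\<bar>" for \<theta>
  proof (rule ccontr)
    assume small: "\<nexists>k. \<delta> \<le> \<bar>translate_coeff \<psi> (trunc_pow \<theta> m) k\<bar>"
    have "\<bar>F (frac \<theta> - of_int k)\<bar> \<le> \<delta>" for k
    proof -
      have "F (frac \<theta> - of_int k) = translate_coeff \<psi> (trunc_pow \<theta> m) (\<lfloor>\<theta>\<rfloor> + k)"
        unfolding F_def translate_coeff_trunc_pow_shift[of \<theta> m "\<lfloor>\<theta>\<rfloor> + k"]
        by (simp add: frac_def algebra_simps)
      then show ?thesis using small[simplified, rule_format, of "\<lfloor>\<theta>\<rfloor> + k"] by simp
    qed
    then have "H (frac \<theta>) \<le> of_nat (card {-N..N}) * \<delta>"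
      unfolding H_def by (intro sum_bounded_above) auto
    also have "\<dots> = (2 * of_int N + 1) * \<delta>" using N0 by simp
    also have "\<dots> < (2 * of_int N + 2) * \<delta>" using \<delta> by simp
    also have "\<dots> = H \<theta>\<^sub>0" using N0 by (simp add: \<delta>_def)
    also have "\<dots> \<le> H (frac \<theta>)"
      using frac_lt_1[of \<theta>] frac_ge_0[of \<theta>] by (intro \<theta>0(2)) simp
    finally show False by simp
  qed
  with \<delta> show ?thesis by blast
qed

text \<open>After dilation by \<open>2^j\<close> the defect sits at \<open>2^j a\<close>, the truncated power is multiplied by \<open>2^(-mj)\<close>, and
  the error on the support of a translate meeting the defect is \<open>O(2^(-(m+1)j))\<close>. A single coefficient of
  size \<open>2^(-mj)\<close> already gives the bound, the factor \<open>2^(-j)\<close> coming from undoing the dilation.\<close>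

lemma defect_energy_lower_bound:
  assumes g: "locally_bounded g" and supp: "\<And>y. g y \<noteq> 0 \<Longrightarrow> \<bar>y\<bar> \<le> R" and m: "m \<le> d"
    and "0 < \<rho>" and deg: "degree P \<le> m" and J: "J \<noteq> 0"
    and expansion: "\<And>x. x \<noteq> a \<Longrightarrow> \<bar>x - a\<bar> < \<rho> \<Longrightarrow>
      \<bar>g x - (poly P x + J * trunc_pow a m x)\<bar> \<le> C * \<bar>x - a\<bar> ^ (m + 1)"
  shows "\<exists>\<kappa>>0. \<exists>N. \<forall>j\<ge>N. \<kappa> / 2 ^ j / 4 ^ (m * j) \<le> (LINT x|lborel. (Q_proj \<psi> j g x)\<^sup>2)"
proof -
  obtain \<delta> where \<delta>: "0 < \<delta>" "\<And>\<theta>. \<exists>k. \<delta> \<le> \<bar>translate_coeff \<psi> (trunc_pow \<theta> m) k\<bar>"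
    using trunc_pow_uniform_lower_bound[OF m] by blast
  define L where "L = (LINT u|lborel. \<bar>\<psi> u\<bar>)"
  define D where "D = \<bar>C\<bar> * (2 * c) ^ (m + 1) * L"
  define \<kappa> where "\<kappa> = \<bar>J\<bar> * \<delta> / 2"
  have L: "0 \<le> L" unfolding L_def by simp
  have c: "0 \<le> c" by (rule psi.c_nonneg)
  have \<kappa>: "0 < \<kappa>" using J \<delta>(1) by (simp add: \<kappa>_def)
  \<comment> \<open>From this level on the supports are short compared with \<open>\<rho>\<close> and
    the error is at most half the main term.\<close>
  obtain N where N: "max (2 * c / \<rho> + 1) (D / \<kappa>) \<le> 2 ^ N"
    using real_arch_pow[of 2 "max (2 * c / \<rho> + 1) (D / \<kappa>)"] by (auto intro: less_imp_le)
  have "\<kappa>\<^sup>2 / 2 ^ j / 4 ^ (m * j) \<le> (LINT x|lborel. (Q_proj \<psi> j g x)\<^sup>2)" if "N \<le> j" for j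
  proof -
    have "(2::real) ^ N \<le> 2 ^ j" using that by simp
    then have j: "2 * c / \<rho> + 1 \<le> 2 ^ j" "D / \<kappa> \<le> 2 ^ j" using N by linarith+
    define G where "G u = g (u / 2 ^ j)" for u
    define \<theta> where "\<theta> = 2 ^ j * a"
    define T where "T u = trunc_pow \<theta> m u" for u
    define q where "q = pcompose P [:0, 1 / 2 ^ j:]"
    have q: "poly q u = poly P (u / 2 ^ j)" for u by (simp add: q_def poly_pcompose)
    have degq: "degree q \<le> d" using deg m by (simp add: q_def degree_pcompose)
    have G: "locally_bounded G" unfolding G_def[abs_def] by (rule locally_bounded_scale[OF g])
    have T: "locally_bounded T" unfolding T_def by blast
    obtain k where k: "\<delta> \<le> \<bar>translate_coeff \<psi> T k\<bar>" using \<delta>(2) unfolding T_def by blast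
    have near: "\<bar>\<theta> - of_int k\<bar> \<le> c"
      using k \<delta>(1) unfolding T_def by (intro translate_coeff_trunc_pow_support[OF m]) auto
    define E where "E u = G u - poly q u - J / 2 ^ (m * j) * T u" for u
    have JT: "locally_bounded (\<lambda>u. J / 2 ^ (m * j) * T u)" by (intro locally_bounded_mult locally_bounded_const T)
    have E: "locally_bounded E" unfolding E_def[abs_def] by (intro locally_bounded_diff G JT locally_bounded_poly)
    have trunc_scale: "trunc_pow a m (u / 2 ^ j) = T u / 2 ^ (m * j)" for u
    proof -
      have "u / 2 ^ j - a = (u - \<theta>) / 2 ^ j" by (simp add: \<theta>_def field_simps)
      moreover have "a < u / 2 ^ j \<longleftrightarrow> \<theta> < u" by (simp add: \<theta>_def field_simps)
      ultimately show ?thesis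
        by (simp add: T_def trunc_pow_def power_divide power_mult[symmetric] mult.commute)
    qed
    have "\<bar>translate_coeff \<psi> E k\<bar> \<le> \<bar>C\<bar> * (2 * c / 2 ^ j) ^ (m + 1) * L"
      unfolding L_def
    proof (rule psi.translate_coeff_bound[OF E])
      show "AE u in lborel. \<psi> (u - of_int k) \<noteq> 0 \<longrightarrow> \<bar>E u\<bar> \<le> \<bar>C\<bar> * (2 * c / 2 ^ j) ^ (m + 1)"
        using AE_lborel_singleton[of \<theta>]
      proof eventually_elim
        case (elim u)
        show ?case
        proof
          assume "\<psi> (u - of_int k) \<noteq> 0"
          then have "\<bar>u - \<theta>\<bar> \<le> 2 * c" using psi.support[of "u - of_int k"] near by linarith
          moreover have "u / 2 ^ j - a = (u - \<theta>) / 2 ^ j" by (simp add: \<theta>_def field_simps)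
          ultimately have dist: "\<bar>u / 2 ^ j - a\<bar> \<le> 2 * c / 2 ^ j"
            by (simp add: divide_right_mono)
          also have "\<dots> < \<rho>"
          proof -
            have "2 * c / \<rho> < 2 ^ j" using j(1) by linarith
            then show ?thesis using \<open>0 < \<rho>\<close> by (simp add: field_simps)
          qed
          finally have "\<bar>u / 2 ^ j - a\<bar> < \<rho>" .
          moreover have "u / 2 ^ j \<noteq> a" using elim by (simp add: \<theta>_def field_simps)
          ultimately have "\<bar>E u\<bar> \<le> C * \<bar>u / 2 ^ j - a\<bar> ^ (m + 1)"
            using expansion[of "u / 2 ^ j"] by (simp add: E_def G_def q trunc_scale diff_diff_eq)
          also have "\<dots> \<le> \<bar>C\<bar> * (2 * c / 2 ^ j) ^ (m + 1)"
            using dist by (intro mult_mono power_mono) auto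
          finally show "\<bar>E u\<bar> \<le> \<bar>C\<bar> * (2 * c / 2 ^ j) ^ (m + 1)" .
        qed
      qed
    qed
    also have "\<dots> = D / 2 ^ j / 2 ^ (m * j)"
      by (simp add: D_def power_divide power_mult[symmetric] power_add mult.commute)
    also have "\<dots> \<le> \<kappa> / 2 ^ (m * j)"
      using j(2) \<kappa> by (intro divide_right_mono) (simp_all add: field_simps)
    finally have errE: "\<bar>translate_coeff \<psi> E k\<bar> \<le> \<kappa> / 2 ^ (m * j)" .
    have "translate_coeff \<psi> E k = translate_coeff \<psi> G k - J / 2 ^ (m * j) * translate_coeff \<psi> T k"
    proof -
      have "translate_coeff \<psi> E k = translate_coeff \<psi> (\<lambda>u. G u - poly q u) k - translate_coeff \<psi> (\<lambda>u. J / 2 ^ (m * j) * T u) k"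
        unfolding E_def[abs_def] using G JT by (intro psi.translate_coeff_diff) auto
      also have "translate_coeff \<psi> (\<lambda>u. G u - poly q u) k = translate_coeff \<psi> G k"
        using G by (subst psi.translate_coeff_diff) (auto simp: translate_coeff_psi_poly[OF degq])
      finally show ?thesis by (simp only: psi.translate_coeff_cmult)
    qed
    moreover have "2 * \<kappa> / 2 ^ (m * j) \<le> \<bar>J / 2 ^ (m * j) * translate_coeff \<psi> T k\<bar>"
      using k by (simp add: \<kappa>_def abs_mult abs_divide divide_right_mono mult_left_mono)
    ultimately have "\<kappa> / 2 ^ (m * j) \<le> \<bar>translate_coeff \<psi> G k\<bar>"
      using errE by linarith
    then have "(\<kappa> / 2 ^ (m * j))\<^sup>2 \<le> \<bar>translate_coeff \<psi> G k\<bar>\<^sup>2"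
      using \<kappa> by (intro power_mono) auto
    also have "\<dots> \<le> (LINT x|lborel. (translate_proj \<psi> G x)\<^sup>2)"
    proof -
      have "\<bar>y\<bar> \<le> 2 ^ j * R" if "G y \<noteq> 0" for y
        using supp[of "y / 2 ^ j"] that by (simp add: G_def abs_divide divide_le_eq mult.commute)
      then show ?thesis using psi.translate_coeff_le_proj_energy[OF G, of "2 ^ j * R" k] by simp
    qed
    finally have "(\<kappa> / 2 ^ (m * j))\<^sup>2 \<le> (LINT x|lborel. (translate_proj \<psi> G x)\<^sup>2)" .
    then have "(\<kappa> / 2 ^ (m * j))\<^sup>2 / 2 ^ j \<le> (LINT x|lborel. (translate_proj \<psi> G x)\<^sup>2) / 2 ^ j"
      by (rule divide_right_mono) simp
    also have "(LINT x|lborel. (translate_proj \<psi> G x)\<^sup>2) / 2 ^ j = (LINT x|lborel. (Q_proj \<psi> j g x)\<^sup>2)"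
      unfolding G_def[abs_def] by (rule psi.Q_proj_energy[OF g, symmetric])
    also have "(\<kappa> / 2 ^ (m * j))\<^sup>2 / 2 ^ j = \<kappa>\<^sup>2 / 2 ^ j / 4 ^ (m * j)"
    proof -
      have "((2::real) ^ (m * j))\<^sup>2 = 4 ^ (m * j)"
        by (simp add: power2_eq_square power_mult_distrib[symmetric])
      then show ?thesis by (simp only: power_divide divide_divide_eq_left mult.commute)
    qed
    finally show ?thesis .
  qed
  moreover have "0 < \<kappa>\<^sup>2" using \<kappa> by simp
  ultimately show ?thesis by blast
qed

text \<open>The polynomials are annihilated, so each coefficient of the dilated function is \<open>O(2^(-(d+1)j))\<close>. There
  are \<open>O(2^j)\<close> of them, and this factor is cancelled by the dilation.\<close>

lemma smooth_energy_upper_bound: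
  assumes g: "locally_bounded g" and supp: "\<And>y. g y \<noteq> 0 \<Longrightarrow> \<bar>y\<bar> \<le> R" and "0 \<le> R"
    and approx: "\<And>x\<^sub>0 h. 0 < h \<Longrightarrow> h \<le> 1 \<Longrightarrow>
      \<exists>P. degree P \<le> d \<and> (\<forall>x. \<bar>x - x\<^sub>0\<bar> \<le> h \<longrightarrow> \<bar>g x - poly P x\<bar> \<le> C * h ^ (d + 1))"
  shows "\<exists>B\<ge>0. \<exists>N. \<forall>j\<ge>N. (LINT x|lborel. (Q_proj \<psi> j g x)\<^sup>2) \<le> B / 4 ^ ((d + 1) * j)"
proof -
  define L where "L = (LINT u|lborel. \<bar>\<psi> u\<bar>)"
  define c' where "c' = c + 1"
  define M where "M = C * c' ^ (d + 1) * L"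
  define B where "B = (2 * R + 6 * c + 3) * M\<^sup>2"
  have c: "0 \<le> c" by (rule psi.c_nonneg)
  obtain N where N: "c' \<le> 2 ^ N"
    using real_arch_pow[of 2 c'] by (auto intro: less_imp_le)
  have "(LINT x|lborel. (Q_proj \<psi> j g x)\<^sup>2) \<le> B / 4 ^ ((d + 1) * j)" if "N \<le> j" for j
  proof -
    have "(2::real) ^ N \<le> 2 ^ j" using that by simp
    then have j: "c' \<le> 2 ^ j" using N by linarith
    define G where "G u = g (u / 2 ^ j)" for u
    have G: "locally_bounded G" unfolding G_def[abs_def] by (rule locally_bounded_scale[OF g])
    have suppG: "\<bar>y\<bar> \<le> 2 ^ j * R" if "G y \<noteq> 0" for y
      using supp[of "y / 2 ^ j"] that by (simp add: G_def abs_divide divide_le_eq mult.commute)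
    define h where "h = c' / 2 ^ j"
    have h: "0 < h" "h \<le> 1" using c j by (auto simp: h_def c'_def)
    have coeff: "\<bar>translate_coeff \<psi> G k\<bar> \<le> M / 2 ^ ((d + 1) * j)" for k
    proof -
      obtain P where degP: "degree P \<le> d"
        and P: "\<And>x. \<bar>x - of_int k / 2 ^ j\<bar> \<le> h \<Longrightarrow> \<bar>g x - poly P x\<bar> \<le> C * h ^ (d + 1)"
        using approx[OF h, of "of_int k / 2 ^ j"] by blast
      define q where "q = pcompose P [:0, 1 / 2 ^ j:]"
      have q: "poly q u = poly P (u / 2 ^ j)" for u by (simp add: q_def poly_pcompose)
      have degq: "degree q \<le> d" using degP by (simp add: q_def degree_pcompose)
      have "translate_coeff \<psi> G k = translate_coeff \<psi> (\<lambda>u. G u - poly q u) k"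
        using G by (subst psi.translate_coeff_diff) (auto simp: translate_coeff_psi_poly[OF degq])
      also have "\<bar>\<dots>\<bar> \<le> (C * h ^ (d + 1)) * L"
        unfolding L_def
      proof (rule psi.translate_coeff_bound)
        show "locally_bounded (\<lambda>u. G u - poly q u)" by (intro locally_bounded_diff G locally_bounded_poly)
        show "AE u in lborel. \<psi> (u - of_int k) \<noteq> 0 \<longrightarrow> \<bar>G u - poly q u\<bar> \<le> C * h ^ (d + 1)"
        proof (intro AE_I2 impI)
          fix u assume "\<psi> (u - of_int k) \<noteq> 0"
          then have "\<bar>u - of_int k\<bar> \<le> c'" using psi.support[of "u - of_int k"] by (simp add: c'_def)
          moreover have "u / 2 ^ j - of_int k / 2 ^ j = (u - of_int k) / 2 ^ j"
            by (simp add: diff_divide_distrib)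
          ultimately have "\<bar>u / 2 ^ j - of_int k / 2 ^ j\<bar> \<le> h"
            by (simp add: h_def divide_right_mono)
          then show "\<bar>G u - poly q u\<bar> \<le> C * h ^ (d + 1)"
            using P[of "u / 2 ^ j"] by (simp add: G_def q)
        qed
      qed
      also have "(C * h ^ (d + 1)) * L = M / 2 ^ ((d + 1) * j)"
        unfolding M_def h_def power_divide power_mult[symmetric] by (simp only: mult.commute[of j]) simp
      finally show ?thesis .
    qed
    define n where "n = \<lceil>2 ^ j * R + 3 * c\<rceil>"
    have n: "2 ^ j * R + 3 * c \<le> of_int n" unfolding n_def by simp
    have "0 \<le> 2 ^ j * R + 3 * c" using \<open>0 \<le> R\<close> c by simp
    then have n0: "0 \<le> n" using n by linarith
    have "(LINT x|lborel. (translate_proj \<psi> G x)\<^sup>2) = (\<Sum>k\<in>{-n..n}. (translate_coeff \<psi> G k)\<^sup>2)"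
      by (rule psi.proj_energy[OF G suppG n])
    also have "\<dots> \<le> of_nat (card {-n..n}) * (M / 2 ^ ((d + 1) * j))\<^sup>2"
    proof (rule sum_bounded_above)
      fix k
      have "\<bar>translate_coeff \<psi> G k\<bar>\<^sup>2 \<le> (M / 2 ^ ((d + 1) * j))\<^sup>2"
        using coeff[of k] by (intro power_mono) auto
      then show "(translate_coeff \<psi> G k)\<^sup>2 \<le> (M / 2 ^ ((d + 1) * j))\<^sup>2" by simp
    qed
    also have "\<dots> \<le> (2 ^ j * (2 * R + 6 * c + 3)) * (M / 2 ^ ((d + 1) * j))\<^sup>2"
    proof (rule mult_right_mono)
      have "of_int n \<le> 2 ^ j * R + 3 * c + 1" unfolding n_def by linarith
      moreover have "6 * c + 3 \<le> 2 ^ j * (6 * c + 3)"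
        using c mult_right_mono[of 1 "2 ^ j :: real" "6 * c + 3"] by simp
      ultimately show "of_nat (card {-n..n}) \<le> 2 ^ j * (2 * R + 6 * c + 3)"
        using n0 by (simp add: algebra_simps)
    qed simp
    also have "\<dots> = 2 ^ j * (B / 4 ^ ((d + 1) * j))"
    proof -
      have "((2::real) ^ ((d + 1) * j))\<^sup>2 = 4 ^ ((d + 1) * j)"
        by (simp add: power2_eq_square power_mult_distrib[symmetric])
      then show ?thesis by (simp only: B_def power_divide) simp
    qed
    finally show ?thesis
      unfolding psi.Q_proj_energy[OF g] G_def[symmetric] by (simp add: field_simps)
  qed
  moreover have "0 \<le> B" using c \<open>0 \<le> R\<close> by (simp add: B_def)
  ultimately show ?thesis by blast
qed

end

section \<open>Expansions of piecewise-smooth functions\<close>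

lemma C_k_on_subset:
  assumes "C_k_on k f S" "T \<subseteq> S"
  shows "C_k_on k f T"
proof -
  obtain D where D: "\<forall>x\<in>S. D 0 x = f x"
      "\<forall>i<k. \<forall>x\<in>S. (D i has_real_derivative D (Suc i) x) (at x within S)"
      "continuous_on S (D k)"
    using assms(1) unfolding C_k_on_def by blast
  have "(D i has_real_derivative D (Suc i) x) (at x within T)" if "i < k" "x \<in> T" for i x
    using D(2) assms(2) that by (meson DERIV_subset subsetD)
  then show ?thesis
    unfolding C_k_on_def using D assms(2)
    by (intro exI[of _ D]) (auto intro: continuous_on_subset)
qed

lemma C_k_on_continuous:
  assumes "C_k_on k f S"
  shows "continuous_on S f"
proof -
  obtain D where D: "\<forall>x\<in>S. D 0 x = f x"
      "\<forall>i<k. \<forall>x\<in>S. (D i has_real_derivative D (Suc i) x) (at x within S)"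
      "continuous_on S (D k)"
    using assms unfolding C_k_on_def by blast
  have "continuous_on S (D 0)"
  proof (cases k)
    case 0
    then show ?thesis using D(3) by simp
  next
    case (Suc l)
    then show ?thesis using D(2) by (intro DERIV_continuous_on[of S _ "D (Suc 0)"]) auto
  qed
  then show ?thesis using D(1) by (simp cong: continuous_on_cong)
qed

lemma iterated_deriv_eq:
  assumes "open S" and D0: "\<And>x. x \<in> S \<Longrightarrow> D 0 x = f x"
    and D: "\<And>i x. i < n \<Longrightarrow> x \<in> S \<Longrightarrow> (D i has_real_derivative D (Suc i) x) (at x)"
  shows "i \<le> n \<Longrightarrow> x \<in> S \<Longrightarrow> (deriv ^^ i) f x = D i x"
proof (induction i arbitrary: x)
  case 0
  then show ?case using D0 by simp
next
  case (Suc i)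
  have "((deriv ^^ i) f has_real_derivative D (Suc i) x) (at x)"
  proof (rule has_field_derivative_transform_within_open[of "D i"])
    show "(D i has_real_derivative D (Suc i) x) (at x)" using D Suc by simp
    show "D i y = (deriv ^^ i) f y" if "y \<in> S" for y using Suc that by simp
  qed (use assms Suc in auto)
  then show ?case by (simp add: DERIV_imp_deriv)
qed

lemma right_deriv_eqI:
  assumes "(g \<longlongrightarrow> L) (at_right a)" "a < u" "\<And>x. a < x \<Longrightarrow> x < u \<Longrightarrow> (deriv ^^ m) f x = g x"
  shows "right_deriv m f a = L"
  unfolding right_deriv_def
proof (rule tendsto_Lim)
  have "eventually (\<lambda>x. x \<in> {a<..<u}) (at_right a)"
    using assms(2) by (rule eventually_at_right_real)
  then have "eventually (\<lambda>x. (deriv ^^ m) f x = g x) (at_right a)"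
    by eventually_elim (use assms(3) in auto)
  then show "((deriv ^^ m) f \<longlongrightarrow> L) (at_right a)"
    using assms(1) by (simp add: tendsto_cong)
qed simp

lemma left_deriv_eqI:
  assumes "(g \<longlongrightarrow> L) (at_left a)" "l < a" "\<And>x. l < x \<Longrightarrow> x < a \<Longrightarrow> (deriv ^^ m) f x = g x"
  shows "left_deriv m f a = L"
  unfolding left_deriv_def
proof (rule tendsto_Lim)
  have "eventually (\<lambda>x. x \<in> {l<..<a}) (at_left a)"
    using assms(2) by (rule eventually_at_left_real)
  then have "eventually (\<lambda>x. (deriv ^^ m) f x = g x) (at_left a)"
    by eventually_elim (use assms(3) in auto)
  then show "((deriv ^^ m) f \<longlongrightarrow> L) (at_left a)"
    using assms(1) by (simp add: tendsto_cong)
qed simp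

text \<open>One-sided derivatives are defined as limits of iterated derivatives on the open
  interval; a smooth extension to the closed interval identifies them.\<close>

lemma one_sided_derivs_eq:
  assumes "l < u" and D0: "\<And>x. l < x \<Longrightarrow> x < u \<Longrightarrow> D 0 x = f x"
    and D: "\<And>i x. i < n \<Longrightarrow> x \<in> {l..u} \<Longrightarrow> (D i has_real_derivative D (Suc i) x) (at x within {l..u})"
    and i: "i < n"
  shows "right_deriv i f l = D i l" "left_deriv i f u = D i u"
proof -
  have deriv_eq: "(deriv ^^ i) f x = D i x" if "l < x" "x < u" for x
  proof (rule iterated_deriv_eq[of "{l<..<u}" D f n])
    fix i x assume "i < n" "x \<in> {l<..<u}"
    then show "(D i has_real_derivative D (Suc i) x) (at x)"
      using D[of i x] at_within_Icc_at[of l x u] by simp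
  qed (use D0 i that in auto)
  have lim: "(D i \<longlongrightarrow> D i x) (at x within {l..u})" if "x \<in> {l..u}" for x
    using DERIV_continuous[OF D[OF i that]] by (simp add: continuous_within)
  show "right_deriv i f l = D i l"
    using lim[of l] \<open>l < u\<close> deriv_eq
    by (intro right_deriv_eqI[where u = u]) (auto simp: at_within_Icc_at_right)
  show "left_deriv i f u = D i u"
    using lim[of u] \<open>l < u\<close> deriv_eq
    by (intro left_deriv_eqI[where l = l]) (auto simp: at_within_Icc_at_left)
qed

lemma C_k_on_UNIV_derivs_agree:
  assumes "C_k_on k f UNIV" "i \<le> k"
  shows "left_deriv i f a = right_deriv i f a"
proof -
  obtain D where D: "\<And>x. D 0 x = f x" "\<And>i x. i < k \<Longrightarrow> (D i has_real_derivative D (Suc i) x) (at x)"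
      "continuous_on UNIV (D k)"
    using assms(1) unfolding C_k_on_def by auto
  have deriv_eq: "(deriv ^^ i) f x = D i x" for x
    using assms(2) D by (intro iterated_deriv_eq[of UNIV D f k]) auto
  have "isCont (D i) a"
  proof (cases "i = k")
    case True
    then show ?thesis using D(3) by (simp add: continuous_on_eq_continuous_at)
  next
    case False
    then have "i < k" using assms(2) by simp
    then show ?thesis using D(2) DERIV_isCont by blast
  qed
  then have lim: "(D i \<longlongrightarrow> D i a) (at a)" by (simp add: isCont_def)
  have "left_deriv i f a = D i a"
    by (rule left_deriv_eqI[where g = "D i" and l = "a - 1"])
       (use lim deriv_eq in \<open>auto simp: filterlim_at_split\<close>)
  moreover have "right_deriv i f a = D i a"
    by (rule right_deriv_eqI[where g = "D i" and u = "a + 1"])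
       (use lim deriv_eq in \<open>auto simp: filterlim_at_split\<close>)
  ultimately show ?thesis by simp
qed

definition taylor_poly :: "(nat \<Rightarrow> real) \<Rightarrow> nat \<Rightarrow> real \<Rightarrow> real poly" where
  "taylor_poly v n w = (\<Sum>i\<le>n. smult (v i / fact i) ([:- w, 1:] ^ i))"

lemma poly_taylor_poly: "poly (taylor_poly v n w) x = (\<Sum>i\<le>n. v i * (x - w) ^ i / fact i)"
  by (simp add: taylor_poly_def poly_sum)

lemma degree_taylor_poly: "degree (taylor_poly v n w) \<le> n"
  unfolding taylor_poly_def
  by (intro degree_sum_le order_trans[OF degree_smult_le]) (auto simp: degree_linear_power)

lemma taylor_poly_error:
  assumes D: "\<And>i x. i \<le> n \<Longrightarrow> x \<in> {l..u} \<Longrightarrow> (D i has_real_derivative D (Suc i) x) (at x within {l..u})"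
    and cont: "continuous_on {l..u} (D (Suc n))"
  shows "\<exists>C\<ge>0. \<forall>w\<in>{l..u}. \<forall>x\<in>{l..u}.
    \<bar>D 0 x - poly (taylor_poly (\<lambda>i. D i w) n w) x\<bar> \<le> C * \<bar>x - w\<bar> ^ (n + 1)"
proof -
  have "compact (D (Suc n) ` {l..u})"
    using cont by (rule compact_continuous_image) simp
  then obtain B where B: "\<And>x. x \<in> {l..u} \<Longrightarrow> norm (D (Suc n) x) \<le> B"
    using compact_imp_bounded[of "D (Suc n) ` {l..u}"] unfolding bounded_iff by blast
  have "\<bar>D 0 x - poly (taylor_poly (\<lambda>i. D i w) n w) x\<bar> \<le> \<bar>B\<bar> / fact n * \<bar>x - w\<bar> ^ (n + 1)"
    if "w \<in> {l..u}" "x \<in> {l..u}" for w x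
  proof -
    have "norm (D 0 x - (\<Sum>i\<le>n. D i w * (x - w) ^ i / fact i)) \<le> B * norm (x - w) ^ Suc n / fact n"
      by (rule field_Taylor[where S = "{l..u}"]) (use D B that in auto)
    also have "\<dots> \<le> \<bar>B\<bar> * norm (x - w) ^ Suc n / fact n"
      by (intro divide_right_mono mult_right_mono) auto
    finally show ?thesis by (simp add: poly_taylor_poly)
  qed
  then show ?thesis by (intro exI[of _ "\<bar>B\<bar> / fact n"]) auto
qed

text \<open>Taylor expansion on both sides of the first defect. The derivatives of order below \<open>m\<close> agree since
  \<open>f\<close> is of class \<open>C^(m-1)\<close>, so the two Taylor polynomials differ only in their leading terms, by the jump.\<close>

lemma first_defect_expansion:
  assumes ps: "piecewise_smooth f m n a"
  shows "\<exists>P C \<rho>. degree P \<le> m \<and> 0 < \<rho> \<and> (\<forall>x. x \<noteq> a 1 \<longrightarrow> \<bar>x - a 1\<bar> < \<rho> \<longrightarrow>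
    \<bar>f x - (poly P x + (right_deriv m f (a 1) - left_deriv m f (a 1)) / fact m * trunc_pow (a 1) m x)\<bar>
      \<le> C * \<bar>x - a 1\<bar> ^ (m + 1))"
proof -
  define b where "b = a 1"
  have "1 \<le> n" using ps unfolding piecewise_smooth_def by auto
  obtain gl where gl: "C_k_on (m + 1) gl {..b}" "\<forall>x\<in>interior {..b}. gl x = f x"
    using ps unfolding piecewise_smooth_def C_k_extends_def b_def by blast
  obtain u gr where u: "b < u" and gr: "C_k_on (m + 1) gr {b..u}" "\<And>x. b < x \<Longrightarrow> x < u \<Longrightarrow> gr x = f x"
  proof (cases "n = 1")
    case True
    then obtain gr where "C_k_on (m + 1) gr {b..}" "\<forall>x\<in>interior {b..}. gr x = f x"
      using ps unfolding piecewise_smooth_def C_k_extends_def b_def by blast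
    then show ?thesis using C_k_on_subset[of "m + 1" gr "{b..}" "{b..b + 1}"] that[of "b + 1" gr] by auto
  next
    case False
    then have n: "1 < n" using \<open>1 \<le> n\<close> by simp
    then have "C_k_extends (m + 1) f {a 1..a (1 + 1)}"
      using ps unfolding piecewise_smooth_def by auto
    moreover have "a 1 < a 2"
    proof (rule strict_mono_onD[of "{1..n}" a])
      show "strict_mono_on {1..n} a" using ps unfolding piecewise_smooth_def by blast
    qed (use n in auto)
    ultimately show ?thesis using that[of "a 2"] unfolding C_k_extends_def b_def by (auto simp: numeral_2_eq_2)
  qed
  have "C_k_on (m + 1) gl {b - 1..b}" using gl(1) by (rule C_k_on_subset) auto
  then obtain D where D: "\<And>x. x \<in> {b - 1..b} \<Longrightarrow> D 0 x = gl x"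
      "\<And>i x. i < m + 1 \<Longrightarrow> x \<in> {b - 1..b} \<Longrightarrow> (D i has_real_derivative D (Suc i) x) (at x within {b - 1..b})"
      "continuous_on {b - 1..b} (D (m + 1))"
    unfolding C_k_on_def by blast
  obtain E where E: "\<And>x. x \<in> {b..u} \<Longrightarrow> E 0 x = gr x"
      "\<And>i x. i < m + 1 \<Longrightarrow> x \<in> {b..u} \<Longrightarrow> (E i has_real_derivative E (Suc i) x) (at x within {b..u})"
      "continuous_on {b..u} (E (m + 1))"
    using gr(1) unfolding C_k_on_def by blast
  have Df: "D 0 x = f x" if "b - 1 < x" "x < b" for x
    using that D(1)[of x] gl(2) by simp
  have Ef: "E 0 x = f x" if "b < x" "x < u" for x
    using that E(1)[of x] gr(2) by simp
  have left: "left_deriv i f b = D i b" if "i \<le> m" for i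
    by (rule one_sided_derivs_eq(2)[of "b - 1" b D f "m + 1"]) (use Df D(2) that in auto)
  have right: "right_deriv i f b = E i b" if "i \<le> m" for i
    by (rule one_sided_derivs_eq(1)[of b u E f "m + 1"]) (use Ef E(2) that u in auto)
  have agree: "D i b = E i b" if "i < m" for i
  proof -
    have "C_k_on (m - 1) f UNIV" using ps that unfolding piecewise_smooth_def by simp
    then have "left_deriv i f b = right_deriv i f b"
      using that by (intro C_k_on_UNIV_derivs_agree) auto
    then show ?thesis using left[of i] right[of i] that by simp
  qed
  define J where "J = (right_deriv m f b - left_deriv m f b) / fact m"
  define P where "P = taylor_poly (\<lambda>i. D i b) m b"
  have P_right: "poly (taylor_poly (\<lambda>i. E i b) m b) x = poly P x + J * (x - b) ^ m" for x
  proof -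
    have "(\<Sum>i<m. E i b * (x - b) ^ i / fact i) = (\<Sum>i<m. D i b * (x - b) ^ i / fact i)"
      using agree by (intro sum.cong) auto
    then show ?thesis
      by (simp add: P_def poly_taylor_poly lessThan_Suc_atMost[symmetric] J_def left right
          diff_divide_distrib left_diff_distrib)
  qed
  obtain C\<^sub>1 where C1: "\<And>x. x \<in> {b - 1..b} \<Longrightarrow> \<bar>D 0 x - poly P x\<bar> \<le> C\<^sub>1 * \<bar>x - b\<bar> ^ (m + 1)"
  proof -
    have "\<exists>C\<ge>0. \<forall>w\<in>{b - 1..b}. \<forall>x\<in>{b - 1..b}.
        \<bar>D 0 x - poly (taylor_poly (\<lambda>i. D i w) m w) x\<bar> \<le> C * \<bar>x - w\<bar> ^ (m + 1)"
      by (rule taylor_poly_error) (use D(2,3) in auto)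
    moreover have "b \<in> {b - 1..b}" by simp
    ultimately show ?thesis using that unfolding P_def by blast
  qed
  obtain C\<^sub>2 where C2: "\<And>x. x \<in> {b..u} \<Longrightarrow>
      \<bar>E 0 x - (poly P x + J * (x - b) ^ m)\<bar> \<le> C\<^sub>2 * \<bar>x - b\<bar> ^ (m + 1)"
  proof -
    have "\<exists>C\<ge>0. \<forall>w\<in>{b..u}. \<forall>x\<in>{b..u}.
        \<bar>E 0 x - poly (taylor_poly (\<lambda>i. E i w) m w) x\<bar> \<le> C * \<bar>x - w\<bar> ^ (m + 1)"
      by (rule taylor_poly_error) (use E(2,3) in auto)
    moreover have "b \<in> {b..u}" using u by simp
    ultimately show ?thesis using that unfolding P_right[symmetric] by blast
  qed
  define \<rho> where "\<rho> = min 1 (u - b)"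
  have "\<bar>f x - (poly P x + J * trunc_pow b m x)\<bar> \<le> max C\<^sub>1 C\<^sub>2 * \<bar>x - b\<bar> ^ (m + 1)"
    if x: "x \<noteq> b" "\<bar>x - b\<bar> < \<rho>" for x
  proof (cases "x < b")
    case True
    then have "x \<in> {b - 1<..<b}" using x by (auto simp: \<rho>_def)
    then have "\<bar>f x - (poly P x + J * trunc_pow b m x)\<bar> \<le> C\<^sub>1 * \<bar>x - b\<bar> ^ (m + 1)"
      using C1[of x] Df[of x] by (simp add: trunc_pow_def)
    also have "\<dots> \<le> max C\<^sub>1 C\<^sub>2 * \<bar>x - b\<bar> ^ (m + 1)" by (intro mult_right_mono) auto
    finally show ?thesis .
  next
    case False
    then have "x \<in> {b<..<u}" using x by (auto simp: \<rho>_def)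
    then have "\<bar>f x - (poly P x + J * trunc_pow b m x)\<bar> \<le> C\<^sub>2 * \<bar>x - b\<bar> ^ (m + 1)"
      using C2[of x] Ef[of x] by (simp add: trunc_pow_def)
    also have "\<dots> \<le> max C\<^sub>1 C\<^sub>2 * \<bar>x - b\<bar> ^ (m + 1)" by (intro mult_right_mono) auto
    finally show ?thesis .
  qed
  moreover have "0 < \<rho>" using u by (simp add: \<rho>_def)
  moreover have "degree P \<le> m" unfolding P_def by (rule degree_taylor_poly)
  ultimately show ?thesis unfolding J_def b_def by blast
qed

lemma defect_in_support:
  assumes supp: "\<And>x. f x \<noteq> 0 \<Longrightarrow> x \<in> {l..u}" and "left_deriv m f a \<noteq> right_deriv m f a"
  shows "a \<in> {l..u}"
proof (rule ccontr)
  assume a: "a \<notin> {l..u}"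
  have "open (- {l..u})" by (simp add: open_Compl)
  then obtain e where e: "0 < e" "ball a e \<subseteq> - {l..u}"
    using a by (meson ComplI open_contains_ball)
  have zero: "(deriv ^^ m) f x = 0" if "x \<in> ball a e" for x
  proof (rule iterated_deriv_eq[of "ball a e" "\<lambda>_ _. 0" f m])
    show "0 = f y" if "y \<in> ball a e" for y
      using supp[of y] subsetD[OF e(2) that] by auto
  qed (use that in auto)
  have "left_deriv m f a = 0"
    by (rule left_deriv_eqI[where g = "\<lambda>_. 0" and l = "a - e"])
       (use e zero in \<open>auto simp: dist_real_def\<close>)
  moreover have "right_deriv m f a = 0"
    by (rule right_deriv_eqI[where g = "\<lambda>_. 0" and u = "a + e"])
       (use e zero in \<open>auto simp: dist_real_def\<close>)
  ultimately show False using assms(2) by simp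
qed

lemma piecewise_smooth_bounded:
  assumes ps: "piecewise_smooth f m n a" and supp: "\<And>x. f x \<noteq> 0 \<Longrightarrow> \<bar>x\<bar> \<le> R"
  shows "\<exists>M. \<forall>x. \<bar>f x\<bar> \<le> M"
proof -
  define bdd where "bdd S \<longleftrightarrow> (\<exists>M. \<forall>x\<in>S. \<bar>f x\<bar> \<le> M)" for S
  have un: "bdd (S \<union> T)" if S: "bdd S" and T: "bdd T" for S T
  proof -
    obtain M N where "\<And>x. x \<in> S \<Longrightarrow> \<bar>f x\<bar> \<le> M" "\<And>x. x \<in> T \<Longrightarrow> \<bar>f x\<bar> \<le> N"
      using S T unfolding bdd_def by blast
    then have "\<forall>x\<in>S \<union> T. \<bar>f x\<bar> \<le> max M N" by (meson UnE max.coboundedI1 max.coboundedI2)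
    then show ?thesis unfolding bdd_def by blast
  qed
  have mono: "bdd S" if "bdd T" "S \<subseteq> T" for S T using that unfolding bdd_def by blast
  have point: "bdd {x}" for x unfolding bdd_def by auto
  have piece: "bdd (interior I)" if ext: "C_k_extends k f I" and "closed I" for k I
  proof -
    obtain g where g: "C_k_on k g I" "\<forall>x\<in>interior I. g x = f x"
      using ext unfolding C_k_extends_def by blast
    have "compact ({-R..R} \<inter> I)" using \<open>closed I\<close> by (intro compact_Int_closed) auto
    moreover have "continuous_on ({-R..R} \<inter> I) g"
      using C_k_on_continuous[OF g(1)] by (rule continuous_on_subset) auto
    ultimately have "bounded (g ` ({-R..R} \<inter> I))"
      by (intro compact_imp_bounded compact_continuous_image)
    then obtain M where M: "\<And>x. x \<in> {-R..R} \<inter> I \<Longrightarrow> \<bar>g x\<bar> \<le> M"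
      unfolding bounded_iff by (metis imageI real_norm_def)
    have "\<bar>f x\<bar> \<le> \<bar>M\<bar>" if x: "x \<in> interior I" for x
    proof (cases "f x = 0")
      case False
      then have "x \<in> {-R..R} \<inter> I" using supp[of x] x interior_subset[of I] by (auto simp: abs_le_iff)
      then show ?thesis using M[of x] g(2) x by force
    qed simp
    then show ?thesis unfolding bdd_def by blast
  qed
  have left: "bdd {..a i}" if "i \<in> {1..n}" for i
  proof -
    have "1 \<le> i" "i \<le> n" using that by auto
    then show ?thesis
    proof (induction i rule: dec_induct)
      case base
      have "bdd (interior {..a 1})"
        using ps unfolding piecewise_smooth_def by (intro piece) auto
      from un[OF this point[of "a 1"]] show ?case by (rule mono) auto
    next
      case (step i)
      have "bdd (interior {a i..a (i + 1)})"
        using ps step unfolding piecewise_smooth_def by (intro piece) auto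
      moreover have "bdd {..a i}" using step by simp
      ultimately have "bdd ({..a i} \<union> interior {a i..a (i + 1)} \<union> {a (i + 1)})"
        by (intro un point)
      then show ?case by (rule mono) auto
    qed
  qed
  have "1 \<le> n" using ps unfolding piecewise_smooth_def by auto
  moreover have "bdd (interior {a n..})"
    using ps unfolding piecewise_smooth_def by (intro piece) auto
  ultimately have "bdd ({..a n} \<union> interior {a n..})" using left by (intro un) auto
  then have "bdd UNIV" by (rule mono) auto
  then show ?thesis unfolding bdd_def by blast
qed

text \<open>The values of \<open>xi \<tau>\<close> on \<open>[-3/2, 3/2]\<close>, its two linear factors being merged into \<open>9/4 - x\<^sup>2\<close>.\<close>

definition xi_poly :: "nat \<Rightarrow> real poly" where
  "xi_poly \<tau> = smult (fact (2 * \<tau> + 3) / (fact (\<tau> + 1))\<^sup>2 * (1 / 3 ^ (2 * \<tau> + 3)))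
     ([:9 / 4, 0, - 1:] ^ (\<tau> + 1))"

lemma poly_xi_poly:
  "poly (xi_poly \<tau>) x = fact (2 * \<tau> + 3) / (fact (\<tau> + 1))\<^sup>2 * (1 / 3 ^ (2 * \<tau> + 3)) *
     (9 / 4 - x\<^sup>2) ^ (\<tau> + 1)"
proof -
  have "poly [:9 / 4, 0, - 1:] x = 9 / 4 - x\<^sup>2" by (simp add: power2_eq_square)
  then show ?thesis by (simp only: xi_poly_def poly_smult poly_power)
qed

lemma xi_eq_poly: "xi \<tau> x = (if \<bar>x\<bar> \<le> 3 / 2 then poly (xi_poly \<tau>) x else 0)"
proof -
  have "(3 / 2 - x) ^ (\<tau> + 1) * (3 / 2 + x) ^ (\<tau> + 1) = (9 / 4 - x\<^sup>2) ^ (\<tau> + 1)"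
    unfolding power_mult_distrib[symmetric] by (simp add: algebra_simps power2_eq_square)
  moreover have "indicator {-3/2..3/2} x = (if \<bar>x\<bar> \<le> 3 / 2 then 1 else 0 :: real)"
    by (auto simp: indicator_def)
  ultimately show ?thesis by (simp only: xi_def poly_xi_poly mult.assoc) simp
qed

lemma xi_poly_form:
  obtains A where "0 < A" "\<And>x. poly (xi_poly \<tau>) x = A * (9 / 4 - x\<^sup>2) ^ (\<tau> + 1)"
proof
  show "0 < fact (2 * \<tau> + 3) / (fact (\<tau> + 1))\<^sup>2 * (1 / 3 ^ (2 * \<tau> + 3) :: real)" by simp
qed (rule poly_xi_poly)

lemma locally_bounded_xi: "locally_bounded (xi \<tau>)"
proof -
  have "locally_bounded (\<lambda>x. if x \<in> {-3/2..3/2} then poly (xi_poly \<tau>) x else 0)"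
    by (rule locally_bounded_restrict) auto
  moreover have "xi \<tau> = (\<lambda>x. if x \<in> {-3/2..3/2} then poly (xi_poly \<tau>) x else 0)"
    by (auto simp: xi_eq_poly fun_eq_iff abs_le_iff)
  ultimately show ?thesis by simp
qed

lemma xi_nonneg: "0 \<le> xi \<tau> x"
proof -
  obtain A where A: "0 < A" "\<And>x. poly (xi_poly \<tau>) x = A * (9 / 4 - x\<^sup>2) ^ (\<tau> + 1)"
    using xi_poly_form[of \<tau>] by blast
  have "x\<^sup>2 \<le> 9 / 4" if "\<bar>x\<bar> \<le> 3 / 2"
    using abs_le_square_iff[of x "3 / 2"] that by (simp add: power2_eq_square)
  then show ?thesis using A by (simp add: xi_eq_poly)
qed

lemma xi_lower_bound:
  assumes "\<bar>x\<bar> \<le> 5 / 4"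
  shows "xi \<tau> (5 / 4) \<le> xi \<tau> x" "0 < xi \<tau> (5 / 4)"
proof -
  obtain A where A: "0 < A" "\<And>x. poly (xi_poly \<tau>) x = A * (9 / 4 - x\<^sup>2) ^ (\<tau> + 1)"
    using xi_poly_form[of \<tau>] by blast
  have "x\<^sup>2 \<le> (5 / 4)\<^sup>2" using abs_le_square_iff[of x "5 / 4"] assms by simp
  then have "(9 / 4 - (5 / 4)\<^sup>2) ^ (\<tau> + 1) \<le> (9 / 4 - x\<^sup>2) ^ (\<tau> + 1)"
    by (intro power_mono) (auto simp: power2_eq_square)
  then show "xi \<tau> (5 / 4) \<le> xi \<tau> x"
    using A assms by (simp add: xi_eq_poly)
  show "0 < xi \<tau> (5 / 4)" using A by (simp add: xi_eq_poly power2_eq_square)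
qed

lemma poly_taylor_error:
  fixes p :: "real poly"
  shows "\<exists>C\<ge>0. \<forall>w\<in>{l..u}. \<exists>P. degree P \<le> n \<and>
    (\<forall>x\<in>{l..u}. \<bar>poly p x - poly P x\<bar> \<le> C * \<bar>x - w\<bar> ^ (n + 1))"
proof -
  define D where "D i = poly ((pderiv ^^ i) p)" for i
  have "(D i has_real_derivative D (Suc i) x) (at x within {l..u})" for i x
    unfolding D_def by (simp add: poly_DERIV DERIV_subset[OF poly_DERIV])
  moreover have "continuous_on {l..u} (D (Suc n))" unfolding D_def by (simp add: continuous_on_poly)
  ultimately obtain C where "0 \<le> C" "\<And>w x. w \<in> {l..u} \<Longrightarrow> x \<in> {l..u} \<Longrightarrow>
    \<bar>D 0 x - poly (taylor_poly (\<lambda>i. D i w) n w) x\<bar> \<le> C * \<bar>x - w\<bar> ^ (n + 1)"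
    using taylor_poly_error[of n l u D] by blast
  moreover have "D 0 = poly p" by (simp add: D_def)
  ultimately show ?thesis using degree_taylor_poly by metis
qed

text \<open>A window inside \<open>[-3/2, 3/2]\<close> sees a polynomial, to which Taylor's formula applies uniformly. Any other
  window contains only points that are outside or within \<open>2 * h\<close> of an end of the interval, where
  \<open>xi \<tau>\<close> has a zero of order \<open>\<tau> + 1\<close>, so the zero polynomial is good enough.\<close>

lemma xi_approximation:
  assumes "n \<le> \<tau>"
  shows "\<exists>C. \<forall>x\<^sub>0 h. 0 < h \<longrightarrow> h \<le> 1 \<longrightarrow>
    (\<exists>P. degree P \<le> n \<and> (\<forall>x. \<bar>x - x\<^sub>0\<bar> \<le> h \<longrightarrow> \<bar>xi \<tau> x - poly P x\<bar> \<le> C * h ^ (n + 1)))"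
proof -
  obtain A where A: "0 < A" "\<And>x. poly (xi_poly \<tau>) x = A * (9 / 4 - x\<^sup>2) ^ (\<tau> + 1)"
    using xi_poly_form[of \<tau>] by blast
  obtain C where C: "0 \<le> C" "\<And>w. w \<in> {-3/2..3/2} \<Longrightarrow> \<exists>P. degree P \<le> n \<and>
    (\<forall>x\<in>{-3/2..3/2}. \<bar>poly (xi_poly \<tau>) x - poly P x\<bar> \<le> C * \<bar>x - w\<bar> ^ (n + 1))"
    using poly_taylor_error[of "-3/2" "3/2" n "xi_poly \<tau>"] by blast
  define C' where "C' = C + A * 6 ^ (\<tau> + 1)"
  have "\<exists>P. degree P \<le> n \<and> (\<forall>x. \<bar>x - x\<^sub>0\<bar> \<le> h \<longrightarrow> \<bar>xi \<tau> x - poly P x\<bar> \<le> C' * h ^ (n + 1))"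
    if h: "0 < h" "h \<le> 1" for x\<^sub>0 h
  proof (cases "\<bar>x\<^sub>0\<bar> + h \<le> 3 / 2")
    case True
    then have "x\<^sub>0 \<in> {-3/2..3/2}" using h by auto
    then obtain P where P: "degree P \<le> n"
        "\<And>x. x \<in> {-3/2..3/2} \<Longrightarrow> \<bar>poly (xi_poly \<tau>) x - poly P x\<bar> \<le> C * \<bar>x - x\<^sub>0\<bar> ^ (n + 1)"
      using C(2) by blast
    have "\<bar>xi \<tau> x - poly P x\<bar> \<le> C' * h ^ (n + 1)" if x: "\<bar>x - x\<^sub>0\<bar> \<le> h" for x
    proof -
      have "\<bar>x\<bar> \<le> 3 / 2" using x True by linarith
      then have "\<bar>xi \<tau> x - poly P x\<bar> \<le> C * \<bar>x - x\<^sub>0\<bar> ^ (n + 1)"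
        using P(2)[of x] abs_le_iff[of x "3 / 2"] by (simp add: xi_eq_poly)
      also have "\<dots> \<le> C' * h ^ (n + 1)"
        using C(1) A(1) h x by (intro mult_mono power_mono) (auto simp: C'_def)
      finally show ?thesis .
    qed
    with P(1) show ?thesis by blast
  next
    case False
    have "\<bar>xi \<tau> x\<bar> \<le> C' * h ^ (n + 1)" if x: "\<bar>x - x\<^sub>0\<bar> \<le> h" for x
    proof (cases "\<bar>x\<bar> \<le> 3 / 2")
      case True
      have "3 / 2 - \<bar>x\<bar> \<le> 2 * h" using x False by linarith
      then have "(3 / 2 - \<bar>x\<bar>) * (3 / 2 + \<bar>x\<bar>) \<le> (2 * h) * 3"
        using True h by (intro mult_mono) auto
      moreover have "(3 / 2 - \<bar>x\<bar>) * (3 / 2 + \<bar>x\<bar>) = 9 / 4 - x\<^sup>2"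
        by (simp add: algebra_simps power2_eq_square abs_mult_self_eq)
      moreover have "0 \<le> (3 / 2 - \<bar>x\<bar>) * (3 / 2 + \<bar>x\<bar>)" using True by simp
      ultimately have "0 \<le> 9 / 4 - x\<^sup>2" "9 / 4 - x\<^sup>2 \<le> 6 * h" by linarith+
      then have "(9 / 4 - x\<^sup>2) ^ (\<tau> + 1) \<le> (6 * h) ^ (\<tau> + 1)"
        by (intro power_mono) auto
      also have "\<dots> = 6 ^ (\<tau> + 1) * h ^ (\<tau> + 1)" by (rule power_mult_distrib)
      also have "\<dots> \<le> 6 ^ (\<tau> + 1) * h ^ (n + 1)"
        using h assms by (intro mult_left_mono power_decreasing) auto
      finally have "(9 / 4 - x\<^sup>2) ^ (\<tau> + 1) \<le> 6 ^ (\<tau> + 1) * h ^ (n + 1)" .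
      then have "A * (9 / 4 - x\<^sup>2) ^ (\<tau> + 1) \<le> A * (6 ^ (\<tau> + 1) * h ^ (n + 1))"
        using A(1) by (intro mult_left_mono) auto
      also have "\<dots> \<le> C' * h ^ (n + 1)"
        using C(1) h by (simp add: C'_def distrib_right)
      finally have "A * (9 / 4 - x\<^sup>2) ^ (\<tau> + 1) \<le> C' * h ^ (n + 1)" .
      then have "xi \<tau> x \<le> C' * h ^ (n + 1)" using True by (simp only: xi_eq_poly A(2) if_True)
      then show ?thesis using xi_nonneg[of \<tau> x] by simp
    next
      case False
      then show ?thesis using C(1) A(1) h by (simp add: xi_eq_poly C'_def)
    qed
    then show ?thesis by (intro exI[of _ 0]) simp
  qed
  then show ?thesis by blast
qed

section \<open>Comparison of the two energies\<close>

text \<open>Writing \<open>q\<close> and \<open>r\<close> for the projections of \<open>g\<close> and \<open>xi \<tau>\<close>, the pointwise inequality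
  \<open>q\<^sup>2 g \<ge> p xi(5/4) (q\<^sup>2 - r\<^sup>2)\<close> holds near the origin because of the lower bound for \<open>g\<close>, and far out
  because there \<open>q = p r\<close> makes the right-hand side nonpositive. It remains to integrate.\<close>

lemma (in wavelet_pair) eventually_weighted_energy_ge:
  assumes f: "locally_bounded f" and f_supp: "\<And>x. f x \<noteq> 0 \<Longrightarrow> \<bar>x\<bar> \<le> 1" and f_nonneg: "\<And>x. 0 \<le> f x"
    and ps: "piecewise_smooth f m n a" and m: "m \<le> d"
    and defect: "left_deriv m f (a 1) \<noteq> right_deriv m f (a 1)"
    and p: "0 < p" "p < 1" and \<tau>: "d \<le> \<tau>"
    and g_def: "g = (\<lambda>x. (1 - p) * f x + p * xi \<tau> x)"
  shows "\<exists>N. \<forall>j\<ge>N. p * xi \<tau> (5 / 4) / 2 * (LINT x|lborel. (Q_proj \<psi> j g x)\<^sup>2)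
           \<le> (LINT x|lborel. (Q_proj \<psi> j g x)\<^sup>2 * g x)"
proof -
  define b where "b = a 1"
  have xi: "locally_bounded (xi \<tau>)" by (rule locally_bounded_xi)
  have g: "locally_bounded g"
    unfolding g_def by (intro locally_bounded_add locally_bounded_mult locally_bounded_const f xi)
  have xi_supp: "\<bar>x\<bar> \<le> 3 / 2" if "xi \<tau> x \<noteq> 0" for x
    using that by (auto simp: xi_eq_poly split: if_splits)
  have g_supp: "\<bar>x\<bar> \<le> 3 / 2" if "g x \<noteq> 0" for x
    using that f_supp[of x] xi_supp[of x] by (force simp: g_def)
  have g_nonneg: "0 \<le> g x" for x
    using p f_nonneg xi_nonneg by (simp add: g_def)

  obtain P\<^sub>1 C\<^sub>1 \<rho>\<^sub>1 where E1: "degree P\<^sub>1 \<le> m" "0 < \<rho>\<^sub>1" "\<And>x. x \<noteq> b \<Longrightarrow> \<bar>x - b\<bar> < \<rho>\<^sub>1 \<Longrightarrow>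
      \<bar>f x - (poly P\<^sub>1 x + (right_deriv m f b - left_deriv m f b) / fact m * trunc_pow b m x)\<bar>
        \<le> C\<^sub>1 * \<bar>x - b\<bar> ^ (m + 1)"
    using first_defect_expansion[OF ps] unfolding b_def by blast
  have b: "b \<in> {-1..1}"
    unfolding b_def
  proof (rule defect_in_support[OF _ defect])
    show "x \<in> {-1..1}" if "f x \<noteq> 0" for x using f_supp[OF that] by (simp add: abs_le_iff)
  qed
  have "b \<in> {-3/2..3/2}" using b by auto
  then obtain P\<^sub>2 C\<^sub>2 where E2: "degree P\<^sub>2 \<le> m"
      "\<And>x. x \<in> {-3/2..3/2} \<Longrightarrow> \<bar>poly (xi_poly \<tau>) x - poly P\<^sub>2 x\<bar> \<le> C\<^sub>2 * \<bar>x - b\<bar> ^ (m + 1)"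
    using poly_taylor_error[of "-3/2" "3/2" m "xi_poly \<tau>"] by metis
  \<comment> \<open>The component \<open>xi \<tau>\<close> is smooth at the defect, so it only changes
    the polynomial and the error term.\<close>
  define P where "P = smult (1 - p) P\<^sub>1 + smult p P\<^sub>2"
  define J where "J = (1 - p) * ((right_deriv m f b - left_deriv m f b) / fact m)"
  define C where "C = (1 - p) * C\<^sub>1 + p * C\<^sub>2"
  define \<rho> where "\<rho> = min \<rho>\<^sub>1 (1 / 2)"
  have "\<exists>\<kappa>>0. \<exists>N. \<forall>j\<ge>N. \<kappa> / 2 ^ j / 4 ^ (m * j) \<le> (LINT x|lborel. (Q_proj \<psi> j g x)\<^sup>2)"
  proof (rule defect_energy_lower_bound[OF g g_supp m])
    show "0 < \<rho>" using E1(2) by (simp add: \<rho>_def)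
    show "degree P \<le> m" unfolding P_def
      using E1(1) E2(1) by (intro degree_add_le order_trans[OF degree_smult_le])
    show "J \<noteq> 0" using defect p by (simp add: J_def b_def)
    show "\<bar>g x - (poly P x + J * trunc_pow b m x)\<bar> \<le> C * \<bar>x - b\<bar> ^ (m + 1)"
      if x: "x \<noteq> b" "\<bar>x - b\<bar> < \<rho>" for x
    proof -
      define e\<^sub>1 where "e\<^sub>1 = f x - (poly P\<^sub>1 x + (right_deriv m f b - left_deriv m f b) / fact m * trunc_pow b m x)"
      define e\<^sub>2 where "e\<^sub>2 = poly (xi_poly \<tau>) x - poly P\<^sub>2 x"
      have "\<bar>x - b\<bar> < 1 / 2" "- 1 \<le> b" "b \<le> 1" using x(2) b by (auto simp: \<rho>_def)
      then have x32: "\<bar>x\<bar> \<le> 3 / 2" by linarith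
      have "\<bar>e\<^sub>1\<bar> \<le> C\<^sub>1 * \<bar>x - b\<bar> ^ (m + 1)"
        unfolding e\<^sub>1_def using x by (intro E1(3)) (auto simp: \<rho>_def)
      moreover have "\<bar>e\<^sub>2\<bar> \<le> C\<^sub>2 * \<bar>x - b\<bar> ^ (m + 1)"
        unfolding e\<^sub>2_def using x32 by (intro E2(2)) auto
      moreover have "g x - (poly P x + J * trunc_pow b m x) = (1 - p) * e\<^sub>1 + p * e\<^sub>2"
        using x32 by (simp add: g_def xi_eq_poly P_def J_def e\<^sub>1_def e\<^sub>2_def algebra_simps)
      moreover have "\<bar>(1 - p) * e\<^sub>1 + p * e\<^sub>2\<bar> \<le> (1 - p) * \<bar>e\<^sub>1\<bar> + p * \<bar>e\<^sub>2\<bar>"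
        using abs_triangle_ineq[of "(1 - p) * e\<^sub>1" "p * e\<^sub>2"] p by (simp add: abs_mult)
      ultimately have "\<bar>g x - (poly P x + J * trunc_pow b m x)\<bar>
          \<le> (1 - p) * (C\<^sub>1 * \<bar>x - b\<bar> ^ (m + 1)) + p * (C\<^sub>2 * \<bar>x - b\<bar> ^ (m + 1))"
        using p by (smt (verit) mult_left_mono)
      then show ?thesis by (simp add: C_def algebra_simps)
    qed
  qed
  then obtain \<kappa> N\<^sub>1 where \<kappa>: "0 < \<kappa>"
    "\<And>j. N\<^sub>1 \<le> j \<Longrightarrow> \<kappa> / 2 ^ j / 4 ^ (m * j) \<le> (LINT x|lborel. (Q_proj \<psi> j g x)\<^sup>2)"
    by blast

  obtain C\<^sub>3 where C3: "\<And>x\<^sub>0 h. 0 < h \<Longrightarrow> h \<le> 1 \<Longrightarrow>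
      \<exists>P. degree P \<le> d \<and> (\<forall>x. \<bar>x - x\<^sub>0\<bar> \<le> h \<longrightarrow> \<bar>xi \<tau> x - poly P x\<bar> \<le> C\<^sub>3 * h ^ (d + 1))"
    using xi_approximation[OF \<tau>] by blast
  have "\<exists>B\<ge>0. \<exists>N. \<forall>j\<ge>N. (LINT x|lborel. (Q_proj \<psi> j (xi \<tau>) x)\<^sup>2) \<le> B / 4 ^ ((d + 1) * j)"
    by (rule smooth_energy_upper_bound[OF xi xi_supp _ C3]) auto
  then obtain B N\<^sub>2 where B: "0 \<le> B"
    "\<And>j. N\<^sub>2 \<le> j \<Longrightarrow> (LINT x|lborel. (Q_proj \<psi> j (xi \<tau>) x)\<^sup>2) \<le> B / 4 ^ ((d + 1) * j)"
    by blast

  \<comment> \<open>From this level on wavelets near \<open>\<bar>x\<bar> > 5/4\<close> do not reach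
    \<open>[-1, 1]\<close>, and the gap \<open>2^j\<close> between the two rates absorbs the
    constants.\<close>
  obtain N\<^sub>3 where N3: "max (8 * c) (2 * B / \<kappa>) \<le> 2 ^ N\<^sub>3"
    using real_arch_pow[of 2 "max (8 * c) (2 * B / \<kappa>)"] by (auto intro: less_imp_le)
  have "p * xi \<tau> (5 / 4) / 2 * (LINT x|lborel. (Q_proj \<psi> j g x)\<^sup>2)
      \<le> (LINT x|lborel. (Q_proj \<psi> j g x)\<^sup>2 * g x)"
    if j: "max N\<^sub>1 (max N\<^sub>2 N\<^sub>3) \<le> j" for j
  proof -
    define q where "q = Q_proj \<psi> j g"
    define r where "r = Q_proj \<psi> j (xi \<tau>)"
    define I where "I = (LINT x|lborel. (q x)\<^sup>2)"
    have "(2::real) ^ N\<^sub>3 \<le> 2 ^ j" using j by simp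
    then have j3: "8 * c \<le> 2 ^ j" "2 * B / \<kappa> \<le> 2 ^ j" using N3 by linarith+
    have q: "locally_bounded q" and r: "locally_bounded r"
      unfolding q_def r_def using g xi by (auto intro: psi.locally_bounded_Q_proj)
    have q_supp: "\<bar>x\<bar> \<le> 3 / 2 + 2 * c / 2 ^ j" if "q x \<noteq> 0" for x
      using psi.Q_proj_support[OF g g_supp] that unfolding q_def by blast
    have r_supp: "\<bar>x\<bar> \<le> 3 / 2 + 2 * c / 2 ^ j" if "r x \<noteq> 0" for x
      using psi.Q_proj_support[OF xi xi_supp] that unfolding r_def by blast
    have far: "q x = p * r x" if x: "5 / 4 < \<bar>x\<bar>" for x
    proof -
      have "q x = Q_proj \<psi> j (\<lambda>y. p * xi \<tau> y) x"
        unfolding q_def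
      proof (rule psi.Q_proj_local[OF g])
        fix y assume "\<bar>y - x\<bar> \<le> 2 * c / 2 ^ j"
        moreover have "2 * c / 2 ^ j \<le> 1 / 4" using j3(1) by (simp add: field_simps)
        ultimately have "1 < \<bar>y\<bar>" using x by linarith
        then have "f y = 0" using f_supp[of y] by linarith
        then show "g y = p * xi \<tau> y" by (simp add: g_def)
      qed (intro locally_bounded_mult locally_bounded_const xi)
      then show ?thesis by (simp add: psi.Q_proj_cmult[OF xi] r_def)
    qed
    have pointwise: "p * xi \<tau> (5 / 4) * ((q x)\<^sup>2 - (r x)\<^sup>2) \<le> (q x)\<^sup>2 * g x" for x
    proof (cases "\<bar>x\<bar> \<le> 5 / 4")
      case True
      have "p * xi \<tau> (5 / 4) \<le> p * xi \<tau> x"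
        using p xi_lower_bound(1)[OF True] by (intro mult_left_mono) auto
      also have "\<dots> \<le> g x" using p f_nonneg[of x] by (simp add: g_def)
      finally have "p * xi \<tau> (5 / 4) * (q x)\<^sup>2 \<le> g x * (q x)\<^sup>2" by (intro mult_right_mono) auto
      moreover have "0 \<le> p * xi \<tau> (5 / 4) * (r x)\<^sup>2" using p xi_nonneg by simp
      ultimately show ?thesis by (simp add: algebra_simps)
    next
      case False
      have "(q x)\<^sup>2 \<le> 1 * (r x)\<^sup>2"
        using far[of x] False p by (simp only: power_mult_distrib)
          (intro mult_right_mono, auto simp: power_le_one)
      then have "p * xi \<tau> (5 / 4) * ((q x)\<^sup>2 - (r x)\<^sup>2) \<le> 0"
        using p xi_nonneg by (intro mult_nonneg_nonpos) auto
      also have "0 \<le> (q x)\<^sup>2 * g x" using g_nonneg by simp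
      finally show ?thesis .
    qed
    have int_q: "integrable lborel (\<lambda>x. (q x)\<^sup>2)"
      by (rule integrable_locally_bounded[OF locally_bounded_power2[OF q], where R = "3 / 2 + 2 * c / 2 ^ j"])
         (use q_supp in simp)
    have int_r: "integrable lborel (\<lambda>x. (r x)\<^sup>2)"
      by (rule integrable_locally_bounded[OF locally_bounded_power2[OF r], where R = "3 / 2 + 2 * c / 2 ^ j"])
         (use r_supp in simp)
    have int_g: "integrable lborel (\<lambda>x. (q x)\<^sup>2 * g x)"
      by (rule integrable_locally_bounded_mult[OF locally_bounded_power2[OF q] g g_supp])
    have "2 * (LINT x|lborel. (r x)\<^sup>2) \<le> I"
    proof -
      have "2 * (LINT x|lborel. (r x)\<^sup>2) \<le> 2 * B / 4 ^ ((d + 1) * j)"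
        using B(2)[of j] j unfolding r_def by simp
      also have "\<dots> = 2 * B / 2 ^ j / 2 ^ j / 4 ^ (d * j)"
      proof -
        have "(4::real) ^ ((d + 1) * j) = 2 ^ j * 2 ^ j * 4 ^ (d * j)"
          by (simp add: power_add power_mult_distrib[symmetric])
        then show ?thesis by (simp only: divide_divide_eq_left mult.assoc)
      qed
      also have "\<dots> \<le> \<kappa> / 2 ^ j / 4 ^ (d * j)"
        using j3(2) \<kappa>(1) by (intro divide_right_mono) (simp_all add: field_simps)
      also have "\<dots> \<le> \<kappa> / 2 ^ j / 4 ^ (m * j)"
        using \<kappa>(1) m by (intro divide_left_mono power_increasing) auto
      also have "\<dots> \<le> I" using \<kappa>(2)[of j] j unfolding I_def q_def by simp
      finally show ?thesis .
    qed
    then have "p * xi \<tau> (5 / 4) * (I / 2) \<le> p * xi \<tau> (5 / 4) * (I - (LINT x|lborel. (r x)\<^sup>2))"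
      using p xi_nonneg by (intro mult_left_mono) auto
    also have "\<dots> = (LINT x|lborel. p * xi \<tau> (5 / 4) * ((q x)\<^sup>2 - (r x)\<^sup>2))"
      using int_q int_r by (simp add: I_def)
    also have "\<dots> \<le> (LINT x|lborel. (q x)\<^sup>2 * g x)"
      using int_q int_r int_g pointwise by (intro integral_mono) auto
    finally show ?thesis by (simp add: I_def q_def)
  qed
  then show ?thesis by blast
qed

theorem theorem5p1:
  fixes r S d N\<^sub>S :: nat
    and \<phi> \<psi> f \<xi> f\<^sub>\<pi> :: "real \<Rightarrow> real"
    and \<Delta>\<^sub>1 \<Delta>\<^sub>2 \<pi> :: real
  assumes "RWB r S \<phi> \<psi>"
    and "vanishing_order r \<psi> d"
    and "0 < \<Delta>\<^sub>1" and "\<Delta>\<^sub>1 \<le> \<Delta>\<^sub>2"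
    and "prob_density f"
    and "f \<in> S_class {-1..1} d \<Delta>\<^sub>1 \<Delta>\<^sub>2 N\<^sub>S"
    and "\<xi> = xi (d + 2)"
    and "0 < \<pi>" and "\<pi> < 1"
    and "f\<^sub>\<pi> = (\<lambda>x. (1 - \<pi>) * f x + \<pi> * \<xi> x)"
  shows "regular_with \<psi> (\<pi> * \<xi> (5/4) / 2) f\<^sub>\<pi> \<and>
    (\<exists>N. \<forall>j\<ge>N. sqrt (LINT x|lborel. (Q_proj \<psi> j f\<^sub>\<pi> x)\<^sup>2 * f\<^sub>\<pi> x)
                 \<ge> sqrt (\<pi> * \<xi> (5/4) / 2) * L2_norm (Q_proj \<psi> j f\<^sub>\<pi>))"
proof -
  obtain c where "wavelet_pair \<phi> \<psi> c d"
    using RWB_imp_wavelet_pair[OF assms(1,2)] by blast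
  then interpret wavelet_pair \<phi> \<psi> c d .
  obtain m n a where supp: "supp f \<subseteq> {-1..1}" and ps: "piecewise_smooth f m n a" and m: "m \<le> d"
    and jumps: "\<forall>i\<in>{1..n}. \<Delta>\<^sub>1 \<le> \<bar>left_deriv m f (a i) - right_deriv m f (a i)\<bar>"
    using assms(6) unfolding S_class_def by blast
  have f_supp: "\<bar>x\<bar> \<le> 1" if "f x \<noteq> 0" for x
  proof -
    have "x \<in> supp f" unfolding supp_def by (rule closure_subset[THEN subsetD]) (simp add: that)
    then show ?thesis using supp by (auto simp: abs_le_iff)
  qed
  obtain M where M: "\<And>x. \<bar>f x\<bar> \<le> M"
    using piecewise_smooth_bounded[OF ps f_supp] by blast
  have f: "locally_bounded f"
    using assms(5) M by (intro locally_boundedI) (auto simp: prob_density_def)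
  \<comment> \<open>At every defect the jump is at least \<open>\<Delta>\<^sub>1 > 0\<close>, so the first one will do.\<close>
  have "1 \<le> n" using ps unfolding piecewise_smooth_def by auto
  then have "\<Delta>\<^sub>1 \<le> \<bar>left_deriv m f (a 1) - right_deriv m f (a 1)\<bar>" using jumps by simp
  then have defect: "left_deriv m f (a 1) \<noteq> right_deriv m f (a 1)" using assms(3) by auto
  have g_def: "f\<^sub>\<pi> = (\<lambda>x. (1 - \<pi>) * f x + \<pi> * xi (d + 2) x)" using assms(7,10) by simp
  obtain N where N: "\<And>j. N \<le> j \<Longrightarrow> \<pi> * \<xi> (5 / 4) / 2 * (LINT x|lborel. (Q_proj \<psi> j f\<^sub>\<pi> x)\<^sup>2)
      \<le> (LINT x|lborel. (Q_proj \<psi> j f\<^sub>\<pi> x)\<^sup>2 * f\<^sub>\<pi> x)"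
    using eventually_weighted_energy_ge[OF f f_supp _ ps m defect assms(8,9) _ g_def] assms(5,7)
    by (auto simp: prob_density_def)
  have C: "0 < \<pi> * \<xi> (5 / 4) / 2"
    using assms(7,8) xi_lower_bound(2)[of 0 "d + 2"] by simp
  have g_supp: "\<bar>x\<bar> \<le> 3 / 2" if "f\<^sub>\<pi> x \<noteq> 0" for x
    using that f_supp[of x] by (force simp: g_def xi_eq_poly split: if_splits)
  have "bounded (range f\<^sub>\<pi>)"
  proof -
    have "locally_bounded f\<^sub>\<pi>"
      unfolding g_def by (intro locally_bounded_add locally_bounded_mult locally_bounded_const f locally_bounded_xi)
    then obtain K where "0 \<le> K" "\<And>x. \<bar>x\<bar> \<le> 3 / 2 \<Longrightarrow> \<bar>f\<^sub>\<pi> x\<bar> \<le> K"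
      using locally_bounded_bound by blast
    then have "\<bar>f\<^sub>\<pi> x\<bar> \<le> K" for x using g_supp[of x] by (cases "f\<^sub>\<pi> x = 0") auto
    then show ?thesis unfolding bounded_iff by auto
  qed
  moreover have "compact (supp f\<^sub>\<pi>)"
  proof -
    have "supp f\<^sub>\<pi> \<subseteq> {-3/2..3/2}"
      unfolding supp_def
    proof (rule closure_minimal)
      show "{x. f\<^sub>\<pi> x \<noteq> 0} \<subseteq> {-3/2..3/2}"
      proof
        fix x assume "x \<in> {x. f\<^sub>\<pi> x \<noteq> 0}"
        then have "\<bar>x\<bar> \<le> 3 / 2" using g_supp[of x] by simp
        then show "x \<in> {-3/2..3/2}" by auto
      qed
    qed simp
    moreover have "closed (supp f\<^sub>\<pi>)" by (simp add: supp_def)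
    ultimately show ?thesis by (meson bounded_closed_interval bounded_subset compact_eq_bounded_closed)
  qed
  ultimately have "regular_with \<psi> (\<pi> * \<xi> (5/4) / 2) f\<^sub>\<pi>"
    unfolding regular_with_def using C N by (simp add: power2_abs) blast
  moreover have "sqrt (\<pi> * \<xi> (5/4) / 2) * L2_norm (Q_proj \<psi> j f\<^sub>\<pi>)
      \<le> sqrt (LINT x|lborel. (Q_proj \<psi> j f\<^sub>\<pi> x)\<^sup>2 * f\<^sub>\<pi> x)" if "N \<le> j" for j
    unfolding L2_norm_def real_sqrt_mult[symmetric] using N[OF that] by (rule real_sqrt_le_mono)
  ultimately show ?thesis by blast
qed

end
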